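(* Let $n\geq 1$ and $k:=[\frac{n}{2}]+1$. Let $\sigma:\mathbb{Z}^n\rightarrow\mathbb{C}$ satisfy $$|\Delta_{\xi}^{\alpha}\sigma(\xi)|\leq C_\alpha\langle\xi\rangle^{-|\alpha|},\qquad \xi\in\mathbb{Z}^n,$$ for all $\alpha\in\mathbb{N}^n$ with $|\alpha|\leq k$, with constants $C_\alpha>0$. Then the periodic operator $\sigma(D)$ is bounded from $L^1(\mathbb{T}^n)$ into $L^p(\mathbb{T}^n)$ for all $0<p<1$.
   Context: $\mathbb{T}^n=\mathbb{R}^n/\mathbb{Z}^n$ with normalized Lebesgue measure; $\mathbb{N}=\{0,1,2,\dots\}$; $[\cdot]$ denotes the integer part; $\langle\xi\rangle=(1+|\xi|^2)^{1/2}$. The toroidal Fourier transform is $\widehat{f}(\xi)=\int_{\mathbb{T}^n}e^{-i2\pi\langle x,\xi\rangle}f(x)\,dx$, $\xi\in\mathbb{Z}^n$. For $f:\mathbb{Z}^n\to\mathbb{C}$ and the canonical basis $(e_j)$, $(\Delta_{\xi_j}f)(\xi)=f(\xi+e_j)-f(\xi)$, and $\Delta_\xi^\alpha=\Delta_{\xi_1}^{\alpha_1}\cdots\Delta_{\xi_n}^{\alpha_n}$. The periodic Fourier multiplier with symbol $\sigma(\xi)$ is $\sigma(D)f(x)=\sum_{\xi\in\mathbb{Z}^n}e^{i2\pi\langle x,\xi\rangle}\sigma(\xi)\widehat{f}(\xi)$ for $f\in C^\infty(\mathbb{T}^n)$. Boundedness from $L^1$ to $L^p$ with $0<p<1$ means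 that there is $C>0$ such that $\left(\int_{\mathbb{T}^n}|\sigma(D)f(x)|^p\,dx\right)^{1/p}\leq C\|f\|_{L^1(\mathbb{T}^n)}$ for all $f\in C^\infty(\mathbb{T}^n)$, so that $\sigma(D)$ extends by density to $L^1(\mathbb{T}^n)$. *)

theory Defs
  imports "HOL-Analysis.Analysis"
begin

text \<open>The lattice \<open>\<int>\<^sup>n\<close> is the type \<^typ>\<open>int ^ 'n\<close>, so that the dimension is
  \<^term>\<open>CARD('n)\<close>, which is automatically at least 1.\<close>

definition lattice_vec :: "int ^ 'n \<Rightarrow> real ^ 'n" where
  "lattice_vec \<xi> = (\<chi> j. real_of_int (\<xi> $ j))"

definition japanese :: "int ^ 'n \<Rightarrow> real" where
  "japanese \<xi> = sqrt (1 + (norm (lattice_vec \<xi>))\<^sup>2)"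


subsection \<open>Difference operators\<close>

definition forward_diff :: "'n \<Rightarrow> (int ^ 'n \<Rightarrow> complex) \<Rightarrow> (int ^ 'n \<Rightarrow> complex)" where
  "forward_diff j f = (\<lambda>\<xi>. f (\<xi> + axis j 1) - f \<xi>)"

definition multi_abs :: "nat ^ 'n \<Rightarrow> nat" where
  "multi_abs \<alpha> = (\<Sum>j\<in>UNIV. \<alpha> $ j)"

text \<open>The index type carries no order; the composition over all directions is well defined
  because the factors commute (see \<open>comp_fun_commute_forward_diff\<close> below).\<close>

definition diff_op :: "nat ^ 'n \<Rightarrow> (int ^ 'n \<Rightarrow> complex) \<Rightarrow> (int ^ 'n \<Rightarrow> complex)" where
  "diff_op \<alpha> f = Finite_Set.fold (\<lambda>j. forward_diff j ^^ (\<alpha> $ j)) f UNIV"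

lemma forward_diff_commute:
  "forward_diff i (forward_diff j f) = forward_diff j (forward_diff i f)"
  by (simp add: forward_diff_def fun_eq_iff algebra_simps)

lemma forward_diff_funpow_commute1:
  "(forward_diff i ^^ a) (forward_diff j f) = forward_diff j ((forward_diff i ^^ a) f)"
  by (induction a) (simp_all add: forward_diff_commute[of i j])

lemma forward_diff_funpow_commute:
  "(forward_diff i ^^ a) ((forward_diff j ^^ b) f) = (forward_diff j ^^ b) ((forward_diff i ^^ a) f)"
  by (induction b) (simp_all add: forward_diff_funpow_commute1)

lemma comp_fun_commute_forward_diff:
  "comp_fun_commute (\<lambda>j. forward_diff j ^^ ((\<alpha> :: nat ^ 'n) $ j))"
  by unfold_locales (simp add: fun_eq_iff[of "_ \<circ> _"] forward_diff_funpow_commute)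


subsection \<open>Functions on the torus\<close>

text \<open>A function on \<open>\<real>\<^sup>n / \<int>\<^sup>n\<close> is a \<open>\<int>\<^sup>n\<close>-periodic function on \<open>\<real>\<^sup>n\<close>, and
  the normalized measure is Lebesgue measure on the fundamental domain \<open>[0,1]\<^sup>n\<close>
  (\<^term>\<open>1 :: real ^ 'n\<close> is the all-ones vector).\<close>

definition periodic :: "(real ^ 'n \<Rightarrow> complex) \<Rightarrow> bool" where
  "periodic f \<longleftrightarrow> (\<forall>x m. f (x + lattice_vec m) = f x)"

primrec times_cont_diff :: "nat \<Rightarrow> (real ^ 'n \<Rightarrow> complex) \<Rightarrow> bool" where
  "times_cont_diff 0 f \<longleftrightarrow> continuous_on UNIV f"
| "times_cont_diff (Suc m) f \<longleftrightarrow>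
     (\<forall>x. f differentiable (at x)) \<and>
     (\<forall>v. times_cont_diff m (\<lambda>x. frechet_derivative f (at x) v))"

definition torus_smooth :: "(real ^ 'n \<Rightarrow> complex) set" where
  "torus_smooth = {f. periodic f \<and> (\<forall>m. times_cont_diff m f)}"

definition fourier_coeff :: "(real ^ 'n \<Rightarrow> complex) \<Rightarrow> int ^ 'n \<Rightarrow> complex" where
  "fourier_coeff f \<xi> =
     (LINT x : cbox 0 1 | lborel. exp (- \<i> * 2 * pi * of_real (x \<bullet> lattice_vec \<xi>)) * f x)"

text \<open>For \<open>f\<close> in \<^const>\<open>torus_smooth\<close> the Fourier coefficients decay faster than any power,
  so for bounded \<open>\<sigma>\<close> the series below converges absolutely at every \<open>x\<close>.\<close>

definition fourier_multiplier ::
    "(int ^ 'n \<Rightarrow> complex) \<Rightarrow> (real ^ 'n \<Rightarrow> complex) \<Rightarrow> (real ^ 'n \<Rightarrow> complex)" where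
  "fourier_multiplier \<sigma> f = (\<lambda>x.
     \<Sum>\<^sub>\<infinity>\<xi>\<in>UNIV. exp (\<i> * 2 * pi * of_real (x \<bullet> lattice_vec \<xi>)) * \<sigma> \<xi> * fourier_coeff f \<xi>)"

text \<open>Integrability of \<open>|T f|\<^sup>p\<close> is part of the bound: the Bochner integral of a
  non-integrable function is 0, which would make the inequality hold vacuously.\<close>

definition bounded_L1_Lp ::
    "((real ^ 'n \<Rightarrow> complex) \<Rightarrow> (real ^ 'n \<Rightarrow> complex)) \<Rightarrow> real \<Rightarrow> bool" where
  "bounded_L1_Lp T p \<longleftrightarrow>
     (\<exists>C>0. \<forall>f\<in>torus_smooth.
        set_integrable lborel (cbox 0 1) (\<lambda>x. norm (T f x) powr p) \<and>
        (LINT x : cbox 0 1 | lborel. norm (T f x) powr p) powr (1 / p)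
          \<le> C * (LINT x : cbox 0 1 | lborel. norm (f x)))"

end

theory Submission
  imports Defs
begin

text \<open>
  Cut the symbol off at \<open>|\<xi>| < 2\<^sup>J\<close> and write the result as \<open>\<sigma>(0)\<close> at the origin plus dyadic pieces
  \<open>\<tau>\<^sub>j\<close> living at \<open>|\<xi>| \<le> 3\<cdot>2\<^sup>j\<close>. With \<open>n\<close> the dimension, the \<open>k\<close>-th differences of \<open>\<tau>\<^sub>j\<close> have squared
  \<open>\<ell>\<^sup>2\<close> norm \<open>O(2\<^sup>j\<^sup>(\<^sup>n\<^sup>-\<^sup>2\<^sup>k\<^sup>))\<close>, so by Parseval and Cauchy--Schwarz with the weight \<open>|x|\<^sup>2\<^sup>k\<close>, where \<open>2k > n\<close>,
  the kernel \<open>K\<^sub>j\<close> has \<open>L\<^sup>1\<close> mass at most a negative power of \<open>2\<^sup>jr\<close> outside the ball of radius \<open>r\<close>. For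
  \<open>2\<^sup>j|y| \<le> 1\<close> the piece \<open>\<tau>\<^sub>j(\<xi>)(e\<^sup>-\<^sup>2\<^sup>\<pi>\<^sup>i\<^sup>y\<^sup>\<xi> - 1)\<close> obeys the same bounds with an extra factor \<open>2\<^sup>j|y|\<close>. Summing over
  \<open>j\<close> gives Hoermander's condition uniformly in \<open>J\<close>; the Calderon--Zygmund decomposition turns it into
  a weak type (1,1) bound, which integrates to \<open>L\<^sup>1 \<rightarrow> L\<^sup>p\<close> for \<open>p < 1\<close>, and Fatou's lemma lets \<open>J \<rightarrow> \<infinity>\<close>.
\<close>

section \<open>Integration over the torus and trigonometric polynomials\<close>

text \<open>The choice of k makes 2k equal to n + 1 or n + 2. The inequality n < 2k makes the
  inverse weight integrable away from the lattice, uniformly enough to give decay in the radius. The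
  inequality 2k < n + 4 makes the squares of
  \<open>(japanese \<xi>)\<^sup>2 / japanese \<xi> ^ k\<close>, summed over a ball of frequencies,
  comparable to the contribution of the outermost shell. The 4 is twice the order to which a dyadic
  piece gains at low frequencies. This gain is why the cutoff is built from a quadratic:
  \<open>1 - nsq \<xi> / N\<^sup>2\<close>, truncated at 0 and raised to the power k, leaves the
  value 1 only quadratically at the origin and has explicit differences. Cauchy--Schwarz enters as
  2uv \<le> t u^2 + v^2 / t with a free parameter t, so that only integrals of squares have to be
  computed; t is chosen afterwards to balance the two terms. Uniformity in J is required of the L2
  norm as well as of the kernel; the former holds because all cutoffs are bounded by 1.\<close>

definition chr :: "int ^ 'n \<Rightarrow> real ^ 'n \<Rightarrow> complex" where
  "chr \<xi> x = cis (2 * pi * (x \<bullet> lattice_vec \<xi>))"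

lemma lattice_vec_nth [simp]: "lattice_vec \<xi> $ i = real_of_int (\<xi> $ i)"
  by (simp add: lattice_vec_def)

lemma lattice_vec_add: "lattice_vec (\<xi> + \<eta>) = lattice_vec \<xi> + lattice_vec \<eta>"
  by (simp add: vec_eq_iff)

lemma lattice_vec_minus: "lattice_vec (- \<xi>) = - lattice_vec \<xi>"
  by (simp add: vec_eq_iff)

lemma lattice_vec_0 [simp]: "lattice_vec 0 = 0"
  by (simp add: vec_eq_iff)

lemma chr_0 [simp]: "chr 0 x = 1"
  by (simp add: chr_def)

lemma norm_chr [simp]: "norm (chr \<xi> x) = 1"
  by (simp add: chr_def)

lemma chr_add: "chr (\<xi> + \<eta>) x = chr \<xi> x * chr \<eta> x"
  by (simp add: chr_def lattice_vec_add inner_add_right cis_mult algebra_simps)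

lemma chr_add_right: "chr \<xi> (x + y) = chr \<xi> x * chr \<xi> y"
  by (simp add: chr_def inner_add_left cis_mult algebra_simps)

lemma chr_minus: "chr (- \<xi>) x = cnj (chr \<xi> x)"
  by (simp add: chr_def lattice_vec_minus cis_cnj)

lemma chr_minus_right: "chr \<xi> (- x) = cnj (chr \<xi> x)"
  by (simp add: chr_def cis_cnj)

lemma chr_diff: "chr (\<xi> - \<eta>) x = chr \<xi> x * cnj (chr \<eta> x)"
  using chr_add[of \<xi> "- \<eta>" x] by (simp add: chr_minus)

lemma chr_diff_right: "chr \<xi> (x - y) = chr \<xi> x * cnj (chr \<xi> y)"
  using chr_add_right[of \<xi> x "- y"] by (simp add: chr_minus_right)

lemma chr_lattice_vec [simp]: "chr \<xi> (lattice_vec m) = 1"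
proof -
  have "lattice_vec m \<bullet> lattice_vec \<xi> = real_of_int (\<Sum>i\<in>UNIV. m $ i * \<xi> $ i)"
    by (simp add: inner_vec_def)
  then show ?thesis
    unfolding chr_def by (metis Ints_of_int cis_multiple_2pi)
qed

lemma chr_axis: "chr \<xi> (axis i t) = cis (2 * pi * t * of_int (\<xi> $ i))"
  by (simp add: chr_def inner_axis' mult_ac)

lemma continuous_on_chr [continuous_intros]: "continuous_on S (chr \<xi>)"
  unfolding chr_def cis_conv_exp by (intro continuous_intros)

lemma borel_measurable_chr [measurable]: "chr \<xi> \<in> borel_measurable borel"
  by (intro borel_measurable_continuous_onI continuous_on_chr)

lemma borel_measurable_cnj [measurable]:
  "f \<in> borel_measurable M \<Longrightarrow> (\<lambda>x. cnj (f x)) \<in> borel_measurable M"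
  by (rule measurable_compose[OF _ borel_measurable_continuous_onI[OF continuous_on_cnj[OF continuous_on_id]]])

section \<open>The torus measure and its translation invariance\<close>

definition fund :: "(real ^ 'n) set" where
  "fund = {x. \<forall>i. 0 \<le> x $ i \<and> x $ i < 1}"

text \<open>The torus is modelled on the whole space: functions stay periodic there and the mass
  sits on a half-open cube. Half-openness makes the lattice translates of \<open>fund\<close> a
  partition and \<open>fund\<close> itself a dyadic cell; the closed cube of the statement differs
  from it by a null set.\<close>

definition torus :: "(real ^ 'n) measure" where
  "torus = density lborel (indicator fund)"

lemma fund_measurable [measurable]: "fund \<in> sets borel"
  unfolding fund_def by measurable

lemma sets_torus [measurable_cong, simp]: "sets torus = sets borel"
  by (simp add: torus_def)

lemma space_torus [simp]: "space torus = UNIV"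
  by (simp add: torus_def)

lemma nn_integral_torus:
  assumes [measurable]: "F \<in> borel_measurable borel"
  shows "(\<integral>\<^sup>+x. F x \<partial>torus) = (\<integral>\<^sup>+x. indicator fund x * F x \<partial>lborel)"
  unfolding torus_def by (subst nn_integral_density) auto

lemma box_subset_fund: "box 0 1 \<subseteq> (fund :: (real ^ 'n) set)"
  by (auto simp: fund_def mem_box_cart less_imp_le)

lemma fund_subset_cbox: "(fund :: (real ^ 'n) set) \<subseteq> cbox 0 1"
  by (auto simp: fund_def mem_box_cart less_imp_le)

lemma AE_fund_cbox: "AE x in lborel. x \<in> (fund :: (real ^ 'n) set) \<longleftrightarrow> x \<in> cbox 0 1"
proof (rule AE_I')
  show "cbox 0 1 - box 0 (1 :: real ^ 'n) \<in> null_sets lborel"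
    using emeasure_lborel_cbox_eq[of 0 "1 :: real ^ 'n"] emeasure_lborel_box_eq[of 0 "1 :: real ^ 'n"]
    by (intro null_setsI) (auto simp: emeasure_Diff box_subset_cbox)
  show "{x \<in> space lborel. \<not> (x \<in> (fund :: (real ^ 'n) set) \<longleftrightarrow> x \<in> cbox 0 1)} \<subseteq> cbox 0 1 - box 0 1"
    using box_subset_fund fund_subset_cbox by auto
qed

lemma emeasure_torus: "A \<in> sets borel \<Longrightarrow> emeasure torus A = emeasure lborel (fund \<inter> A)"
  unfolding torus_def by (subst emeasure_density) (auto simp flip: indicator_inter_arith)

lemma emeasure_torus_UNIV [simp]: "emeasure (torus :: (real ^ 'n) measure) UNIV = 1"
proof -
  have "emeasure lborel (fund :: (real ^ 'n) set) = emeasure lborel (cbox 0 (1 :: real ^ 'n))"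
    using AE_fund_cbox by (intro emeasure_eq_AE) auto
  also have "\<dots> = 1"
    proof -
    have "(\<Prod>b\<in>Basis. (1 :: real ^ 'n) \<bullet> b) = 1"
      by (rule prod.neutral) (auto simp: Basis_vec_def inner_axis)
    then show ?thesis
      by (subst emeasure_lborel_cbox_eq) (auto simp: Basis_vec_def inner_axis)
  qed
  finally show ?thesis by (simp add: emeasure_torus)
qed

interpretation torus: finite_measure "torus :: (real ^ 'n) measure"
  by standard simp

lemma measure_torus_UNIV [simp]: "measure (torus :: (real ^ 'n) measure) UNIV = 1"
  by (simp add: measure_def)

lemma integral_torus:
  fixes F :: "real ^ 'n \<Rightarrow> 'b :: {banach, second_countable_topology}"
  assumes [measurable]: "F \<in> borel_measurable borel"
  shows "integral\<^sup>L torus F = (LINT x : cbox 0 1 | lborel. F x)"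
proof -
  have "integral\<^sup>L torus F = (LINT x | lborel. indicator fund x *\<^sub>R F x)"
  proof -
    have "torus = density lborel (\<lambda>x :: real ^ 'n. ennreal (indicator fund x))"
      by (simp add: torus_def ennreal_indicator)
    then show ?thesis by (subst \<open>torus = _\<close>, subst integral_density) auto
  qed
  also have "\<dots> = (LINT x | lborel. indicator (cbox 0 1) x *\<^sub>R F x)"
    by (rule integral_cong_AE) (use AE_fund_cbox in \<open>auto simp: indicator_def\<close>)
  finally show ?thesis by (simp add: set_lebesgue_integral_def)
qed

lemma integrable_torus_bounded:
  fixes F :: "real ^ 'n \<Rightarrow> 'b :: {banach, second_countable_topology}"
  assumes "F \<in> borel_measurable borel" and "\<And>x. norm (F x) \<le> B"
  shows "integrable torus F"
  by (rule torus.integrable_const_bound[where B = B]) (use assms in auto)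

definition lperiodic :: "(real ^ 'n \<Rightarrow> 'b) \<Rightarrow> bool" where
  "lperiodic F \<longleftrightarrow> (\<forall>x m. F (x + lattice_vec m) = F x)"

lemma lperiodicD: "lperiodic F \<Longrightarrow> F (x + lattice_vec m) = F x"
  by (simp add: lperiodic_def)

lemma lperiodic_compose: "lperiodic F \<Longrightarrow> lperiodic (\<lambda>x. h (F x))"
  by (simp add: lperiodic_def)

lemma nn_integral_lborel_translation:
  fixes F :: "real ^ 'n \<Rightarrow> ennreal"
  assumes [measurable]: "F \<in> borel_measurable borel"
  shows "(\<integral>\<^sup>+x. F (x + a) \<partial>lborel) = (\<integral>\<^sup>+x. F x \<partial>lborel)"
proof -
  have "(\<integral>\<^sup>+x. F x \<partial>lborel) = (\<integral>\<^sup>+x. F x \<partial>distr lborel borel ((+) a))"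
    by (simp add: lborel_distr_plus)
  also have "\<dots> = (\<integral>\<^sup>+x. F (x + a) \<partial>lborel)"
    by (subst nn_integral_distr) (auto simp: add.commute)
  finally show ?thesis by simp
qed

text \<open>The translates partition the space: z lies in the one whose index is the coordinatewise
  floor of z.\<close>

lemma nn_integral_fund_translates:
  fixes z :: "real ^ 'n"
  shows "(\<integral>\<^sup>+m. indicator fund (z - lattice_vec m) \<partial>count_space UNIV) = 1"
proof -
  define m0 :: "int ^ 'n" where "m0 = (\<chi> i. \<lfloor>z $ i\<rfloor>)"
  have "z - lattice_vec m \<in> fund \<longleftrightarrow> m = m0" for m
    unfolding fund_def m0_def vec_eq_iff mem_Collect_eq
    by (rule iff_allI) (simp, linarith)
  then have "(\<lambda>m. indicator fund (z - lattice_vec m)) = (indicator {m0} :: _ \<Rightarrow> ennreal)"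
    by (auto simp: fun_eq_iff indicator_def)
  then show ?thesis by simp
qed

text \<open>Multiply by the partition of unity formed by the translates of \<open>fund\<close>,
  exchange sum and integral, and move each translate back to \<open>fund\<close>. By periodicity of
  F only the other indicator is shifted, and its translates sum to 1 as well.\<close>

lemma nn_integral_torus_translation:
  fixes F :: "real ^ 'n \<Rightarrow> ennreal"
  assumes [measurable]: "F \<in> borel_measurable borel" and "lperiodic F"
  shows "(\<integral>\<^sup>+x. F (x + y) \<partial>torus) = (\<integral>\<^sup>+x. F x \<partial>torus)"
proof -
  have per: "F (x + lattice_vec m) = F x" for x m using assms(2) by (simp add: lperiodic_def)
  have "(\<integral>\<^sup>+x. F (x + y) \<partial>torus) = (\<integral>\<^sup>+x. indicator fund x * F (x + y) \<partial>lborel)"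
    by (simp add: nn_integral_torus)
  also have "\<dots> = (\<integral>\<^sup>+x. indicator fund (x - y) * F x \<partial>lborel)"
    using nn_integral_lborel_translation[of "\<lambda>x. indicator fund (x - y) * F x" y] by simp
  also have "\<dots> = (\<integral>\<^sup>+x. \<integral>\<^sup>+m. indicator fund (x - lattice_vec m) * (indicator fund (x - y) * F x)
      \<partial>count_space UNIV \<partial>lborel)"
    by (simp add: nn_integral_multc nn_integral_fund_translates)
  also have "\<dots> = (\<integral>\<^sup>+m. \<integral>\<^sup>+x. indicator fund (x - lattice_vec m) * (indicator fund (x - y) * F x)
      \<partial>lborel \<partial>count_space UNIV)"
    by (subst nn_integral_count_space_nn_integral) auto
  also have "\<dots> = (\<integral>\<^sup>+m. \<integral>\<^sup>+x. indicator fund x * (indicator fund (x - y - lattice_vec m) * F x)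
      \<partial>lborel \<partial>count_space UNIV)"
  proof -
    have "(\<integral>\<^sup>+x. indicator fund (x - lattice_vec m) * (indicator fund (x - y) * F x) \<partial>lborel)
        = (\<integral>\<^sup>+x. indicator fund x * (indicator fund (x + lattice_vec m - y) * F x) \<partial>lborel)" for m
      using nn_integral_lborel_translation[of "\<lambda>x. indicator fund (x - lattice_vec m) * (indicator fund (x - y) * F x)" "lattice_vec m"]
      by (simp add: per)
    then have "(\<integral>\<^sup>+m. \<integral>\<^sup>+x. indicator fund (x - lattice_vec m) * (indicator fund (x - y) * F x)
      \<partial>lborel \<partial>count_space UNIV) = (\<integral>\<^sup>+m. \<integral>\<^sup>+x. indicator fund x * (indicator fund (x + lattice_vec m - y) * F x)
      \<partial>lborel \<partial>count_space UNIV)" by simp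
    \<comment> \<open>Reversing the sign of m brings the shifted indicator into the form of the
      partition of unity.\<close>
    also have "\<dots> = (\<integral>\<^sup>+m. \<integral>\<^sup>+x. indicator fund x * (indicator fund (x + lattice_vec (- m) - y) * F x)
      \<partial>lborel \<partial>count_space UNIV)"
      by (subst nn_integral_bij_count_space[where g = uminus and A = UNIV and B = UNIV, symmetric])
        (auto intro!: bij_uminus)
    finally show ?thesis
      by (simp add: lattice_vec_minus algebra_simps)
  qed
  also have "\<dots> = (\<integral>\<^sup>+x. \<integral>\<^sup>+m. indicator fund x * (indicator fund (x - y - lattice_vec m) * F x)
      \<partial>count_space UNIV \<partial>lborel)"
    by (subst nn_integral_count_space_nn_integral) auto
  also have "\<dots> = (\<integral>\<^sup>+x. indicator fund x * F x \<partial>lborel)"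
    by (simp add: nn_integral_multc nn_integral_cmult nn_integral_fund_translates)
  finally show ?thesis by (simp add: nn_integral_torus)
qed

lemma integral_torus_translation:
  fixes F :: "real ^ 'n \<Rightarrow> real"
  assumes [measurable]: "F \<in> borel_measurable borel" and "lperiodic F" and nonneg: "\<And>x. 0 \<le> F x"
  shows "(\<integral>x. F (x + y) \<partial>torus) = (\<integral>x. F x \<partial>torus)"
proof -
  have "(\<integral>x. F (x + y) \<partial>torus) = enn2real (\<integral>\<^sup>+x. ennreal (F (x + y)) \<partial>torus)"
    using nonneg by (subst integral_eq_nn_integral) auto
  also have "(\<integral>\<^sup>+x. ennreal (F (x + y)) \<partial>torus) = (\<integral>\<^sup>+x. ennreal (F x) \<partial>torus)"
    using assms(2) by (intro nn_integral_torus_translation) (auto simp: lperiodic_def)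
  also have "enn2real \<dots> = (\<integral>x. F x \<partial>torus)"
    using nonneg by (subst integral_eq_nn_integral) auto
  finally show ?thesis .
qed

text \<open>A translation by half the diagonal. In the centred cube 0 is a nearest lattice point, so
  distances to the lattice can be read off the coordinates.\<close>

lemma nn_integral_torus_centred:
  fixes F :: "real ^ 'n \<Rightarrow> ennreal"
  assumes [measurable]: "F \<in> borel_measurable borel" and "lperiodic F"
  shows "(\<integral>\<^sup>+x. F x \<partial>torus) = (\<integral>\<^sup>+x. indicator {x. \<forall>i. - 1/2 \<le> x $ i \<and> x $ i < 1/2} x * F x \<partial>lborel)"
proof -
  define h :: "real ^ 'n" where "h = (\<chi> i. 1/2)"
  have "(\<integral>\<^sup>+x. F x \<partial>torus) = (\<integral>\<^sup>+x. F (x + - h) \<partial>torus)"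
    using assms by (intro nn_integral_torus_translation[symmetric])
  also have "\<dots> = (\<integral>\<^sup>+x. indicator fund x * F (x + - h) \<partial>lborel)"
    by (simp add: nn_integral_torus)
  also have "\<dots> = (\<integral>\<^sup>+x. indicator fund (x + h) * F x \<partial>lborel)"
    using nn_integral_lborel_translation[of "\<lambda>x. indicator fund (x + h) * F x" "- h"] by simp
  also have "(\<lambda>x. indicator fund (x + h) :: ennreal) = indicator {x. \<forall>i. - 1/2 \<le> x $ i \<and> x $ i < 1/2}"
  proof -
    have "x + h \<in> fund \<longleftrightarrow> (\<forall>i. - 1/2 \<le> x $ i \<and> x $ i < 1/2)" for x
      unfolding fund_def h_def mem_Collect_eq by (rule iff_allI) (simp, linarith)
    then show ?thesis by (auto simp: fun_eq_iff indicator_def)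
  qed
  finally show ?thesis .
qed

lemma lperiodic_chr: "lperiodic (chr \<xi>)"
  by (simp add: lperiodic_def chr_add_right)

lemma integral_chr: "(\<integral>x. chr \<xi> x \<partial>torus) = (if \<xi> = 0 then 1 else 0)"
proof (cases "\<xi> = 0")
  case False
  then obtain i where i: "\<xi> $ i \<noteq> 0" by (auto simp: vec_eq_iff)
  \<comment> \<open>Half a period of the character in a direction where \<open>\<xi>\<close> does
    not vanish: translating by y reverses the sign, so the mean is its own negative.\<close>
  define y where "y = (axis i (1 / (2 * of_int (\<xi> $ i))) :: real ^ 'a)"
  have "chr \<xi> y = -1" using i by (simp add: y_def chr_axis)
  then have sh: "chr \<xi> (x + y) = - chr \<xi> x" for x by (simp add: chr_add_right)
  have int: "integrable torus (\<lambda>x. chr \<xi> x)" by (rule integrable_torus_bounded[where B = 1]) auto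
  have b: "\<bar>Re (chr \<xi> x)\<bar> \<le> 1" "\<bar>Im (chr \<xi> x)\<bar> \<le> 1" for x
    using abs_Re_le_cmod[of "chr \<xi> x"] abs_Im_le_cmod[of "chr \<xi> x"] by auto
  have le1: "0 \<le> 1 + u" if "\<bar>u\<bar> \<le> 1" for u :: real using that by linarith
  \<comment> \<open>Translation invariance is available for nonnegative functions; adding 1 makes
    the real part, and below the imaginary part, nonnegative.\<close>
  have "(\<integral>x. 1 + Re (chr \<xi> (x + y)) \<partial>torus) = (\<integral>x. 1 + Re (chr \<xi> x) \<partial>torus)"
    using b(1) lperiodic_chr[of \<xi>]
    by (intro integral_torus_translation) (auto simp: lperiodic_def intro: le1)
  then have 1: "(\<integral>x. Re (chr \<xi> x) \<partial>torus) = 0" using int by (simp add: sh)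
  have "(\<integral>x. 1 + Im (chr \<xi> (x + y)) \<partial>torus) = (\<integral>x. 1 + Im (chr \<xi> x) \<partial>torus)"
    using b(2) lperiodic_chr[of \<xi>]
    by (intro integral_torus_translation) (auto simp: lperiodic_def intro: le1)
  then have 2: "(\<integral>x. Im (chr \<xi> x) \<partial>torus) = 0" using int by (simp add: sh)
  show ?thesis using False 1 2 int by (simp add: complex_eq_iff)
qed simp

section \<open>Trigonometric polynomials, Parseval and Bessel\<close>

abbreviation supp :: "(int ^ 'n \<Rightarrow> complex) \<Rightarrow> (int ^ 'n) set" where
  "supp a \<equiv> {\<xi>. a \<xi> \<noteq> 0}"

text \<open>The convolution kernel of the multiplier a. For infinite support the sum takes the
  default value 0, so Parseval is stated for finite support.\<close>

definition tp :: "(int ^ 'n \<Rightarrow> complex) \<Rightarrow> real ^ 'n \<Rightarrow> complex" where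
  "tp a x = (\<Sum>\<xi> | a \<xi> \<noteq> 0. a \<xi> * chr \<xi> x)"

lemma tp_eq: "finite S \<Longrightarrow> supp a \<subseteq> S \<Longrightarrow> tp a x = (\<Sum>\<xi>\<in>S. a \<xi> * chr \<xi> x)"
  unfolding tp_def by (intro sum.mono_neutral_left) auto

lemma lperiodic_tp: "lperiodic (tp a)"
  by (simp add: lperiodic_def tp_def chr_add_right)

lemma continuous_on_tp [continuous_intros]: "continuous_on S (tp a)"
  unfolding tp_def by (intro continuous_intros)

lemma borel_measurable_tp [measurable]: "tp a \<in> borel_measurable borel"
  by (intro borel_measurable_continuous_onI continuous_on_tp)

lemma norm_tp_le: "norm (tp a x) \<le> (\<Sum>\<xi> | a \<xi> \<noteq> 0. norm (a \<xi>))"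
  unfolding tp_def by (rule order.trans[OF norm_sum]) (simp add: norm_mult)

lemma tp_parseval_sum:
  assumes "finite S"
  shows "(\<integral>x. (norm (\<Sum>\<xi>\<in>S. a \<xi> * chr \<xi> x))\<^sup>2 \<partial>torus) = (\<Sum>\<xi>\<in>S. (norm (a \<xi>))\<^sup>2)"
proof -
  have int: "integrable torus (chr \<xi> :: real ^ 'a \<Rightarrow> complex)" for \<xi>
    by (rule integrable_torus_bounded[where B = 1]) auto
  let ?F = "\<lambda>x. \<Sum>\<xi>\<in>S. a \<xi> * chr \<xi> x"
  have eq: "complex_of_real ((norm (?F x))\<^sup>2) = (\<Sum>\<xi>\<in>S. \<Sum>\<eta>\<in>S. a \<xi> * cnj (a \<eta>) * chr (\<xi> - \<eta>) x)" for x
    by (subst complex_norm_square) (simp add: cnj_sum sum_product chr_diff mult_ac)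
  have "complex_of_real (\<integral>x. (norm (?F x))\<^sup>2 \<partial>torus) = (\<integral>x. complex_of_real ((norm (?F x))\<^sup>2) \<partial>torus)"
    by (rule integral_complex_of_real[symmetric])
  also have "\<dots> = (\<Sum>\<xi>\<in>S. \<Sum>\<eta>\<in>S. a \<xi> * cnj (a \<eta>) * (if \<xi> - \<eta> = 0 then 1 else 0))"
    unfolding eq using int
    by (simp add: integrable_sum integrable_mult_right integral_chr)
  also have "\<dots> = (\<Sum>\<xi>\<in>S. a \<xi> * cnj (a \<xi>))"
    using assms by (intro sum.cong refl) (simp add: if_distrib cong: if_cong)
  also have "\<dots> = complex_of_real (\<Sum>\<xi>\<in>S. (norm (a \<xi>))\<^sup>2)"
    by (simp add: complex_norm_square del: of_real_power)
  finally show ?thesis using of_real_eq_iff by blast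
qed

lemma tp_parseval:
  assumes "finite (supp a)"
  shows "(\<integral>x. (norm (tp a x))\<^sup>2 \<partial>torus) = (\<Sum>\<xi> | a \<xi> \<noteq> 0. (norm (a \<xi>))\<^sup>2)"
  unfolding tp_def using assms by (rule tp_parseval_sum)

definition fc :: "(real ^ 'n \<Rightarrow> complex) \<Rightarrow> int ^ 'n \<Rightarrow> complex" where
  "fc f \<xi> = (\<integral>x. cnj (chr \<xi> x) * f x \<partial>torus)"

text \<open>Integrate |f - P|^2 \<ge> 0 for the partial Fourier sum P over S: the mixed integral and
  the integral of |P|^2 both equal the coefficient sum.\<close>

lemma fc_bessel:
  fixes f :: "real ^ 'n \<Rightarrow> complex"
  assumes [measurable]: "f \<in> borel_measurable borel" and bd: "\<And>x. norm (f x) \<le> B" and fin: "finite S"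
  shows "(\<Sum>\<xi>\<in>S. (norm (fc f \<xi>))\<^sup>2) \<le> (\<integral>x. (norm (f x))\<^sup>2 \<partial>torus)"
proof -
  let ?P = "\<lambda>x. \<Sum>\<xi>\<in>S. fc f \<xi> * chr \<xi> x"
  have intf: "integrable torus (\<lambda>x. cnj (chr \<xi> x) * f x)" for \<xi>
    by (rule integrable_torus_bounded[where B = B]) (auto simp: norm_mult bd)
  have Pb: "norm (?P x) \<le> (\<Sum>\<xi>\<in>S. norm (fc f \<xi>))" for x
    by (rule order.trans[OF norm_sum]) (simp add: norm_mult)
  have intP: "integrable torus (\<lambda>x. (norm (?P x))\<^sup>2)"
    by (rule integrable_torus_bounded[where B = "(\<Sum>\<xi>\<in>S. norm (fc f \<xi>))\<^sup>2"])
      (use Pb in \<open>auto intro!: power_mono\<close>)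
  have intF: "integrable torus (\<lambda>x. (norm (f x))\<^sup>2)"
    by (rule integrable_torus_bounded[where B = "B\<^sup>2"]) (use bd in \<open>auto intro!: power_mono\<close>)
  have intc: "integrable torus (\<lambda>x. cnj (?P x) * f x)"
    using intf by (auto simp: cnj_sum sum_distrib_right mult.assoc intro!: integrable_sum integrable_mult_right)
  have cr: "(\<integral>x. cnj (?P x) * f x \<partial>torus) = complex_of_real (\<Sum>\<xi>\<in>S. (norm (fc f \<xi>))\<^sup>2)"
  proof -
    have "(\<integral>x. cnj (?P x) * f x \<partial>torus) = (\<integral>x. (\<Sum>\<xi>\<in>S. cnj (fc f \<xi>) * (cnj (chr \<xi> x) * f x)) \<partial>torus)"
      by (simp add: cnj_sum sum_distrib_right mult.assoc)
    also have "\<dots> = (\<Sum>\<xi>\<in>S. cnj (fc f \<xi>) * fc f \<xi>)"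
      using intf by (simp add: fc_def integrable_mult_right)
    finally show ?thesis by (simp add: complex_norm_square mult.commute del: of_real_power)
  qed
  have pw: "0 \<le> (norm (f x))\<^sup>2 - 2 * Re (cnj (?P x) * f x) + (norm (?P x))\<^sup>2" for x
  proof -
    have "(norm (u - v))\<^sup>2 = (norm u)\<^sup>2 - 2 * Re (cnj v * u) + (norm v)\<^sup>2" for u v :: complex
      unfolding cmod_power2 by (simp add: power2_eq_square algebra_simps)
    from this[of "f x" "?P x"] show ?thesis by (metis zero_le_power2)
  qed
  have gen: "(\<integral>x. u x - 2 * Re (w x) + v x \<partial>torus) = (\<integral>x. u x \<partial>torus) - 2 * Re (\<integral>x. w x \<partial>torus) + (\<integral>x. v x \<partial>torus)"
    if "integrable torus u" "integrable torus w" "integrable torus v"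
    for u v :: "real ^ 'n \<Rightarrow> real" and w :: "real ^ 'n \<Rightarrow> complex"
    using that by simp
  have "0 \<le> (\<integral>x. (norm (f x))\<^sup>2 - 2 * Re (cnj (?P x) * f x) + (norm (?P x))\<^sup>2 \<partial>torus)"
    using pw by (intro integral_nonneg_AE) auto
  also have "\<dots> = (\<integral>x. (norm (f x))\<^sup>2 \<partial>torus) - 2 * Re (\<integral>x. cnj (?P x) * f x \<partial>torus) + (\<integral>x. (norm (?P x))\<^sup>2 \<partial>torus)"
    by (rule gen[OF intF intc intP])
  also have "\<dots> = (\<integral>x. (norm (f x))\<^sup>2 \<partial>torus) - (\<Sum>\<xi>\<in>S. (norm (fc f \<xi>))\<^sup>2)"
    unfolding cr tp_parseval_sum[OF fin] by simp
  finally show ?thesis by simp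
qed

section \<open>Difference calculus\<close>

abbreviation fd :: "'n \<Rightarrow> nat \<Rightarrow> (int ^ 'n \<Rightarrow> complex) \<Rightarrow> int ^ 'n \<Rightarrow> complex" where
  "fd l m f \<equiv> (forward_diff l ^^ m) f"

lemma fd_Suc: "fd l (Suc m) f \<xi> = fd l m f (\<xi> + axis l 1) - fd l m f \<xi>"
  by (simp add: forward_diff_def)

lemma fd_Suc_right: "fd l (Suc m) f = fd l m (forward_diff l f)"
  by (simp add: funpow_swap1)

lemma fd_shift: "fd l m (\<lambda>\<xi>. f (\<xi> + \<eta>)) \<xi> = fd l m f (\<xi> + \<eta>)"
  by (induction m arbitrary: \<xi>) (simp_all add: fd_Suc add_ac del: funpow.simps(2))

lemma fd_add: "fd l m (\<lambda>\<xi>. f \<xi> + g \<xi>) \<xi> = fd l m f \<xi> + fd l m g \<xi>"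
  by (induction m arbitrary: \<xi>) (simp_all add: fd_Suc del: funpow.simps(2))

lemma fd_diff: "fd l m (\<lambda>\<xi>. f \<xi> - g \<xi>) \<xi> = fd l m f \<xi> - fd l m g \<xi>"
  by (induction m arbitrary: \<xi>) (simp_all add: fd_Suc del: funpow.simps(2))

lemma fd_const: "0 < m \<Longrightarrow> fd l m (\<lambda>_. c) \<xi> = 0"
proof (induction m arbitrary: \<xi>)
  case (Suc m)
  then show ?case by (cases "m = 0") (simp_all add: fd_Suc del: funpow.simps(2))
qed simp

lemma axis_Suc: "axis l (int (Suc t)) = (axis l 1 + axis l (int t) :: int ^ 'n)"
  by (simp add: vec_eq_iff axis_def)

lemma axis_0 [simp]: "axis l 0 = (0 :: 'a :: zero ^ 'n)"
  by (simp add: vec_eq_iff axis_def)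

text \<open>A difference of order m sees only a segment of m + 1 lattice points. This is how a
  truncated symbol gets replaced by a polynomial, or by 0, when the whole segment lies on one side
  of the truncation.\<close>

lemma fd_cong:
  assumes "\<And>t. t \<le> m \<Longrightarrow> f (\<xi> + axis l (int t)) = g (\<xi> + axis l (int t))"
  shows "fd l m f \<xi> = fd l m g \<xi>"
  using assms
proof (induction m arbitrary: \<xi>)
  case 0
  from 0[of 0] show ?case by simp
next
  case (Suc m)
  have "fd l m f (\<xi> + axis l 1) = fd l m g (\<xi> + axis l 1)"
  proof (rule Suc.IH)
    fix t assume "t \<le> m"
    then show "f (\<xi> + axis l 1 + axis l (int t)) = g (\<xi> + axis l 1 + axis l (int t))"
      using Suc.prems[of "Suc t"] by (simp only: axis_Suc add.assoc)
  qed
  moreover have "fd l m f \<xi> = fd l m g \<xi>" using Suc by simp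
  ultimately show ?case by (simp add: fd_Suc del: funpow.simps(2))
qed

lemma fd_bound:
  assumes "\<And>t. t \<le> m \<Longrightarrow> norm (f (\<xi> + axis l (int t))) \<le> A"
  shows "norm (fd l m f \<xi>) \<le> 2 ^ m * A"
  using assms
proof (induction m arbitrary: \<xi>)
  case 0
  from 0[of 0] show ?case by simp
next
  case (Suc m)
  have "norm (fd l m f (\<xi> + axis l 1)) \<le> 2 ^ m * A"
  proof (rule Suc.IH)
    fix t assume "t \<le> m"
    then show "norm (f (\<xi> + axis l 1 + axis l (int t))) \<le> A"
      using Suc.prems[of "Suc t"] by (simp only: axis_Suc add.assoc)
  qed
  moreover have "norm (fd l m f \<xi>) \<le> 2 ^ m * A" using Suc by simp
  ultimately show ?case
    using norm_triangle_ineq4[of "fd l m f (\<xi> + axis l 1)" "fd l m f \<xi>"]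
    by (simp add: fd_Suc del: funpow.simps(2))
qed

text \<open>The discrete Leibniz rule: the difference of a product is the difference of f times the
  shifted g, plus f times the difference of g. Each of the m applications doubles the number of
  terms. One step raises the order of f and shifts g, or raises the order of g; hence the bounds are
  asked for in the triangle \<open>a + t \<le> m\<close>.\<close>

lemma fd_mult_bound:
  assumes "\<And>a t. a + t \<le> m \<Longrightarrow> norm (fd l a f (\<xi> + axis l (int t))) \<le> F * \<rho> ^ a"
    and "\<And>a t. a + t \<le> m \<Longrightarrow> norm (fd l a g (\<xi> + axis l (int t))) \<le> G * \<rho> ^ a"
    and "0 \<le> \<rho>"
  shows "norm (fd l m (\<lambda>\<xi>. f \<xi> * g \<xi>) \<xi>) \<le> 2 ^ m * F * G * \<rho> ^ m"
  using assms
proof (induction m arbitrary: f g F G)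
  case 0
  have "norm (f \<xi>) \<le> F" "norm (g \<xi>) \<le> G" using 0(1,2)[of 0 0] by simp_all
  then have "norm (f \<xi>) * norm (g \<xi>) \<le> F * G" by (intro mult_mono) (auto intro: order.trans[OF norm_ge_zero])
  then show ?case by (simp add: norm_mult)
next
  case (Suc m)
  let ?g' = "\<lambda>\<xi>. g (\<xi> + axis l 1)"
  have eq: "forward_diff l (\<lambda>\<xi>. f \<xi> * g \<xi>) = (\<lambda>\<xi>. forward_diff l f \<xi> * ?g' \<xi> + f \<xi> * forward_diff l g \<xi>)"
    by (simp add: forward_diff_def fun_eq_iff algebra_simps)
  have "norm (fd l m (\<lambda>\<xi>. forward_diff l f \<xi> * ?g' \<xi>) \<xi>) \<le> 2 ^ m * (F * \<rho>) * G * \<rho> ^ m"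
  proof (rule Suc.IH[OF _ _ \<open>0 \<le> \<rho>\<close>])
    fix a t assume "a + t \<le> m"
    then show "norm (fd l a (forward_diff l f) (\<xi> + axis l (int t))) \<le> F * \<rho> * \<rho> ^ a"
      using Suc.prems(1)[of "Suc a" t] by (simp add: fd_Suc_right mult_ac del: funpow.simps(2))
    have "\<xi> + axis l (int t) + axis l 1 = \<xi> + axis l (int (Suc t))"
      by (simp only: axis_Suc) simp
    then show "norm (fd l a ?g' (\<xi> + axis l (int t))) \<le> G * \<rho> ^ a"
      using Suc.prems(2)[of a "Suc t"] \<open>a + t \<le> m\<close> by (simp only: fd_shift)
  qed
  moreover have "norm (fd l m (\<lambda>\<xi>. f \<xi> * forward_diff l g \<xi>) \<xi>) \<le> 2 ^ m * F * (G * \<rho>) * \<rho> ^ m"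
  proof (rule Suc.IH[OF _ _ \<open>0 \<le> \<rho>\<close>])
    fix a t assume "a + t \<le> m"
    then show "norm (fd l a f (\<xi> + axis l (int t))) \<le> F * \<rho> ^ a"
      using Suc.prems(1)[of a t] by simp
    show "norm (fd l a (forward_diff l g) (\<xi> + axis l (int t))) \<le> G * \<rho> * \<rho> ^ a"
      using Suc.prems(2)[of "Suc a" t] \<open>a + t \<le> m\<close>
      by (simp add: fd_Suc_right mult_ac del: funpow.simps(2))
  qed
  ultimately show ?case
    unfolding fd_Suc_right eq fd_add
    by (intro order.trans[OF norm_triangle_ineq]) (simp add: mult_ac)
qed

section \<open>The Japanese bracket under lattice shifts\<close>

lemma japanese_ge_1 [simp]: "1 \<le> japanese \<xi>"
  by (simp add: japanese_def)

lemma japanese_pos [simp]: "0 < japanese \<xi>"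
  using japanese_ge_1[of \<xi>] by linarith

lemma japanese_sq: "(japanese \<xi>)\<^sup>2 = 1 + (norm (lattice_vec \<xi>))\<^sup>2"
  by (simp add: japanese_def)

lemma norm_lattice_vec_le: "norm (lattice_vec \<xi>) \<le> japanese \<xi>"
  unfolding japanese_def by (rule real_le_rsqrt) simp

lemma component_le_japanese: "\<bar>real_of_int (\<xi> $ i)\<bar> \<le> japanese \<xi>"
  using component_le_norm_cart[of "lattice_vec \<xi>" i] norm_lattice_vec_le[of \<xi>] by simp

lemma japanese_le: "japanese \<xi> \<le> 1 + norm (lattice_vec \<xi>)"
  unfolding japanese_def by (rule real_le_lsqrt) (auto simp: power2_eq_square algebra_simps)

lemma japanese_add: "japanese (\<xi> + \<eta>) \<le> japanese \<xi> + norm (lattice_vec \<eta>)"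
proof -
  let ?u = "lattice_vec \<xi>" and ?v = "lattice_vec \<eta>"
  have "(norm (?u + ?v))\<^sup>2 \<le> (norm ?u + norm ?v)\<^sup>2"
    by (intro power_mono norm_triangle_ineq) auto
  moreover have "norm ?u * norm ?v \<le> japanese \<xi> * norm ?v"
    by (intro mult_right_mono norm_lattice_vec_le) auto
  ultimately have "1 + (norm (?u + ?v))\<^sup>2 \<le> (japanese \<xi> + norm ?v)\<^sup>2"
    by (simp add: power2_sum japanese_sq)
  then show ?thesis
    unfolding japanese_def[of "\<xi> + \<eta>"] lattice_vec_add
    using japanese_pos[of \<xi>] norm_ge_zero[of ?v] by (intro real_le_lsqrt) linarith+
qed

lemma norm_lattice_vec_axis [simp]: "norm (lattice_vec (axis l t)) = \<bar>real_of_int t\<bar>"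
proof -
  have "lattice_vec (axis l t) = axis l (real_of_int t)" by (simp add: vec_eq_iff axis_def)
  then show ?thesis by (simp add: norm_eq_sqrt_inner inner_axis_axis)
qed

lemma japanese_shift_le: "japanese (\<xi> + axis l (int t)) \<le> japanese \<xi> + t"
  using japanese_add[of \<xi> "axis l (int t)"] by simp

lemma japanese_shift_ge: "japanese \<xi> \<le> japanese (\<xi> + axis l (int t)) + t"
  using japanese_add[of "\<xi> + axis l (int t)" "- axis l (int t)"] by (simp add: lattice_vec_minus)

text \<open>The additive change t is at most k times the bracket, because the bracket is at least
  1.\<close>

lemma japanese_shift_mult:
  fixes t k :: nat
  assumes "t \<le> k"
  shows "japanese (\<xi> + axis l (int t)) \<le> (1 + k) * japanese \<xi>"
    and "japanese \<xi> \<le> (1 + k) * japanese (\<xi> + axis l (int t))"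
proof -
  have *: "u + real t \<le> (1 + real k) * u" if "1 \<le> u" for u
    using mult_mono[of "real t" "real k" 1 u] assms that by (simp add: algebra_simps)
  show "japanese (\<xi> + axis l (int t)) \<le> (1 + k) * japanese \<xi>"
    using japanese_shift_le[of \<xi> l t] *[of "japanese \<xi>"] by simp
  show "japanese \<xi> \<le> (1 + k) * japanese (\<xi> + axis l (int t))"
    using japanese_shift_ge[of \<xi> l t] *[of "japanese (\<xi> + axis l (int t))"] by simp
qed

section \<open>Dyadic pieces of the symbol\<close>

text \<open>A quadratic polynomial in the lattice point: along an axis its first difference is
  affine, its second constant and its third zero.\<close>

definition nsq :: "int ^ 'n \<Rightarrow> real" where "nsq \<xi> = (norm (lattice_vec \<xi>))\<^sup>2"

lemma nsq_axis: "nsq (\<xi> + axis l t) = nsq \<xi> + 2 * of_int (\<xi> $ l) * of_int t + (of_int t)\<^sup>2"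
proof -
  have *: "lattice_vec (axis l t) = axis l (real_of_int t)" by (simp add: vec_eq_iff axis_def)
  have "nsq (\<xi> + axis l t) = (lattice_vec \<xi> + axis l (real_of_int t)) \<bullet> (lattice_vec \<xi> + axis l (real_of_int t))"
    by (simp add: nsq_def lattice_vec_add power2_norm_eq_inner *)
  also have "\<dots> = nsq \<xi> + 2 * (lattice_vec \<xi> \<bullet> axis l (real_of_int t)) + axis l (real_of_int t) \<bullet> axis l (real_of_int t)"
    by (simp add: inner_add_left inner_add_right inner_commute nsq_def power2_norm_eq_inner)
  finally show ?thesis by (simp add: inner_axis power2_eq_square)
qed

definition hat :: "real \<Rightarrow> int ^ 'n \<Rightarrow> real" where
  "hat N \<xi> = max 0 (1 - nsq \<xi> / N\<^sup>2)"

text \<open>The power \<open>k\<close> makes the kink of the truncation harmless: near the sphere \<open>|\<xi>| = N\<close> the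
  base is \<open>O(1/N)\<close>, so differences of order at most \<open>k\<close> still gain a factor \<open>1/N\<close> each.\<close>

definition cutoff :: "nat \<Rightarrow> real \<Rightarrow> int ^ 'n \<Rightarrow> complex" where
  "cutoff k N \<xi> = complex_of_real (hat N \<xi> ^ k)"

lemma nsq_nonneg [simp]: "0 \<le> nsq \<xi>"
  by (simp add: nsq_def)

lemma hat_nonneg [simp]: "0 \<le> hat N \<xi>" and hat_le_1 [simp]: "hat N \<xi> \<le> 1"
  by (auto simp: hat_def)

lemma norm_cutoff_le: "norm (cutoff k N \<xi>) \<le> 1"
  by (simp add: cutoff_def norm_power power_le_one)

lemma abs_component_sq_le: "(real_of_int (\<xi> $ i))\<^sup>2 \<le> nsq \<xi>"
  using component_le_norm_cart[of "lattice_vec \<xi>" i] unfolding nsq_def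
  by (metis abs_ge_zero lattice_vec_nth power2_abs power_mono)

text \<open>Bernoulli's inequality inside the ball; outside it the right side is already at least 1.
  This quadratic contact with 1 at the origin is the source of the factor
  \<open>(japanese \<xi>)\<^sup>2 / 4 ^ j\<close> in the dyadic pieces.\<close>

lemma one_minus_cutoff_le:
  assumes "1 \<le> k" "0 < N"
  shows "norm (1 - cutoff k N \<xi>) \<le> k * nsq \<xi> / N\<^sup>2"
proof -
  define u where "u = nsq \<xi> / N\<^sup>2"
  have u: "0 \<le> u" by (simp add: u_def)
  have "1 - hat N \<xi> ^ k \<le> k * u"
  proof (cases "u \<le> 1")
    case True
    then have "1 + real k * (- u) \<le> (1 + - u) ^ k" by (intro Bernoulli_inequality) simp
    with True show ?thesis by (simp add: hat_def u_def)
  next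
    case False
    then have "1 * 1 \<le> real k * u" using assms by (intro mult_mono) auto
    moreover have "1 - hat N \<xi> ^ k \<le> 1" by simp
    ultimately show ?thesis by linarith
  qed
  moreover have "norm (1 - cutoff k N \<xi>) = 1 - hat N \<xi> ^ k"
  proof -
    have "1 - cutoff k N \<xi> = complex_of_real (1 - hat N \<xi> ^ k)" by (simp add: cutoff_def)
    moreover have "hat N \<xi> ^ k \<le> 1" by (simp add: power_le_one)
    ultimately show ?thesis by (simp only: norm_of_real)
  qed
  ultimately show ?thesis by (simp add: u_def)
qed

lemma max0_lipschitz: "\<bar>max 0 u - max 0 v\<bar> \<le> \<bar>u - v\<bar>" for u v :: real
  by linarith

lemma hat_step:
  assumes "0 < N"
  shows "\<bar>hat N (\<xi> + axis l 1) - hat N \<xi>\<bar> \<le> \<bar>2 * of_int (\<xi> $ l) + 1\<bar> / N\<^sup>2"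
proof -
  have "\<bar>hat N (\<xi> + axis l 1) - hat N \<xi>\<bar> \<le> \<bar>(1 - nsq (\<xi> + axis l 1) / N\<^sup>2) - (1 - nsq \<xi> / N\<^sup>2)\<bar>"
    unfolding hat_def by (rule max0_lipschitz)
  also have "(1 - nsq (\<xi> + axis l 1) / N\<^sup>2) - (1 - nsq \<xi> / N\<^sup>2) = - ((2 * of_int (\<xi> $ l) + 1) / N\<^sup>2)"
    using nsq_axis[of \<xi> l 1] by (simp add: field_simps add_divide_distrib diff_divide_distrib)
  finally show ?thesis by (simp add: abs_divide)
qed

text \<open>If both points are outside the ball, the hat vanishes at both. Otherwise one of them
  bounds the coordinate \<open>\<xi> $ l\<close> by N up to 1, which makes the step of
  \<open>hat_step\<close> of order 1 / N.\<close>

lemma hat_step_const: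
  assumes "1 \<le> N"
  shows "\<bar>hat N (\<xi> + axis l 1) - hat N \<xi>\<bar> \<le> 5 / N"
proof (cases "nsq \<xi> \<ge> N\<^sup>2 \<and> nsq (\<xi> + axis l 1) \<ge> N\<^sup>2")
  case True
  then have "hat N (\<xi> + axis l 1) = 0" "hat N \<xi> = 0"
    using assms by (auto simp: hat_def divide_simps)
  then show ?thesis using assms by simp
next
  case False
  have "\<bar>2 * real_of_int (\<xi> $ l) + 1\<bar> \<le> 5 * N"
  proof (cases "nsq \<xi> < N\<^sup>2")
    case True
    then have "(real_of_int (\<xi> $ l))\<^sup>2 \<le> N\<^sup>2" using abs_component_sq_le[of \<xi> l] by linarith
    then have "\<bar>real_of_int (\<xi> $ l)\<bar> \<le> N" using assms by (simp add: abs_le_square_iff[symmetric])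
    then show ?thesis using assms by linarith
  next
    case n: False
    then have "(real_of_int ((\<xi> + axis l 1) $ l))\<^sup>2 \<le> N\<^sup>2"
      using False abs_component_sq_le[of "\<xi> + axis l 1" l] by linarith
    then have "\<bar>real_of_int ((\<xi> + axis l 1) $ l)\<bar> \<le> N" using assms by (simp add: abs_le_square_iff[symmetric])
    then show ?thesis using assms by (simp add: axis_def)
  qed
  then have "\<bar>2 * real_of_int (\<xi> $ l) + 1\<bar> / N\<^sup>2 \<le> 5 * N / N\<^sup>2"
    by (intro divide_right_mono) auto
  also have "\<dots> = 5 / N" using assms by (simp add: power2_eq_square)
  finally show ?thesis using hat_step[of N \<xi> l] assms by linarith
qed

lemma hat_steps:
  assumes "1 \<le> N"
  shows "\<bar>hat N (\<xi> + axis l (int t)) - hat N \<xi>\<bar> \<le> 5 * t / N"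
proof (induction t)
  case (Suc t)
  have "\<xi> + axis l (int (Suc t)) = (\<xi> + axis l (int t)) + axis l 1" by (simp only: axis_Suc) simp
  moreover have "\<bar>hat N (\<xi> + axis l (int t) + axis l 1) - hat N (\<xi> + axis l (int t))\<bar> \<le> 5 / N"
    by (rule hat_step_const[OF assms])
  ultimately show ?case using Suc by (simp add: add_divide_distrib algebra_simps)
qed simp

lemma cutoff_eq_0: "0 < k \<Longrightarrow> 0 < N \<Longrightarrow> N\<^sup>2 \<le> nsq \<xi> \<Longrightarrow> cutoff k N \<xi> = 0"
  by (simp add: cutoff_def hat_def divide_simps)

text \<open>Where no truncation occurs the base is the polynomial
  \<open>1 - nsq \<xi> / N\<^sup>2\<close>, each of whose differences gains a factor 3 / N. The
  Leibniz rule transfers this to the powers, one application per factor, each contributing at most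
  \<open>2 ^ a\<close>.\<close>

lemma fd_quadratic_power:
  fixes a b t q :: nat
  assumes N: "1 \<le> N" and ins: "\<And>t. t \<le> a \<Longrightarrow> nsq (\<xi> + axis l (int t)) < N\<^sup>2"
    and bt: "b + t \<le> a"
  shows "norm (fd l b (\<lambda>\<xi>. complex_of_real (1 - nsq \<xi> / N\<^sup>2) ^ q) (\<xi> + axis l (int t)))
     \<le> 2 ^ (a * q) * (3 / N) ^ b"
  using bt
proof (induction q arbitrary: b t)
  case 0
  then show ?case using N by (cases "b = 0") (auto simp: fd_const)
next
  case (Suc q)
  define p where "p = (\<lambda>\<xi> :: int ^ 'a. complex_of_real (1 - nsq \<xi> / N\<^sup>2))"
  have p1: "fd l 1 p \<zeta> = complex_of_real (- (2 * of_int (\<zeta> $ l) + 1) / N\<^sup>2)" for \<zeta>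
    using nsq_axis[of \<zeta> l 1] by (simp add: p_def forward_diff_def add_divide_distrib diff_divide_distrib)
  have "fd l 2 p \<zeta> = fd l 1 p (\<zeta> + axis l 1) - fd l 1 p \<zeta>" for \<zeta>
    using fd_Suc[where l = l and m = 1 and f = p and \<xi> = \<zeta>] by (simp add: numeral_2_eq_2 del: funpow.simps(2))
  then have p2: "fd l 2 p = (\<lambda>_. complex_of_real (- 2 / N\<^sup>2))"
    unfolding p1 by (simp add: fun_eq_iff axis_def add_divide_distrib diff_divide_distrib flip: of_real_diff)
  have p3: "fd l c p \<zeta> = 0" if "3 \<le> c" for c \<zeta>
  proof -
    have "fd l c p = fd l (c - 2) (fd l 2 p)"
    proof -
      have "fd l (c - 2 + 2) p = fd l (c - 2) (fd l 2 p)" by (simp only: funpow_add comp_apply)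
      moreover have "c - 2 + 2 = c" using that by simp
      ultimately show ?thesis by metis
    qed
    then show ?thesis using that fd_const[where m = "c - 2" and l = l] unfolding p2 by simp
  qed
  \<comment> \<open>Value at most 1, first difference at most (2 N + 1) / N^2, second equal to 2 /
    N^2 in modulus, higher ones zero: each is at most the matching power of 3 / N.\<close>
  have pb: "norm (fd l c p (\<xi> + axis l (int s))) \<le> 1 * (3 / N) ^ c" if "c + s \<le> a" for c s
  proof -
    have "nsq (\<xi> + axis l (int s)) < N\<^sup>2" using ins that by simp
    moreover from this have "(real_of_int ((\<xi> + axis l (int s)) $ l))\<^sup>2 \<le> N\<^sup>2"
      using abs_component_sq_le[of "\<xi> + axis l (int s)" l] by linarith
    then have cl: "\<bar>real_of_int ((\<xi> + axis l (int s)) $ l)\<bar> \<le> N"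
      using N by (simp add: abs_le_square_iff[symmetric])
    consider "c = 0" | "c = 1" | "c = 2" | "3 \<le> c" by linarith
    then show ?thesis
    proof cases
      case 1
      have "0 \<le> nsq (\<xi> + axis l (int s)) / N\<^sup>2" "nsq (\<xi> + axis l (int s)) / N\<^sup>2 \<le> 1"
        using calculation N by (auto simp: divide_simps)
      then have "\<bar>1 - nsq (\<xi> + axis l (int s)) / N\<^sup>2\<bar> \<le> 1" by linarith
      then show ?thesis using 1 by (simp add: p_def del: of_real_diff)
    next
      case 2
      have "\<bar>- (2 * of_int ((\<xi> + axis l (int s)) $ l) + 1) / N\<^sup>2\<bar> \<le> 3 * N / N\<^sup>2"
        unfolding abs_divide using cl N by (auto intro!: divide_right_mono) 
      also have "\<dots> = 3 / N" using N by (simp add: power2_eq_square)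
      finally show ?thesis unfolding 2 p1 norm_of_real by simp
    next
      case 3
      have "\<bar>- 2 / N\<^sup>2\<bar> \<le> 9 / N\<^sup>2" by (simp add: divide_right_mono)
      then show ?thesis unfolding 3 p2 norm_of_real by (simp add: power_divide)
    next
      case 4
      then show ?thesis using p3[OF 4] N by simp
    qed
  qed
  have "norm (fd l b (\<lambda>\<xi>. p \<xi> * p \<xi> ^ q) (\<xi> + axis l (int t))) \<le> 2 ^ b * 1 * 2 ^ (a * q) * (3 / N) ^ b"
  proof (rule fd_mult_bound)
    fix c s assume cs: "c + s \<le> b"
    have e: "\<xi> + axis l (int t) + axis l (int s) = \<xi> + axis l (int (t + s))"
      by (simp add: vec_eq_iff axis_def)
    show "norm (fd l c p (\<xi> + axis l (int t) + axis l (int s))) \<le> 1 * (3 / N) ^ c"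
      unfolding e using cs Suc.prems by (intro pb) simp
    show "norm (fd l c (\<lambda>\<xi>. p \<xi> ^ q) (\<xi> + axis l (int t) + axis l (int s))) \<le> 2 ^ (a * q) * (3 / N) ^ c"
      unfolding e p_def using cs Suc.prems by (intro Suc.IH) simp
  qed (use N in simp)
  also have "\<dots> \<le> 2 ^ (a * Suc q) * (3 / N) ^ b"
  proof -
    have "(2::real) ^ b * 2 ^ (a * q) \<le> 2 ^ (a * Suc q)"
      using Suc.prems by (simp add: power_add[symmetric])
    then show ?thesis using N by (intro mult_right_mono) auto
  qed
  finally show ?case by (simp add: p_def)
qed

text \<open>Two regimes, one summand of the constant for each: a segment inside the ball, where the
  cutoff is a polynomial, and a segment that leaves the ball, where the hat is small
  throughout.\<close>

lemma fd_cutoff_bound: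
  assumes N: "1 \<le> N" and k: "1 \<le> k" and a: "a \<le> k"
  shows "norm (fd l a (cutoff k N) \<xi>) \<le> (2 ^ k * (10 * real k) ^ k + 2 ^ (k * k) * 3 ^ k) / N ^ a"
proof (cases "\<forall>t\<le>a. nsq (\<xi> + axis l (int t)) < N\<^sup>2")
  case True
  have "fd l a (cutoff k N) \<xi> = fd l a (\<lambda>\<xi>. complex_of_real (1 - nsq \<xi> / N\<^sup>2) ^ k) \<xi>"
  proof (rule fd_cong)
    fix t assume "t \<le> a"
    then have "nsq (\<xi> + axis l (int t)) / N\<^sup>2 \<le> 1"
      using True N by (auto simp: divide_simps less_imp_le)
    then show "cutoff k N (\<xi> + axis l (int t)) = complex_of_real (1 - nsq (\<xi> + axis l (int t)) / N\<^sup>2) ^ k"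
      by (simp add: cutoff_def hat_def)
  qed
  also have "norm \<dots> \<le> 2 ^ (a * k) * (3 / N) ^ a"
    using fd_quadratic_power[OF N, of a \<xi> l a 0 k] True by simp
  also have "\<dots> \<le> 2 ^ (k * k) * (3 ^ k / N ^ a)"
    unfolding power_divide using a N
    by (intro mult_mono divide_right_mono power_increasing) auto
  also have "\<dots> \<le> (2 ^ k * (10 * real k) ^ k + 2 ^ (k * k) * 3 ^ k) / N ^ a"
    using N by (simp add: divide_simps)
  finally show ?thesis .
next
  case False
  then obtain t0 where t0: "t0 \<le> a" "N\<^sup>2 \<le> nsq (\<xi> + axis l (int t0))" by (auto simp: not_less)
  have z: "hat N (\<xi> + axis l (int t0)) = 0" using t0 N by (auto simp: hat_def divide_simps)
  have "norm (cutoff k N (\<xi> + axis l (int t))) \<le> (10 * real k) ^ k / N ^ a" if "t \<le> a" for t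
  proof -
    \<comment> \<open>The zero of the hat and the point in question are each at most k steps away
      from \<open>\<xi>\<close>, at a cost of 5 / N per step: hence 10 k / N.\<close>
    have "5 * real t / N \<le> 5 * k / N" "5 * real t0 / N \<le> 5 * k / N"
      using that t0 a N by (auto intro!: divide_right_mono)
    then have "hat N (\<xi> + axis l (int t)) \<le> 10 * real k / N"
      using hat_steps[OF N, of \<xi> l t] hat_steps[OF N, of \<xi> l t0] z by (simp add: abs_le_iff) 
    then have "hat N (\<xi> + axis l (int t)) ^ k \<le> (10 * real k / N) ^ k" by (intro power_mono) auto
    also have "\<dots> \<le> (10 * real k) ^ k / N ^ a"
      unfolding power_divide using N a by (intro divide_left_mono power_increasing) auto
    finally show ?thesis by (simp add: cutoff_def norm_power)
  qed
  then have "norm (fd l a (cutoff k N) \<xi>) \<le> 2 ^ a * ((10 * real k) ^ k / N ^ a)" by (rule fd_bound)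
  also have "\<dots> \<le> 2 ^ k * ((10 * real k) ^ k / N ^ a)"
    using a N by (intro mult_right_mono power_increasing) auto
  also have "\<dots> \<le> (2 ^ k * (10 * real k) ^ k + 2 ^ (k * k) * 3 ^ k) / N ^ a"
    using N by (simp add: divide_simps)
  finally show ?thesis .
qed

lemma four_power: "(4::real) ^ j = (2 ^ j)\<^sup>2"
  by (simp add: power_mult[symmetric] mult.commute[of j]) (simp add: power_mult)

text \<open>The constant of \<open>fd_cutoff_bound\<close>, times \<open>(k + 2) ^ k\<close> for
  trading N against a bracket of size up to \<open>(k + 2) * N\<close>; the summand
  \<open>3 * k\<close> covers the orders 0 and 1.\<close>

definition cutoff_const :: "nat \<Rightarrow> real" where
  "cutoff_const k = (2 ^ k * (10 * real k) ^ k + 2 ^ (k * k) * 3 ^ k) * (k + 2) ^ k + 3 * k"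

lemma cutoff_const_nonneg: "0 \<le> cutoff_const k"
  by (simp add: cutoff_const_def)

text \<open>Orders 0 and 1 come from the quadratic behaviour at the origin. From order 2 on the
  constant 1 drops out and \<open>N ^ a\<close> is split as \<open>N\<^sup>2 * N ^ (a - 2)\<close>.
  The second factor may be traded for the bracket as long as that is at most
  \<open>(k + 2) * N\<close>; beyond this radius the difference is 0.\<close>

lemma fd_one_minus_cutoff_bound:
  assumes N: "1 \<le> N" and k: "1 \<le> k" and a: "a \<le> k"
  shows "norm (fd l a (\<lambda>\<xi>. 1 - cutoff k N \<xi>) \<xi>)
    \<le> cutoff_const k / N\<^sup>2 * ((japanese \<xi>)\<^sup>2 / japanese \<xi> ^ a)"
proof -
  define J where "J = japanese \<xi>"
  have J: "1 \<le> J" by (simp add: J_def)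
  define C1 where "C1 = 2 ^ k * (10 * real k) ^ k + 2 ^ (k * k) * 3 ^ k"
  have C1: "0 \<le> C1" by (simp add: C1_def)
  have c3: "3 * real k \<le> cutoff_const k" and cC: "C1 * (k + 2) ^ k \<le> cutoff_const k"
    using C1 by (simp_all add: cutoff_const_def C1_def)
  consider "a = 0" | "a = 1" | "2 \<le> a" by linarith
  then show ?thesis
  proof cases
    case 1
    have "norm (1 - cutoff k N \<xi>) \<le> k * nsq \<xi> / N\<^sup>2" using one_minus_cutoff_le[of k N \<xi>] k N by simp
    also have "\<dots> \<le> k * J\<^sup>2 / N\<^sup>2"
      by (intro divide_right_mono mult_left_mono) (auto simp: J_def japanese_sq nsq_def)
    also have "\<dots> \<le> cutoff_const k / N\<^sup>2 * (J\<^sup>2 / J ^ a)"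
    proof -
      have "real k * J\<^sup>2 \<le> cutoff_const k * J\<^sup>2" using c3 by (intro mult_right_mono) auto
      then show ?thesis using N 1 by (auto simp: intro!: divide_right_mono)
    qed
    finally show ?thesis using 1 by (simp add: J_def)
  next
    case 2
    have "fd l 1 (\<lambda>\<xi>. 1 - cutoff k N \<xi>) \<xi>
        = complex_of_real (hat N \<xi>) ^ k - complex_of_real (hat N (\<xi> + axis l 1)) ^ k"
      by (simp add: forward_diff_def cutoff_def)
    also have "norm \<dots> \<le> k * norm (complex_of_real (hat N \<xi>) - complex_of_real (hat N (\<xi> + axis l 1)))"
      by (intro norm_power_diff) auto
    also have "norm (complex_of_real (hat N \<xi>) - complex_of_real (hat N (\<xi> + axis l 1)))
        = \<bar>hat N (\<xi> + axis l 1) - hat N \<xi>\<bar>"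
      by (metis abs_minus_commute norm_of_real of_real_diff)
    also have "\<dots> \<le> 3 * J / N\<^sup>2"
    proof -
      have "\<bar>2 * real_of_int (\<xi> $ l) + 1\<bar> \<le> 3 * J"
        using component_le_japanese[of \<xi> l] J unfolding J_def by linarith
      then show ?thesis using hat_step[of N \<xi> l] N
        by (meson divide_right_mono order_trans zero_le_power2 zero_less_one less_le_trans)
    qed
    finally have "norm (fd l a (\<lambda>\<xi>. 1 - cutoff k N \<xi>) \<xi>) \<le> real k * (3 * J / N\<^sup>2)"
      using 2 by (simp add: mult_left_mono)
    also have "\<dots> = 3 * k / N\<^sup>2 * J" by simp
    also have "\<dots> \<le> cutoff_const k / N\<^sup>2 * J"
      using c3 J by (intro mult_right_mono divide_right_mono) auto
    finally show ?thesis using 2 J by (simp add: J_def power2_eq_square)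
  next
    case 3
    have "fd l a (\<lambda>\<xi>. 1 - cutoff k N \<xi>) \<xi> = - fd l a (cutoff k N) \<xi>"
      using 3 by (simp add: fd_diff fd_const)
    then have eq: "norm (fd l a (\<lambda>\<xi>. 1 - cutoff k N \<xi>) \<xi>) = norm (fd l a (cutoff k N) \<xi>)" by simp
    show ?thesis
    proof (cases "J \<le> (k + 2) * N")
      case True
      have "J ^ (a - 2) \<le> ((k + 2) * N) ^ (a - 2)" using True J by (intro power_mono) auto
      also have "\<dots> = (k + 2) ^ (a - 2) * N ^ (a - 2)" by (simp add: power_mult_distrib)
      also have "\<dots> \<le> (k + 2) ^ k * N ^ (a - 2)"
        using a N by (intro mult_right_mono of_nat_mono power_increasing) auto
      finally have "J ^ (a - 2) / N ^ (a - 2) \<le> (k + 2) ^ k"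
        using N by (simp add: divide_simps)
      then have "1 / N ^ (a - 2) \<le> (k + 2) ^ k / J ^ (a - 2)"
        using J N by (simp add: field_simps)
      then have "C1 / N\<^sup>2 * (1 / N ^ (a - 2)) \<le> C1 / N\<^sup>2 * ((k + 2) ^ k / J ^ (a - 2))"
        using C1 by (intro mult_left_mono) auto
      also have "\<dots> = C1 * (k + 2) ^ k / N\<^sup>2 * (1 / J ^ (a - 2))" by simp
      also have "\<dots> \<le> cutoff_const k / N\<^sup>2 * (1 / J ^ (a - 2))"
        using cC J by (intro mult_right_mono divide_right_mono) auto
      finally have "C1 / N\<^sup>2 * (1 / N ^ (a - 2)) \<le> cutoff_const k / N\<^sup>2 * (1 / J ^ (a - 2))" .
      moreover have "N ^ a = N\<^sup>2 * N ^ (a - 2)" using 3 by (metis le_add_diff_inverse power_add)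
      moreover have "J ^ a = J\<^sup>2 * J ^ (a - 2)" using 3 by (metis le_add_diff_inverse power_add)
      moreover have "norm (fd l a (cutoff k N) \<xi>) \<le> C1 / N ^ a"
        using fd_cutoff_bound[OF N k a, of l \<xi>] by (simp add: C1_def)
      moreover have "japanese \<xi> \<noteq> 0" using japanese_pos[of \<xi>] by linarith
      ultimately show ?thesis unfolding eq by (simp add: J_def mult.commute)
    next
      case False
      have "fd l a (cutoff k N) \<xi> = fd l a (\<lambda>_. 0) \<xi>"
      proof (rule fd_cong)
        fix t assume t: "t \<le> a"
        \<comment> \<open>Moving at most k steps from \<open>\<xi>\<close> leaves a bracket of at
          least 2 N, and \<open>4 * N\<^sup>2 - 1 \<ge> N\<^sup>2\<close> then puts the point
          outside the ball.\<close>
        have "2 * N \<le> (k + 2) * N - k" using N k by (simp add: algebra_simps)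
        then have "2 * N \<le> japanese (\<xi> + axis l (int t))"
          using False japanese_shift_ge[of \<xi> l t] t a by (simp add: J_def)
        then have "(2 * N)\<^sup>2 \<le> (japanese (\<xi> + axis l (int t)))\<^sup>2" using N by (intro power_mono) auto
        then have "(2 * N)\<^sup>2 \<le> 1 + nsq (\<xi> + axis l (int t))" by (simp only: japanese_sq nsq_def)
        moreover have "1 \<le> N\<^sup>2" using N by simp
        ultimately have "N\<^sup>2 \<le> nsq (\<xi> + axis l (int t))" by (simp add: power_mult_distrib)
        then show "cutoff k N (\<xi> + axis l (int t)) = 0" using k N by (intro cutoff_eq_0) auto
      qed
      also have "\<dots> = 0" using 3 by (intro fd_const) simp
      finally show ?thesis unfolding eq using cutoff_const_nonneg[of k]
        by (simp add: less_imp_le[OF japanese_pos])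
    qed
  qed
qed

text \<open>The pieces do not vanish near the origin; the gain \<open>(\<langle>\<xi>\<rangle> / 2\<^sup>j)\<^sup>2\<close> at low frequencies replaces
  this. A gain of first order only would lose a logarithm when the dimension is even.\<close>

definition adapted :: "nat \<Rightarrow> nat \<Rightarrow> real \<Rightarrow> (int ^ 'n \<Rightarrow> complex) \<Rightarrow> bool" where
  "adapted k j A a \<longleftrightarrow> 0 \<le> A \<and> (\<forall>\<xi>. a \<xi> \<noteq> 0 \<longrightarrow> japanese \<xi> \<le> 3 * 2 ^ j) \<and>
     (\<forall>l m \<xi>. m \<le> k \<longrightarrow> norm (fd l m a \<xi>) \<le> A / 4 ^ j * ((japanese \<xi>)\<^sup>2 / japanese \<xi> ^ m))"

definition dyadic_cutoff :: "nat \<Rightarrow> nat \<Rightarrow> int ^ 'n \<Rightarrow> complex" where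
  "dyadic_cutoff k j \<xi> = cutoff k (2 ^ Suc j) \<xi> - cutoff k (2 ^ j) \<xi>"

text \<open>The piece is a difference of two functions of the form 1 minus a cutoff, and each of
  these has the second-order gain. The radius of the support comes from
  \<open>1 + 2 ^ Suc j \<le> 3 * 2 ^ j\<close>.\<close>

lemma adapted_dyadic_cutoff:
  assumes k: "1 \<le> k"
  shows "adapted k j (2 * cutoff_const k) (dyadic_cutoff k j :: int ^ 'n \<Rightarrow> complex)"
  unfolding adapted_def
proof (intro conjI allI impI)
  fix \<xi> :: "int ^ 'n" assume nz: "dyadic_cutoff k j \<xi> \<noteq> 0"
  have "nsq \<xi> < (2 ^ Suc j)\<^sup>2"
  proof (rule ccontr)
    assume "\<not> ?thesis"
    then have *: "(2 ^ Suc j)\<^sup>2 \<le> nsq \<xi>" by simp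
    have "((2::real) ^ j)\<^sup>2 \<le> (2 ^ Suc j)\<^sup>2" by (intro power_mono) auto
    with * have "(2 ^ j)\<^sup>2 \<le> nsq \<xi>" by linarith
    with * nz k show False by (simp add: dyadic_cutoff_def cutoff_eq_0)
  qed
  then have "norm (lattice_vec \<xi>) < 2 ^ Suc j"
    unfolding nsq_def by (rule power_less_imp_less_base) simp
  moreover have "(1::real) \<le> 2 ^ j" by simp
  ultimately show "japanese \<xi> \<le> 3 * 2 ^ j" using japanese_le[of \<xi>] by (simp only: power_Suc)
next
  fix l m and \<xi> :: "int ^ 'n" assume m: "m \<le> k"
  let ?u = "(japanese \<xi>)\<^sup>2 / japanese \<xi> ^ m"
  have u0: "0 \<le> ?u" by (simp add: less_imp_le[OF japanese_pos])
  have eq: "dyadic_cutoff k j = (\<lambda>\<xi> :: int ^ 'n. (1 - cutoff k (2 ^ j) \<xi>) - (1 - cutoff k (2 ^ Suc j) \<xi>))"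
    by (simp add: dyadic_cutoff_def fun_eq_iff)
  have "norm (fd l m (dyadic_cutoff k j) \<xi>)
     \<le> cutoff_const k / (2 ^ j)\<^sup>2 * ?u + cutoff_const k / (2 ^ Suc j)\<^sup>2 * ?u"
    unfolding eq fd_diff[of m l "\<lambda>\<xi>. 1 - cutoff k (2 ^ j) \<xi>" "\<lambda>\<xi>. 1 - cutoff k (2 ^ Suc j) \<xi>"]
    by (intro order.trans[OF norm_triangle_ineq4] add_mono fd_one_minus_cutoff_bound k m) (auto simp del: power_Suc)
  also have "\<dots> \<le> cutoff_const k / 4 ^ j * ?u + cutoff_const k / 4 ^ j * ?u"
  proof -
    have "(2 ^ j)\<^sup>2 = (4::real) ^ j" "(2 ^ Suc j)\<^sup>2 = (4::real) * 4 ^ j"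
      by (simp_all add: four_power power_mult_distrib)
    moreover have "cutoff_const k / (4 * 4 ^ j) \<le> cutoff_const k / 4 ^ j"
      using cutoff_const_nonneg by (intro divide_left_mono) auto
    ultimately show ?thesis using u0 by (intro add_mono mult_right_mono) auto
  qed
  finally show "norm (fd l m (dyadic_cutoff k j) \<xi>) \<le> 2 * cutoff_const k / 4 ^ j * ?u"
    by (simp add: algebra_simps)
qed (use cutoff_const_nonneg in simp)

text \<open>The Leibniz rule, with all brackets on the segment replaced by the one at
  \<open>\<xi>\<close>: this costs a factor \<open>1 + k\<close> for each of the two powers in the
  numerator and for each order of difference. The radius in the bounds on g is that of a segment of
  at most k steps meeting the support of a; characters minus 1 obey such bounds only on a ball of
  this kind.\<close>

lemma adapted_mult:
  fixes a g :: "int ^ 'n \<Rightarrow> complex"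
  assumes a: "adapted k j A a" and B: "0 \<le> B"
    and g: "\<And>l m \<xi>. m \<le> k \<Longrightarrow> japanese \<xi> \<le> (real k + 3) * 2 ^ j \<Longrightarrow> norm (fd l m g \<xi>) \<le> B / japanese \<xi> ^ m"
  shows "adapted k j (2 ^ k * (1 + real k) ^ (k + 2) * A * B) (\<lambda>\<xi>. a \<xi> * g \<xi>)"
  unfolding adapted_def
proof (intro conjI allI impI)
  have A: "0 \<le> A" and supp: "\<And>\<xi>. a \<xi> \<noteq> 0 \<Longrightarrow> japanese \<xi> \<le> 3 * 2 ^ j"
    and ab: "\<And>l m \<xi>. m \<le> k \<Longrightarrow> norm (fd l m a \<xi>) \<le> A / 4 ^ j * ((japanese \<xi>)\<^sup>2 / japanese \<xi> ^ m)"
    using a by (auto simp: adapted_def)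
  show "0 \<le> 2 ^ k * (1 + real k) ^ (k + 2) * A * B" using A B by simp
  show "a \<xi> * g \<xi> \<noteq> 0 \<Longrightarrow> japanese \<xi> \<le> 3 * 2 ^ j" for \<xi> using supp by auto
  fix l m and \<xi> :: "int ^ 'n" assume m: "m \<le> k"
  define J where "J = japanese \<xi>"
  have J: "1 \<le> J" by (simp add: J_def)
  show "norm (fd l m (\<lambda>\<xi>. a \<xi> * g \<xi>) \<xi>)
    \<le> 2 ^ k * (1 + real k) ^ (k + 2) * A * B / 4 ^ j * ((japanese \<xi>)\<^sup>2 / japanese \<xi> ^ m)"
  proof (cases "\<exists>t\<le>m. a (\<xi> + axis l (int t)) \<noteq> 0")
    case False
    then have "fd l m (\<lambda>\<xi>. a \<xi> * g \<xi>) \<xi> = fd l m (\<lambda>_. 0) \<xi>" by (intro fd_cong) simp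
    also have "\<dots> = 0" by (cases "m = 0") (simp_all add: fd_const)
    finally show ?thesis using A B by (simp add: less_imp_le[OF japanese_pos])
  next
    case True
    then obtain t0 where t0: "t0 \<le> m" "a (\<xi> + axis l (int t0)) \<noteq> 0" by blast
    have near: "japanese (\<xi> + axis l (int t)) \<le> (real k + 3) * 2 ^ j" if "t \<le> m" for t
    proof -
      have "\<xi> + axis l (int t) = (\<xi> + axis l (int t0)) + axis l (int t - int t0)"
        by (simp add: vec_eq_iff axis_def)
      then have "japanese (\<xi> + axis l (int t)) \<le> japanese (\<xi> + axis l (int t0)) + \<bar>real_of_int (int t - int t0)\<bar>"
        using japanese_add[of "\<xi> + axis l (int t0)" "axis l (int t - int t0)"]
        by (simp only: norm_lattice_vec_axis)
      also have "\<dots> \<le> 3 * 2 ^ j + real k * 1" using supp[OF t0(2)] that t0(1) m by auto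
      also have "\<dots> \<le> 3 * 2 ^ j + real k * 2 ^ j" by (intro add_left_mono mult_left_mono) auto
      finally show ?thesis by (simp add: algebra_simps)
    qed
    define \<rho> where "\<rho> = (1 + k) / J"
    have rho: "0 \<le> \<rho>" using J by (simp add: \<rho>_def)
    have inv: "1 / japanese (\<xi> + axis l (int t)) ^ b \<le> \<rho> ^ b" if "t \<le> m" for t b
    proof -
      have "J \<le> (1 + k) * japanese (\<xi> + axis l (int t))"
        using japanese_shift_mult(2)[of t k \<xi> l] that m by (simp add: J_def)
      then have "1 / japanese (\<xi> + axis l (int t)) \<le> \<rho>"
        using J by (simp add: \<rho>_def field_simps)
      then have "(1 / japanese (\<xi> + axis l (int t))) ^ b \<le> \<rho> ^ b"
        by (intro power_mono) (auto simp: less_imp_le)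
      then show ?thesis by (simp add: power_one_over)
    qed
    have "norm (fd l m (\<lambda>\<xi>. a \<xi> * g \<xi>) \<xi>) \<le> 2 ^ m * (A / 4 ^ j * ((1 + real k)\<^sup>2 * J\<^sup>2)) * B * \<rho> ^ m"
    proof (rule fd_mult_bound[OF _ _ rho])
      fix b t assume bt: "b + t \<le> m"
      let ?J = "japanese (\<xi> + axis l (int t))"
      have "?J\<^sup>2 \<le> ((1 + k) * J)\<^sup>2"
        using japanese_shift_mult(1)[of t k \<xi> l] bt m by (intro power_mono) (auto simp: J_def less_imp_le)
      then have "?J\<^sup>2 * (1 / ?J ^ b) \<le> ((1 + real k)\<^sup>2 * J\<^sup>2) * \<rho> ^ b"
        using inv[of t b] bt by (intro mult_mono) (auto simp: power_mult_distrib less_imp_le)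
      then have "A / 4 ^ j * (?J\<^sup>2 * (1 / ?J ^ b)) \<le> A / 4 ^ j * (((1 + real k)\<^sup>2 * J\<^sup>2) * \<rho> ^ b)"
        using A by (intro mult_left_mono) auto
      then show "norm (fd l b a (\<xi> + axis l (int t))) \<le> A / 4 ^ j * ((1 + real k)\<^sup>2 * J\<^sup>2) * \<rho> ^ b"
        using ab[of b l "\<xi> + axis l (int t)"] bt m by (simp add: mult.assoc)
      have "norm (fd l b g (\<xi> + axis l (int t))) \<le> B * (1 / ?J ^ b)"
        using g[of b "\<xi> + axis l (int t)" l] near[of t] bt m by simp
      also have "\<dots> \<le> B * \<rho> ^ b" using inv[of t b] bt B by (intro mult_left_mono) auto
      finally show "norm (fd l b g (\<xi> + axis l (int t))) \<le> B * \<rho> ^ b" .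
    qed
    also have "\<dots> = (2 ^ m * (1 + real k) ^ (m + 2)) * (A * B / 4 ^ j * (J\<^sup>2 / J ^ m))"
      by (simp add: \<rho>_def power_divide power_add power2_eq_square)
    also have "\<dots> \<le> (2 ^ k * (1 + real k) ^ (k + 2)) * (A * B / 4 ^ j * (J\<^sup>2 / J ^ m))"
      using m A B J by (intro mult_right_mono mult_mono power_increasing) auto
    finally show ?thesis by (simp add: J_def mult.assoc)
  qed
qed

section \<open>Characters as symbols\<close>

lemma norm_cis_minus_1: "norm (cis \<theta> - 1) = 2 * \<bar>sin (\<theta> / 2)\<bar>"
  by (simp add: cis_conv_exp dist_exp_i_1)

lemma norm_cis_minus_1_le: "norm (cis \<theta> - 1) \<le> \<bar>\<theta>\<bar>"
  using abs_sin_x_le_abs_x[of "\<theta> / 2"] by (simp add: norm_cis_minus_1)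

lemma norm_cnj_chr_minus_1_le: "norm (cnj (chr \<xi> y) - 1) \<le> 2 * pi * (norm y * norm (lattice_vec \<xi>))"
proof -
  have "norm (cnj (chr \<xi> y) - 1) = norm (cis (2 * pi * (y \<bullet> lattice_vec \<xi>)) - 1)"
    by (metis chr_def complex_cnj_diff complex_cnj_one complex_mod_cnj)
  also have "\<dots> \<le> \<bar>2 * pi * (y \<bullet> lattice_vec \<xi>)\<bar>" by (rule norm_cis_minus_1_le)
  also have "\<dots> = 2 * pi * \<bar>y \<bullet> lattice_vec \<xi>\<bar>" by (simp add: abs_mult)
  also have "\<dots> \<le> 2 * pi * (norm y * norm (lattice_vec \<xi>))"
    by (intro mult_left_mono Cauchy_Schwarz_ineq2) auto
  finally show ?thesis .
qed

lemma fd_cnj_chr: "fd l m (\<lambda>\<zeta>. cnj (chr \<zeta> y)) \<xi> = (cnj (chr (axis l 1) y) - 1) ^ m * cnj (chr \<xi> y)"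
  by (induction m arbitrary: \<xi>) (simp_all add: fd_Suc chr_add algebra_simps del: funpow.simps(2))

text \<open>Order 0 is the linear bound for \<open>cis\<close>. For m > 0 the conjugate character is
  an eigenfunction of the difference operator with eigenvalue at most \<open>2 * pi * norm y\<close>
  in modulus. As u = \<open>norm y * 2 ^ j\<close> is at most 1, \<open>u ^ m \<le> u\<close>
  retains the one power of u that makes the sum over low scales converge.\<close>

lemma fd_modulation_bound:
  fixes y :: "real ^ 'n"
  assumes y: "norm y * 2 ^ j \<le> 1" and m: "m \<le> k" and J: "japanese \<xi> \<le> c * 2 ^ j" and c: "1 \<le> c"
  shows "norm (fd l m (\<lambda>\<zeta>. cnj (chr \<zeta> y) - 1) \<xi>) \<le> (2 * pi * c) ^ (k + 1) * (norm y * 2 ^ j) / japanese \<xi> ^ m"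
proof -
  let ?u = "norm y * 2 ^ j"
  have 1: "1 \<le> 2 * pi * c"
  proof -
    have "1 * 1 \<le> 2 * pi * c" using pi_ge_two c by (intro mult_mono) auto
    then show ?thesis by simp
  qed
  show ?thesis
  proof (cases "m = 0")
    case True
    have "norm (cnj (chr \<xi> y) - 1) \<le> 2 * pi * (norm y * norm (lattice_vec \<xi>))" by (rule norm_cnj_chr_minus_1_le)
    also have "\<dots> \<le> 2 * pi * (norm y * (c * 2 ^ j))"
      using J norm_lattice_vec_le[of \<xi>] by (intro mult_left_mono) auto
    also have "\<dots> = (2 * pi * c) ^ 1 * ?u" by simp
    also have "\<dots> \<le> (2 * pi * c) ^ (k + 1) * ?u"
      by (intro mult_right_mono power_increasing 1) auto
    finally show ?thesis using True by simp
  next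
    case False
    have "norm (cnj (chr (axis l 1) y) - 1) \<le> 2 * pi * norm y"
      using norm_cnj_chr_minus_1_le[of "axis l 1" y] by simp
    then have "norm (cnj (chr (axis l 1) y) - 1) ^ m \<le> (2 * pi * norm y) ^ m"
      by (intro power_mono) auto
    moreover have "fd l m (\<lambda>\<zeta>. cnj (chr \<zeta> y) - 1) \<xi> = (cnj (chr (axis l 1) y) - 1) ^ m * cnj (chr \<xi> y)"
      using False by (simp add: fd_diff fd_const fd_cnj_chr)
    ultimately have "norm (fd l m (\<lambda>\<zeta>. cnj (chr \<zeta> y) - 1) \<xi>) \<le> (2 * pi * norm y) ^ m"
      by (simp add: norm_mult norm_power)
    also have "\<dots> * japanese \<xi> ^ m \<le> (2 * pi * norm y) ^ m * (c * 2 ^ j) ^ m"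
      using J by (intro mult_left_mono power_mono) (auto simp: less_imp_le)
    also have "\<dots> = (2 * pi * c) ^ m * ?u ^ m" by (simp add: power_mult_distrib)
    also have "\<dots> \<le> (2 * pi * c) ^ (k + 1) * ?u"
    proof (intro mult_mono power_increasing 1)
      have "?u ^ m \<le> ?u ^ 1" using False y by (intro power_decreasing) auto
      then show "?u ^ m \<le> ?u" by simp
    qed (use m c in auto)
    finally have "norm (fd l m (\<lambda>\<zeta>. cnj (chr \<zeta> y) - 1) \<xi>) * japanese \<xi> ^ m \<le> (2 * pi * c) ^ (k + 1) * ?u"
      by (simp add: mult_right_mono)
    then show ?thesis by (simp add: pos_le_divide_eq)
  qed
qed

text \<open>All factors of the fold except the one at l are zeroth powers, and commutation allows
  that one to be split off. This is the bridge from the multi-index hypothesis to iterated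
  differences along an axis.\<close>

lemma diff_op_pure: "diff_op (\<chi> i. if i = l then m else 0) f = fd l m f"
proof -
  let ?\<alpha> = "(\<chi> i. if i = l then m else 0) :: nat ^ 'a"
  interpret comp_fun_commute "\<lambda>j. forward_diff j ^^ (?\<alpha> $ j)" by (rule comp_fun_commute_forward_diff)
  have z: "Finite_Set.fold (\<lambda>j. forward_diff j ^^ (?\<alpha> $ j)) f S = f" if "finite S" "l \<notin> S" for S
    using that
  proof (induction S rule: finite_induct)
    case (insert x S)
    have "Finite_Set.fold (\<lambda>j. forward_diff j ^^ (?\<alpha> $ j)) f (insert x S)
        = (forward_diff x ^^ (?\<alpha> $ x)) (Finite_Set.fold (\<lambda>j. forward_diff j ^^ (?\<alpha> $ j)) f S)"
      by (rule fold_insert) (use insert in auto)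
    moreover have "?\<alpha> $ x = 0" using insert by auto
    ultimately show ?case using insert by simp
  qed simp
  have "diff_op ?\<alpha> f = Finite_Set.fold (\<lambda>j. forward_diff j ^^ (?\<alpha> $ j)) f (insert l (UNIV - {l}))"
    by (simp add: diff_op_def insert_absorb)
  also have "\<dots> = (forward_diff l ^^ (?\<alpha> $ l)) (Finite_Set.fold (\<lambda>j. forward_diff j ^^ (?\<alpha> $ j)) f (UNIV - {l}))"
    by (rule fold_insert) auto
  also have "\<dots> = fd l m f" by (subst z) auto
  finally show ?thesis .
qed

lemma multi_abs_pure: "multi_abs (\<chi> i. if i = l then m else 0) = m"
  by (simp add: multi_abs_def)

section \<open>Square function bounds for the pieces\<close>

lemma card_vec_le:
  assumes "finite A"
  shows "finite {\<xi> :: 'a ^ 'n. \<forall>i. \<xi> $ i \<in> A}" "card {\<xi> :: 'a ^ 'n. \<forall>i. \<xi> $ i \<in> A} \<le> card A ^ CARD('n)"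
proof -
  have eq: "{\<xi> :: 'a ^ 'n. \<forall>i. \<xi> $ i \<in> A} \<subseteq> vec_lambda ` (PiE UNIV (\<lambda>_. A))"
  proof
    fix \<xi> :: "'a ^ 'n" assume "\<xi> \<in> {\<xi>. \<forall>i. \<xi> $ i \<in> A}"
    then have "vec_nth \<xi> \<in> PiE UNIV (\<lambda>_. A)" by auto
    then show "\<xi> \<in> vec_lambda ` (PiE UNIV (\<lambda>_. A))" by (metis image_eqI vec_nth_inverse)
  qed
  have fin: "finite (PiE (UNIV :: 'n set) (\<lambda>_. A))" using assms by (intro finite_PiE) auto
  then show "finite {\<xi> :: 'a ^ 'n. \<forall>i. \<xi> $ i \<in> A}" using eq finite_subset by blast
  have "card {\<xi> :: 'a ^ 'n. \<forall>i. \<xi> $ i \<in> A} \<le> card (vec_lambda ` (PiE (UNIV :: 'n set) (\<lambda>_. A)))"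
    by (intro card_mono finite_imageI fin eq)
  also have "\<dots> \<le> card (PiE (UNIV :: 'n set) (\<lambda>_. A))" by (intro card_image_le fin)
  finally show "card {\<xi> :: 'a ^ 'n. \<forall>i. \<xi> $ i \<in> A} \<le> card A ^ CARD('n)" by (simp add: card_PiE)
qed

lemma card_japanese_ball:
  fixes R :: real
  assumes R: "1 \<le> R"
  shows "finite {\<xi> :: int ^ 'n. japanese \<xi> \<le> R}"
    and "real (card {\<xi> :: int ^ 'n. japanese \<xi> \<le> R}) \<le> (3 * R) ^ CARD('n)"
proof -
  let ?A = "{- \<lfloor>R\<rfloor> .. \<lfloor>R\<rfloor>}"
  have sub: "{\<xi> :: int ^ 'n. japanese \<xi> \<le> R} \<subseteq> {\<xi>. \<forall>i. \<xi> $ i \<in> ?A}"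
  proof safe
    fix \<xi> :: "int ^ 'n" and i assume "japanese \<xi> \<le> R"
    then have "\<bar>real_of_int (\<xi> $ i)\<bar> \<le> R" using component_le_japanese[of \<xi> i] by simp
    then have "real_of_int \<bar>\<xi> $ i\<bar> \<le> R" by simp
    then have "\<bar>\<xi> $ i\<bar> \<le> \<lfloor>R\<rfloor>" by (simp only: le_floor_iff)
    then show "\<xi> $ i \<in> ?A" by auto
  qed
  show "finite {\<xi> :: int ^ 'n. japanese \<xi> \<le> R}"
    using sub card_vec_le(1)[of ?A] finite_subset by blast
  have "card {\<xi> :: int ^ 'n. japanese \<xi> \<le> R} \<le> card {\<xi> :: int ^ 'n. \<forall>i. \<xi> $ i \<in> ?A}"
    using sub by (intro card_mono card_vec_le(1)) auto
  also have "\<dots> \<le> card ?A ^ CARD('n)" by (intro card_vec_le(2)) simp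
  finally have "real (card {\<xi> :: int ^ 'n. japanese \<xi> \<le> R}) \<le> real (card ?A) ^ CARD('n)"
    by (metis of_nat_le_iff of_nat_power)
  also have "\<dots> \<le> (3 * R) ^ CARD('n)"
  proof (rule power_mono)
    have "0 \<le> \<lfloor>R\<rfloor>" using R by simp
    then have "real (card ?A) = 2 * real_of_int \<lfloor>R\<rfloor> + 1" by simp
    also have "\<dots> \<le> 2 * R + 1" by simp
    finally show "real (card ?A) \<le> 3 * R" using R by linarith
  qed simp
  finally show "real (card {\<xi> :: int ^ 'n. japanese \<xi> \<le> R}) \<le> (3 * R) ^ CARD('n)" .
qed

lemma dyadic_level_exists:
  fixes x :: real
  assumes "1 \<le> x"
  obtains i :: nat where "2 ^ i \<le> x" "x < 2 ^ Suc i"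
proof -
  obtain m where m: "x < 2 ^ m" using real_arch_pow[of 2 x] by auto
  define i where "i = (LEAST m. x < 2 ^ m)"
  have i: "x < 2 ^ i" unfolding i_def using m by (rule LeastI)
  then have "i \<noteq> 0" using assms by (cases i) auto
  then obtain i' where i': "i = Suc i'" by (cases i) auto
  have "\<not> x < 2 ^ i'" using not_less_Least[of i' "\<lambda>m. x < 2 ^ m"] i' unfolding i_def by simp
  with i i' show ?thesis by (intro that[of i']) auto
qed

lemma sum_power_le_twice:
  assumes "1 \<le> e"
  shows "(\<Sum>i\<le>L. ((2::real) ^ i) ^ e) \<le> 2 * (2 ^ L) ^ e"
proof (induction L)
  case (Suc L)
  have "(2::real) * (2 ^ L) ^ e \<le> (2 ^ Suc L) ^ e"
    using assms power_increasing[of 1 e "2::real"] by (simp add: power_mult_distrib)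
  then show ?case using Suc by (simp only: sum.atMost_Suc)
qed simp

text \<open>Count by dyadic shells: the shell at level i holds at most
  \<open>(6 * 2 ^ i) ^ CARD('n)\<close> points, each of weight at most
  \<open>16 * (2 ^ i) ^ 4 / (2 ^ i) ^ (2 * k)\<close>. The resulting exponent
  \<open>CARD('n) + 4 - 2 * k\<close> is at least 1, so the last shell dominates and summing over
  the levels costs a factor 2.\<close>

lemma sum_japanese_le:
  fixes S :: "(int ^ 'n) set"
  assumes S: "\<And>\<xi>. \<xi> \<in> S \<Longrightarrow> japanese \<xi> \<le> 2 ^ L" and k: "2 * k < CARD('n) + 4"
  shows "(\<Sum>\<xi>\<in>S. ((japanese \<xi>)\<^sup>2 / japanese \<xi> ^ k)\<^sup>2)
     \<le> 32 * 6 ^ CARD('n) * (2 ^ L) ^ (CARD('n) + 4 - 2 * k)"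
proof -
  define e where "e = CARD('n) + 4 - 2 * k"
  let ?w = "\<lambda>\<xi> :: int ^ 'n. ((japanese \<xi>)\<^sup>2 / japanese \<xi> ^ k)\<^sup>2"
  have fin: "finite S"
    using card_japanese_ball(1)[of "2 ^ L"] S by (rule_tac finite_subset[of S "{\<xi>. japanese \<xi> \<le> 2 ^ L}"]) auto
  have "\<exists>i. 2 ^ i \<le> japanese \<xi> \<and> japanese \<xi> < 2 ^ Suc i" for \<xi> :: "int ^ 'n"
    using dyadic_level_exists[OF japanese_ge_1[of \<xi>]] by metis
  then obtain lev :: "int ^ 'n \<Rightarrow> nat" where lev: "2 ^ lev \<xi> \<le> japanese \<xi>" "japanese \<xi> < 2 ^ Suc (lev \<xi>)" for \<xi>
    by metis
  have img: "lev ` S \<subseteq> {..L}"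
  proof safe
    fix \<xi> assume "\<xi> \<in> S"
    then have "(2::real) ^ lev \<xi> \<le> 2 ^ L" using lev(1)[of \<xi>] S[of \<xi>] by linarith
    then show "lev \<xi> \<le> L" by simp
  qed
  have "(\<Sum>\<xi>\<in>S. ?w \<xi>)
      = (\<Sum>i\<le>L. \<Sum>\<xi> | \<xi> \<in> S \<and> lev \<xi> = i. ?w \<xi>)"
    by (rule sum.group[symmetric, OF fin _ img]) simp
  also have "\<dots> \<le> (\<Sum>i\<le>L. 16 * 6 ^ CARD('n) * (2 ^ i) ^ e)"
  proof (rule sum_mono)
    fix i assume "i \<in> {..L}"
    let ?T = "{\<xi>. \<xi> \<in> S \<and> lev \<xi> = i}"
    define x :: real where "x = 2 ^ i"
    have x: "1 \<le> x" by (simp add: x_def)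
    have bd: "?w \<xi> \<le> 16 * x ^ 4 / x ^ (2 * k)" if "\<xi> \<in> ?T" for \<xi>
    proof -
      have l: "x \<le> japanese \<xi>" "japanese \<xi> \<le> 2 * x" using lev[of \<xi>] that by (auto simp: x_def)
      have "?w \<xi> = japanese \<xi> ^ 4 / japanese \<xi> ^ (2 * k)"
        by (simp add: power_divide power_mult[symmetric] mult.commute)
      also have "\<dots> \<le> (2 * x) ^ 4 / x ^ (2 * k)"
        using l x by (intro frac_le power_mono) auto
      finally show ?thesis by (simp add: power_mult_distrib)
    qed
    have "?T \<subseteq> {\<xi>. japanese \<xi> \<le> 2 * x}" using lev(2) by (auto simp: x_def less_imp_le)
    then have "real (card ?T) \<le> real (card {\<xi> :: int ^ 'n. japanese \<xi> \<le> 2 * x})"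
      using card_japanese_ball(1)[of "2 * x"] x by (intro of_nat_mono card_mono) auto
    also have "\<dots> \<le> (3 * (2 * x)) ^ CARD('n)" using x by (intro card_japanese_ball(2)) simp
    finally have cT: "real (card ?T) \<le> 6 ^ CARD('n) * x ^ CARD('n)" by (simp add: power_mult_distrib)
    have "(\<Sum>\<xi>\<in>?T. ?w \<xi>) \<le> real (card ?T) * (16 * x ^ 4 / x ^ (2 * k))"
      by (rule sum_bounded_above) (rule bd)
    also have "\<dots> \<le> 6 ^ CARD('n) * x ^ CARD('n) * (16 * x ^ 4 / x ^ (2 * k))"
      using cT x by (intro mult_right_mono) auto
    also have "\<dots> = 16 * 6 ^ CARD('n) * (x ^ (CARD('n) + 4) / x ^ (2 * k))"
      by (simp add: power_add)
    also have "x ^ (CARD('n) + 4) / x ^ (2 * k) = x ^ e"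
      using k x by (simp add: e_def power_diff)
    finally show "(\<Sum>\<xi>\<in>?T. ?w \<xi>) \<le> 16 * 6 ^ CARD('n) * (2 ^ i) ^ e"
      by (simp add: x_def)
  qed
  also have "\<dots> = 16 * 6 ^ CARD('n) * (\<Sum>i\<le>L. (2 ^ i) ^ e)" by (simp add: sum_distrib_left)
  also have "\<dots> \<le> 16 * 6 ^ CARD('n) * (2 * (2 ^ L) ^ e)"
    using k by (intro mult_left_mono sum_power_le_twice) (auto simp: e_def)
  finally show ?thesis by (simp add: e_def)
qed

lemma adapted_finite_support:
  assumes "adapted k j A a"
  shows "finite (supp a)"
proof -
  have "supp a \<subseteq> {\<xi>. japanese \<xi> \<le> 3 * 2 ^ j}" using assms by (auto simp: adapted_def)
  moreover have "(1::real) \<le> 3 * 2 ^ j" using one_le_power[of "2::real" j] by linarith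
  ultimately show ?thesis using card_japanese_ball(1) finite_subset by blast
qed

lemma fd_finite_support:
  assumes "finite (supp a)"
  shows "finite {\<xi>. fd l m a \<xi> \<noteq> 0}"
proof (induction m)
  case (Suc m)
  have "{\<xi>. fd l (Suc m) a \<xi> \<noteq> 0} \<subseteq> {\<xi>. fd l m a \<xi> \<noteq> 0} \<union> (\<lambda>\<xi>. \<xi> - axis l 1) ` {\<xi>. fd l m a \<xi> \<noteq> 0}"
  proof
    fix \<xi> assume "\<xi> \<in> {\<xi>. fd l (Suc m) a \<xi> \<noteq> 0}"
    then have "fd l m a \<xi> \<noteq> 0 \<or> fd l m a (\<xi> + axis l 1) \<noteq> 0"
      by (auto simp: fd_Suc simp del: funpow.simps(2))
    then show "\<xi> \<in> {\<xi>. fd l m a \<xi> \<noteq> 0} \<union> (\<lambda>\<xi>. \<xi> - axis l 1) ` {\<xi>. fd l m a \<xi> \<noteq> 0}"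
      by (auto intro!: image_eqI[of _ _ "\<xi> + axis l 1"])
  qed
  then show ?case using Suc finite_subset by blast
qed (use assms in simp)

definition sqnorm :: "(int ^ 'n \<Rightarrow> complex) \<Rightarrow> real" where
  "sqnorm a = (\<Sum>\<xi> | a \<xi> \<noteq> 0. (norm (a \<xi>))\<^sup>2)"

text \<open>Differences of order k enlarge the support by at most k, to a bracket of at most
  \<open>2 ^ (k + 3 + j)\<close>. The sum of squares there is of order
  \<open>(2 ^ j) ^ (CARD('n) + 4 - 2 * k)\<close>, and the square of the denominator
  \<open>4 ^ j\<close> removes the surplus exponent 4.\<close>

lemma sqnorm_fd_adapted:
  fixes a :: "int ^ 'n \<Rightarrow> complex"
  assumes a: "adapted k j A a" and k: "2 * k < CARD('n) + 4"
  shows "sqnorm (fd l k a) \<le> 32 * 6 ^ CARD('n) * (2 ^ (k + 3)) ^ (CARD('n) + 4 - 2 * k) * A\<^sup>2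
      * ((2 ^ j) ^ CARD('n) / (2 ^ j) ^ (2 * k))"
proof -
  define e where "e = CARD('n) + 4 - 2 * k"
  let ?w = "\<lambda>\<xi> :: int ^ 'n. ((japanese \<xi>)\<^sup>2 / japanese \<xi> ^ k)\<^sup>2"
  have sup: "japanese \<xi> \<le> 2 ^ (k + 3 + j)" if nz: "fd l k a \<xi> \<noteq> 0" for \<xi>
  proof -
    have "\<exists>t\<le>k. a (\<xi> + axis l (int t)) \<noteq> 0"
    proof (rule ccontr)
      assume "\<not> ?thesis"
      then have "fd l k a \<xi> = fd l k (\<lambda>_. 0) \<xi>" by (intro fd_cong) auto
      also have "\<dots> = 0" by (cases "k = 0") (simp_all add: fd_const)
      finally show False using nz by simp
    qed
    then obtain t where t: "t \<le> k" "a (\<xi> + axis l (int t)) \<noteq> 0" by blast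
    then have "japanese \<xi> \<le> 3 * 2 ^ j + real k * 1"
      using a japanese_shift_ge[of \<xi> l t] by (force simp: adapted_def)
    also have "\<dots> \<le> 3 * 2 ^ j + real k * 2 ^ j" by (intro add_left_mono mult_left_mono) auto
    also have "\<dots> = real (k + 3) * 2 ^ j" by (simp add: algebra_simps)
    also have "\<dots> \<le> 2 ^ (k + 3) * 2 ^ j"
      by (intro mult_right_mono) (metis less_exp of_nat_less_iff of_nat_numeral of_nat_power less_imp_le, simp)
    finally show ?thesis by (simp add: power_add)
  qed
  have "sqnorm (fd l k a) \<le> (\<Sum>\<xi> | fd l k a \<xi> \<noteq> 0. (A / 4 ^ j)\<^sup>2 * ?w \<xi>)"
    unfolding sqnorm_def
  proof (rule sum_mono)
    fix \<xi>
    have "norm (fd l k a \<xi>) \<le> A / 4 ^ j * ((japanese \<xi>)\<^sup>2 / japanese \<xi> ^ k)" using a by (simp add: adapted_def)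
    then show "(norm (fd l k a \<xi>))\<^sup>2 \<le> (A / 4 ^ j)\<^sup>2 * ?w \<xi>"
      unfolding power_mult_distrib[symmetric] by (intro power_mono) auto
  qed
  also have "\<dots> = (A / 4 ^ j)\<^sup>2 * (\<Sum>\<xi> | fd l k a \<xi> \<noteq> 0. ?w \<xi>)"
    by (simp add: sum_distrib_left)
  also have "\<dots> \<le> (A / 4 ^ j)\<^sup>2 * (32 * 6 ^ CARD('n) * (2 ^ (k + 3 + j)) ^ e)"
    unfolding e_def using sup k by (intro mult_left_mono sum_japanese_le) auto
  also have "\<dots> = 32 * 6 ^ CARD('n) * (2 ^ (k + 3)) ^ e * A\<^sup>2 * ((2 ^ j) ^ e / (4 ^ j)\<^sup>2)"
    by (simp add: power_add power_mult_distrib power_divide)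
  also have "(2 ^ j) ^ e / ((4::real) ^ j)\<^sup>2 = (2 ^ j) ^ CARD('n) / (2 ^ j) ^ (2 * k)"
  proof -
    have "((4::real) ^ j)\<^sup>2 = (2 ^ j) ^ 4"
      unfolding four_power by (simp add: power_mult[symmetric])
    moreover have "((2::real) ^ j) ^ (CARD('n) + 4) = (2 ^ j) ^ e * (2 ^ j) ^ (2 * k)"
      unfolding power_add[symmetric] using k by (simp add: e_def)
    ultimately show ?thesis by (simp add: field_simps power_add)
  qed
  finally show ?thesis by (simp add: e_def)
qed

lemma sqnorm_adapted:
  fixes a :: "int ^ 'n \<Rightarrow> complex"
  assumes a: "adapted k j A a"
  shows "sqnorm a \<le> 81 * 9 ^ CARD('n) * A\<^sup>2 * (2 ^ j) ^ CARD('n)"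
proof -
  have R: "(1::real) \<le> 3 * 2 ^ j" using one_le_power[of "2::real" j] by linarith
  have A: "0 \<le> A" using a by (simp add: adapted_def)
  have sub: "supp a \<subseteq> {\<xi>. japanese \<xi> \<le> 3 * 2 ^ j}" using a by (auto simp: adapted_def)
  have "sqnorm a \<le> real (card (supp a)) * (81 * A\<^sup>2)"
    unfolding sqnorm_def
  proof (rule sum_bounded_above)
    fix \<xi> assume "\<xi> \<in> supp a"
    then have J: "japanese \<xi> \<le> 3 * 2 ^ j" using sub by auto
    \<comment> \<open>The zeroth difference is the symbol itself, in whatever direction.\<close>
    have "norm (fd (undefined :: 'n) 0 a \<xi>) \<le> A / 4 ^ j * ((japanese \<xi>)\<^sup>2 / japanese \<xi> ^ 0)"
      using a unfolding adapted_def by blast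
    then have "norm (a \<xi>) \<le> A / 4 ^ j * (japanese \<xi>)\<^sup>2" by simp
    also have "\<dots> \<le> A / 4 ^ j * (3 * 2 ^ j)\<^sup>2"
      using J A by (intro mult_left_mono power_mono) (auto simp: less_imp_le)
    also have "\<dots> = 9 * A"
      by (simp add: four_power power_mult_distrib)
    finally have "(norm (a \<xi>))\<^sup>2 \<le> (9 * A)\<^sup>2" by (intro power_mono) auto
    then show "(norm (a \<xi>))\<^sup>2 \<le> 81 * A\<^sup>2" by (simp add: power_mult_distrib)
  qed
  also have "\<dots> \<le> (3 * (3 * 2 ^ j)) ^ CARD('n) * (81 * A\<^sup>2)"
  proof (rule mult_right_mono)
    have "real (card (supp a)) \<le> real (card {\<xi> :: int ^ 'n. japanese \<xi> \<le> 3 * 2 ^ j})"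
      using card_japanese_ball(1)[OF R] sub by (intro of_nat_mono card_mono) auto
    also have "\<dots> \<le> (3 * (3 * 2 ^ j)) ^ CARD('n)" by (rule card_japanese_ball(2)[OF R])
    finally show "real (card (supp a)) \<le> (3 * (3 * 2 ^ j)) ^ CARD('n)" .
  qed simp
  finally show ?thesis by (simp add: power_mult_distrib mult_ac)
qed

section \<open>Operations on coefficients seen on the kernel side\<close>

lemma tp_diff:
  assumes "finite (supp a)" "finite (supp b)"
  shows "tp (\<lambda>\<xi>. a \<xi> - b \<xi>) x = tp a x - tp b x"
proof -
  let ?S = "supp a \<union> supp b"
  have "finite ?S" using assms by simp
  then show ?thesis
    by (subst (1 2 3) tp_eq[where S = ?S]) (auto simp: sum_subtractf algebra_simps)
qed

lemma tp_freq_shift: "tp (\<lambda>\<xi>. a (\<xi> + \<eta>)) x = cnj (chr \<eta> x) * tp a x"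
proof -
  have "tp (\<lambda>\<xi>. a (\<xi> + \<eta>)) x = (\<Sum>\<xi> | a \<xi> \<noteq> 0. a \<xi> * chr (\<xi> - \<eta>) x)"
    unfolding tp_def
    by (rule sum.reindex_bij_witness[of _ "\<lambda>\<xi>. \<xi> - \<eta>" "\<lambda>\<xi>. \<xi> + \<eta>"]) auto
  then show ?thesis by (simp add: tp_def chr_diff sum_distrib_left mult_ac)
qed

text \<open>Shifting the coefficients by a unit vector multiplies the polynomial by a conjugate
  character, so every difference contributes one factor: summation by parts in frequency.\<close>

lemma tp_fd:
  assumes "finite (supp a)"
  shows "tp (fd l m a) x = (cnj (chr (axis l 1) x) - 1) ^ m * tp a x"
proof (induction m)
  case (Suc m)
  have fin: "finite {\<xi>. fd l m a \<xi> \<noteq> 0}" by (rule fd_finite_support[OF assms])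
  have fin': "finite {\<xi>. fd l m a (\<xi> + axis l 1) \<noteq> 0}"
    using finite_vimageI[OF fin, of "\<lambda>\<xi>. \<xi> + axis l 1"] by (simp add: vimage_def inj_on_def)
  have "fd l (Suc m) a = (\<lambda>\<xi>. fd l m a (\<xi> + axis l 1) - fd l m a \<xi>)"
    by (simp add: fun_eq_iff fd_Suc del: funpow.simps(2))
  then show ?case
    using tp_diff[OF fin' fin, of x] Suc by (simp add: tp_freq_shift algebra_simps del: funpow.simps(2))
qed simp

text \<open>Translating the kernel modulates its coefficients; this is what
  \<open>adapted_mult\<close> is later applied to, with a character minus 1 as second
  factor.\<close>

lemma tp_translate_diff:
  assumes "finite (supp a)"
  shows "tp a (x - y) - tp a x = tp (\<lambda>\<xi>. a \<xi> * (cnj (chr \<xi> y) - 1)) x"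
  by (subst tp_eq[OF assms, of "\<lambda>\<xi>. a \<xi> * (cnj (chr \<xi> y) - 1)"])
    (auto simp: tp_def chr_diff_right sum_subtractf[symmetric] algebra_simps)

lemma integral_weight_tp:
  assumes "finite (supp a)"
  shows "(\<integral>x. (norm (cnj (chr (axis l 1) x) - 1) ^ m * norm (tp a x))\<^sup>2 \<partial>torus) = sqnorm (fd l m a)"
  using tp_parseval[OF fd_finite_support[OF assms, where l = l and m = m]]
  by (simp add: sqnorm_def tp_fd[OF assms] norm_mult norm_power)

section \<open>Kernel estimates\<close>

lemma emeasure_sup_cube:
  fixes c :: "real ^ 'n"
  assumes "0 \<le> \<rho>"
  shows "emeasure lborel {x. \<forall>i. \<bar>x $ i - c $ i\<bar> \<le> \<rho>} = ennreal ((2 * \<rho>) ^ CARD('n))"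
proof -
  have eq: "{x. \<forall>i. \<bar>x $ i - c $ i\<bar> \<le> \<rho>} = cbox (\<chi> i. c $ i - \<rho>) (\<chi> i. c $ i + \<rho>)"
    by (auto simp: mem_box_cart abs_le_iff algebra_simps)
  have "c \<in> cbox (\<chi> i. c $ i - \<rho>) (\<chi> i. c $ i + \<rho>)" using assms by (simp add: mem_box_cart)
  then have "measure lborel (cbox (\<chi> i. c $ i - \<rho>) (\<chi> i. c $ i + \<rho>)) = (2 * \<rho>) ^ CARD('n)"
    by (subst content_cbox_cart) auto
  then show ?thesis unfolding eq
    by (subst emeasure_eq_ennreal_measure) (auto simp: emeasure_lborel_cbox_eq)
qed

text \<open>The union of the cubes of half-side \<open>\<rho>\<close> about all lattice points:
  choosing m separately in each coordinate amounts to choosing one lattice point in the maximum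
  norm. Being periodic, its indicator can be translated under the torus integral.\<close>

definition nbhd :: "real \<Rightarrow> (real ^ 'n) set" where
  "nbhd \<rho> = {x. \<forall>i. \<exists>m :: int. \<bar>x $ i - of_int m\<bar> \<le> \<rho>}"

lemma nbhd_measurable [measurable]: "nbhd \<rho> \<in> sets borel"
  unfolding nbhd_def by measurable

lemma nbhd_lattice: "x + lattice_vec m \<in> nbhd \<rho> \<longleftrightarrow> x \<in> nbhd \<rho>"
proof -
  have imp: "x + lattice_vec m \<in> nbhd \<rho>" if x: "x \<in> nbhd \<rho>" for x :: "real ^ 'a" and m
    unfolding nbhd_def
  proof safe
    fix i
    obtain q :: int where "\<bar>x $ i - of_int q\<bar> \<le> \<rho>" using x by (auto simp: nbhd_def)
    then show "\<exists>q :: int. \<bar>(x + lattice_vec m) $ i - of_int q\<bar> \<le> \<rho>" by (intro exI[of _ "q + m $ i"]) simp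
  qed
  show ?thesis using imp[of "x + lattice_vec m" "- m"] imp[of x m] by (auto simp: lattice_vec_minus)
qed

lemma lperiodic_indicator_nbhd: "lperiodic (indicator (nbhd \<rho>))" "lperiodic (indicator (- nbhd \<rho>))"
  by (simp_all add: lperiodic_def indicator_def nbhd_lattice)

lemma lperiodic_mult: "lperiodic F \<Longrightarrow> lperiodic G \<Longrightarrow> lperiodic (\<lambda>x. F x * G x)"
  by (simp add: lperiodic_def)

definition centred_cell :: "(real ^ 'n) set" where
  "centred_cell = {x. \<forall>i. - 1/2 \<le> x $ i \<and> x $ i < 1/2}"

text \<open>In the centred cell every nonzero integer is at distance at least 1/2 from the
  coordinate and 0 is at distance at most 1/2, so 0 can be taken for m.\<close>

lemma nbhd_centred:
  assumes "x \<in> centred_cell" "x \<in> nbhd \<rho>"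
  shows "\<bar>x $ i\<bar> \<le> \<rho>"
proof -
  obtain m :: int where m: "\<bar>x $ i - of_int m\<bar> \<le> \<rho>" using assms(2) by (auto simp: nbhd_def)
  have c: "- 1/2 \<le> x $ i" "x $ i < 1/2" using assms(1) by (auto simp: centred_cell_def)
  consider "m = 0" | "real_of_int m \<ge> 1" | "real_of_int m \<le> - 1" by linarith
  then show ?thesis using m c by cases (simp_all add: abs_if split: if_splits)
qed

lemma emeasure_nbhd:
  assumes "0 \<le> \<rho>"
  shows "emeasure torus (nbhd \<rho> :: (real ^ 'n) set) \<le> ennreal ((2 * \<rho>) ^ CARD('n))"
proof -
  have "emeasure torus (nbhd \<rho> :: (real ^ 'n) set) = (\<integral>\<^sup>+(x :: real ^ 'n). indicator (nbhd \<rho>) x \<partial>torus)" by simp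
  also have "\<dots> = (\<integral>\<^sup>+(x :: real ^ 'n). indicator centred_cell x * indicator (nbhd \<rho>) x \<partial>lborel)"
    unfolding centred_cell_def by (rule nn_integral_torus_centred) (auto intro: lperiodic_indicator_nbhd)
  also have "\<dots> \<le> (\<integral>\<^sup>+(x :: real ^ 'n). indicator {x. \<forall>i. \<bar>x $ i - 0 $ i\<bar> \<le> \<rho>} x \<partial>lborel)"
    by (intro nn_integral_mono) (auto simp: indicator_def nbhd_centred)
  also have "\<dots> = emeasure lborel {x :: real ^ 'n. \<forall>i. \<bar>x $ i - 0 $ i\<bar> \<le> \<rho>}"
    by (intro nn_integral_indicator) measurable
  finally show ?thesis using emeasure_sup_cube[OF assms, of "0 :: real ^ 'n"] by simp
qed

definition wgt :: "nat \<Rightarrow> real ^ 'n \<Rightarrow> real" where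
  "wgt k x = (\<Sum>l\<in>UNIV. (norm (cnj (chr (axis l 1) x) - 1) ^ k)\<^sup>2)"

lemma norm_cnj_chr_axis: "norm (cnj (chr (axis l 1) x) - 1) = 2 * \<bar>sin (pi * x $ l)\<bar>"
proof -
  have "lattice_vec (axis l 1) = axis l 1" by (simp add: vec_eq_iff axis_def)
  then have "chr (axis l 1) x = cis (2 * pi * x $ l)" by (simp add: chr_def inner_axis)
  moreover have "norm (cnj (cis (2 * pi * x $ l)) - 1) = norm (cis (2 * pi * x $ l) - 1)"
    by (metis complex_cnj_diff complex_cnj_one complex_mod_cnj)
  ultimately show ?thesis by (simp add: norm_cis_minus_1 mult_ac)
qed

lemma borel_measurable_wgt [measurable]: "wgt k \<in> borel_measurable borel"
  unfolding wgt_def by measurable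

lemma lperiodic_wgt: "lperiodic (wgt k)"
  by (simp add: lperiodic_def wgt_def chr_add_right)

lemma wgt_nonneg [simp]: "0 \<le> wgt k x"
  by (simp add: wgt_def sum_nonneg)

text \<open>With y = x / 2 at most pi / 4, the cosine is at least sqrt 2 / 2 on [0, y]. By the mean
  value theorem this bounds sin y below, and directly cos y; the double angle formula multiplies the
  two bounds.\<close>

lemma sin_ge_linear:
  assumes "0 \<le> x" "x \<le> pi / 2"
  shows "x / 2 \<le> sin x"
proof (cases "x = 0")
  case False
  define y where "y = x / 2"
  have y: "0 < y" "y \<le> pi / 4" using assms False by (auto simp: y_def)
  have c: "sqrt 2 / 2 \<le> cos z" if "0 \<le> z" "z \<le> pi / 4" for z
    using cos_monotone_0_pi_le[of z "pi / 4"] that by (simp add: cos_45)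
  obtain z where z: "0 < z" "z < y" "sin y - sin 0 = (y - 0) * cos z"
    using MVT2[OF y(1), of sin cos] by (auto intro: DERIV_sin)
  have "y * (sqrt 2 / 2) \<le> sin y" using z c[of z] y by (auto intro!: mult_left_mono)
  then have "(y * (sqrt 2 / 2)) * (sqrt 2 / 2) \<le> sin y * cos y"
    using c[of y] y by (intro mult_mono) (auto intro!: sin_ge_zero)
  moreover have "(y * (sqrt 2 / 2)) * (sqrt 2 / 2) = y / 2" by (simp add: field_simps)
  ultimately have "y / 2 \<le> sin y * cos y" by linarith
  moreover have "sin x = 2 * sin y * cos y" using sin_double[of y] by (simp add: y_def)
  ultimately show ?thesis by (simp add: y_def)
qed simp

text \<open>On the centred cell the weight dominates \<open>|x|\<^sup>2\<^sup>k\<close> in the maximum norm, while multiplication by its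
  summands corresponds to \<open>k\<close>-th differences of the coefficients.\<close>

lemma wgt_ge:
  assumes "x \<in> centred_cell"
  shows "\<bar>x $ l\<bar> ^ (2 * k) \<le> wgt k x"
proof -
  have c: "\<bar>x $ l\<bar> \<le> 1 / 2" proof -
    have "- 1/2 \<le> x $ l \<and> x $ l < 1/2" using assms by (simp add: centred_cell_def)
    then show ?thesis by linarith
  qed
  have "pi * \<bar>x $ l\<bar> \<le> pi / 2" using c by (simp add: field_simps)
  then have "pi * \<bar>x $ l\<bar> / 2 \<le> sin (pi * \<bar>x $ l\<bar>)" by (intro sin_ge_linear) auto
  also have "\<dots> \<le> \<bar>sin (pi * x $ l)\<bar>" by (cases "0 \<le> x $ l") auto
  finally have "pi * \<bar>x $ l\<bar> \<le> norm (cnj (chr (axis l 1) x) - 1)" by (simp add: norm_cnj_chr_axis)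
  moreover have "1 * \<bar>x $ l\<bar> \<le> pi * \<bar>x $ l\<bar>" using pi_ge_two by (intro mult_right_mono) auto
  ultimately have "\<bar>x $ l\<bar> ^ (2 * k) \<le> norm (cnj (chr (axis l 1) x) - 1) ^ (2 * k)" by (intro power_mono) auto
  also have "\<dots> = (norm (cnj (chr (axis l 1) x) - 1) ^ k)\<^sup>2" by (simp add: power_mult[symmetric] mult.commute)
  also have "\<dots> \<le> wgt k x" unfolding wgt_def by (intro member_le_sum) auto
  finally show ?thesis .
qed

text \<open>For dividing by the weight: a coordinate at positive distance from the integers gives a
  nonzero sine.\<close>

lemma wgt_pos:
  assumes "0 \<le> r" "x \<notin> nbhd r"
  shows "0 < wgt k x"
proof -
  obtain l where l: "\<And>m :: int. \<bar>x $ l - of_int m\<bar> > r" using assms(2) by (auto simp: nbhd_def not_le)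
  have "sin (pi * x $ l) \<noteq> 0"
  proof
    assume "sin (pi * x $ l) = 0"
    then obtain m :: int where "pi * x $ l = of_int m * pi" by (auto simp: sin_zero_iff_int2)
    then have "x $ l = of_int m" by (simp add: mult.commute)
    then show False using l[of m] assms(1) by simp
  qed
  then have "0 < (norm (cnj (chr (axis l 1) x) - 1) ^ k)\<^sup>2" by (simp add: norm_cnj_chr_axis)
  also have "\<dots> \<le> wgt k x" unfolding wgt_def by (intro member_le_sum) auto
  finally show ?thesis .
qed

lemma ennreal_le_suminf: "f i \<le> (\<Sum>i. f i)" for f :: "nat \<Rightarrow> ennreal"
  using sum_le_suminf[of f "{i}"] by simp

text \<open>Shells between the radii \<open>2 ^ i * r\<close> and \<open>2 ^ Suc i * r\<close> in
  the maximum norm: the weight is at least \<open>(2 ^ i * r) ^ (2 * k)\<close> and the volume at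
  most \<open>(4 * (2 ^ i * r)) ^ CARD('n)\<close>. As \<open>2 * k\<close> exceeds the dimension by
  at least 1, the terms decay like \<open>(1 / 2) ^ i\<close>, whence the factor 2.\<close>

lemma nn_integral_inverse_wgt:
  assumes k: "CARD('n) < 2 * k" and r: "0 < r"
  shows "(\<integral>\<^sup>+(x :: real ^ 'n). indicator (- nbhd r) x * ennreal (1 / wgt k x) \<partial>torus)
    \<le> ennreal (2 * 4 ^ CARD('n) * (r ^ CARD('n) / r ^ (2 * k)))" (is "?I \<le> _")
proof -
  let ?n = "CARD('n)"
  let ?e = "\<lambda>i :: nat. ennreal (1 / (2 ^ i * r) ^ (2 * k))"
  define Q where "Q i = {x :: real ^ 'n. \<forall>l. \<bar>x $ l - 0 $ l\<bar> \<le> 2 ^ Suc i * r}" for i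
  have Q [measurable]: "Q i \<in> sets borel" for i unfolding Q_def by measurable
  have pw: "indicator centred_cell x * (indicator (- nbhd r) x * ennreal (1 / wgt k x))
      \<le> (\<Sum>i. ?e i * indicator (Q i) x)" for x :: "real ^ 'n"
  proof (cases "x \<in> centred_cell \<and> x \<notin> nbhd r")
    case True
    have "Max (range (\<lambda>l. \<bar>x $ l\<bar>)) \<in> range (\<lambda>l. \<bar>x $ l\<bar>)" by (intro Max_in) auto
    then obtain l0 where l0: "Max (range (\<lambda>l. \<bar>x $ l\<bar>)) = \<bar>x $ l0\<bar>" by (rule rangeE)
    have mx: "\<bar>x $ l\<bar> \<le> \<bar>x $ l0\<bar>" for l unfolding l0[symmetric] by (intro Max_ge) auto
    obtain l where l: "\<And>m :: int. \<bar>x $ l - of_int m\<bar> > r" using True by (auto simp: nbhd_def not_le)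
    have s: "r < \<bar>x $ l0\<bar>" using l[of 0] mx[of l] by simp
    then have "1 \<le> \<bar>x $ l0\<bar> / r" using r by simp
    then obtain i where i: "2 ^ i \<le> \<bar>x $ l0\<bar> / r" "\<bar>x $ l0\<bar> / r < 2 ^ Suc i" by (rule dyadic_level_exists)
    have i1: "2 ^ i * r \<le> \<bar>x $ l0\<bar>" and i2: "\<bar>x $ l0\<bar> \<le> 2 ^ Suc i * r"
      using i r by (simp_all add: field_simps)
    have "(2 ^ i * r) ^ (2 * k) \<le> \<bar>x $ l0\<bar> ^ (2 * k)" using i1 r by (intro power_mono) auto
    also have "\<dots> \<le> wgt k x" using True by (intro wgt_ge) auto
    finally have "1 / wgt k x \<le> 1 / (2 ^ i * r) ^ (2 * k)" using r by (intro frac_le) auto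
    moreover have "x \<in> Q i" using mx i2 unfolding Q_def by (auto intro: order.trans)
    ultimately have "indicator centred_cell x * (indicator (- nbhd r) x * ennreal (1 / wgt k x))
      \<le> ?e i * indicator (Q i) x"
      using True by (simp add: ennreal_leI)
    also have "\<dots> \<le> (\<Sum>i. ?e i * indicator (Q i) x)"
      by (rule ennreal_le_suminf)
    finally show ?thesis .
  qed (auto simp: indicator_def)
  have sh: "?e i * emeasure lborel (Q i)
      \<le> ennreal (4 ^ ?n * (r ^ ?n / r ^ (2 * k)) * (1 / 2) ^ i)" for i
  proof -
    have "emeasure lborel (Q i) = ennreal ((2 * (2 ^ Suc i * r)) ^ ?n)"
      unfolding Q_def using r by (intro emeasure_sup_cube) auto
    then have "?e i * emeasure lborel (Q i)
        = ennreal (1 / (2 ^ i * r) ^ (2 * k) * (4 * (2 ^ i * r)) ^ ?n)"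
      using r by (simp add: ennreal_mult'[symmetric] mult_ac)
    also have "1 / (2 ^ i * r) ^ (2 * k) * (4 * (2 ^ i * r)) ^ ?n
        = 4 ^ ?n * (r ^ ?n / r ^ (2 * k)) * ((2 ^ i) ^ ?n / (2 ^ i) ^ (2 * k))"
      by (simp add: power_mult_distrib field_simps)
    also have "\<dots> \<le> 4 ^ ?n * (r ^ ?n / r ^ (2 * k)) * (1 / 2) ^ i"
    proof (rule mult_left_mono)
      have "(2::real) ^ i * (2 ^ i) ^ ?n \<le> (2 ^ i) ^ (2 * k)"
        unfolding power_Suc[symmetric] using k by (intro power_increasing) auto
      then show "((2::real) ^ i) ^ ?n / (2 ^ i) ^ (2 * k) \<le> (1 / 2) ^ i"
        by (simp add: power_one_over field_simps)
    qed (use r in simp)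
    finally show ?thesis by (simp add: ennreal_leI)
  qed
  have "?I
      = (\<integral>\<^sup>+(x :: real ^ 'n). indicator centred_cell x * (indicator (- nbhd r) x * ennreal (1 / wgt k x)) \<partial>lborel)"
    unfolding centred_cell_def
    by (intro nn_integral_torus_centred lperiodic_mult lperiodic_indicator_nbhd lperiodic_compose[OF lperiodic_wgt]) auto
  also have "\<dots> \<le> (\<integral>\<^sup>+(x :: real ^ 'n). (\<Sum>i. ?e i * indicator (Q i) x) \<partial>lborel)"
    by (intro nn_integral_mono pw)
  also have "\<dots> = (\<Sum>i. ?e i * emeasure lborel (Q i))"
    by (subst nn_integral_suminf) (auto simp: nn_integral_cmult_indicator)
  also have "\<dots> \<le> (\<Sum>i. ennreal (4 ^ ?n * (r ^ ?n / r ^ (2 * k)) * (1 / 2) ^ i))"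
    by (intro suminf_le sh) auto
  also have "\<dots> = ennreal (4 ^ ?n * (r ^ ?n / r ^ (2 * k)) * 2)"
  proof (rule suminf_ennreal_eq)
    have "(\<lambda>i. (1 / 2) ^ i) sums (2 :: real)" using geometric_sums[of "1 / 2 :: real"] by simp
    then show "(\<lambda>i. 4 ^ ?n * (r ^ ?n / r ^ (2 * k)) * (1 / 2) ^ i) sums (4 ^ ?n * (r ^ ?n / r ^ (2 * k)) * 2)"
      by (rule sums_mult)
  qed (use r in simp)
  finally show ?thesis by (simp add: mult_ac)
qed

lemma nn_integral_wgt_tp:
  fixes a :: "int ^ 'n \<Rightarrow> complex"
  assumes fin: "finite (supp a)"
  shows "(\<integral>\<^sup>+x. ennreal (wgt k x * (norm (tp a x))\<^sup>2) \<partial>torus) = ennreal (\<Sum>l\<in>UNIV. sqnorm (fd l k a))"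
proof -
  let ?G = "\<lambda>l x. (norm (cnj (chr (axis l 1) x) - 1) ^ k * norm (tp a x))\<^sup>2"
  have int: "integrable torus (?G l)" for l
  proof (rule integrable_torus_bounded)
    fix x :: "real ^ 'n"
    have "norm (cnj (chr (axis l 1) x) - 1) ^ k * norm (tp a x) \<le> 2 ^ k * (\<Sum>\<xi> | a \<xi> \<noteq> 0. norm (a \<xi>))"
      using norm_tp_le[of a x] norm_triangle_ineq4[of "cnj (chr (axis l 1) x)" 1]
      by (intro mult_mono power_mono) auto
    then show "norm (?G l x) \<le> (2 ^ k * (\<Sum>\<xi> | a \<xi> \<noteq> 0. norm (a \<xi>)))\<^sup>2"
      by (simp add: power_mono)
  qed measurable
  have eq: "wgt k x * (norm (tp a x))\<^sup>2 = (\<Sum>l\<in>UNIV. ?G l x)" for x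
    by (simp add: wgt_def sum_distrib_right power_mult_distrib)
  have "(\<integral>\<^sup>+x. ennreal (\<Sum>l\<in>UNIV. ?G l x) \<partial>torus) = ennreal (\<integral>x. (\<Sum>l\<in>UNIV. ?G l x) \<partial>torus)"
    using int by (intro nn_integral_eq_integral integrable_sum) (auto intro!: sum_nonneg)
  also have "(\<integral>x. (\<Sum>l\<in>UNIV. ?G l x) \<partial>torus) = (\<Sum>l\<in>UNIV. sqnorm (fd l k a))"
    using int by (simp add: integral_weight_tp[OF fin])
  finally show ?thesis unfolding eq .
qed

lemma ennreal_mult_add:
  "0 \<le> a \<Longrightarrow> 0 \<le> b \<Longrightarrow> 0 \<le> c \<Longrightarrow> 0 \<le> d \<Longrightarrow>
    ennreal a * ennreal b + ennreal c * ennreal d = ennreal (a * b + c * d)"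
  by (simp add: ennreal_plus[symmetric] ennreal_mult[symmetric] del: ennreal_plus)

text \<open>Weighted Cauchy--Schwarz in additive form: the pointwise inequality 2 z \<le> t w z^2 +
  1 / (t w), with w the weight and z the modulus of the kernel, is integrated off the neighbourhood,
  and t stays free.\<close>

lemma nn_integral_tp_far:
  fixes a :: "int ^ 'n \<Rightarrow> complex"
  assumes fin: "finite (supp a)" and k: "CARD('n) < 2 * k" and r: "0 < r" and t: "0 < t"
  shows "(\<integral>\<^sup>+x. indicator (- nbhd r) x * ennreal (norm (tp a x)) \<partial>torus)
    \<le> ennreal (t / 2 * (\<Sum>l\<in>UNIV. sqnorm (fd l k a)) + 4 ^ CARD('n) * (r ^ CARD('n) / r ^ (2 * k)) / t)" (is "?I \<le> _")
proof -
  have pw: "indicator (- nbhd r) x * ennreal (norm (tp a x))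
     \<le> ennreal (t / 2) * ennreal (wgt k x * (norm (tp a x))\<^sup>2) + ennreal (1 / (2 * t)) * (indicator (- nbhd r) x * ennreal (1 / wgt k x))" for x
  proof (cases "x \<in> nbhd r")
    case False
    define w z where "w = wgt k x" and "z = norm (tp a x)"
    have w: "0 < w" using wgt_pos[of r x k] r False by (simp add: w_def)
    have "0 \<le> (t * w * z - 1)\<^sup>2" by simp
    then have "2 * (t * w) * z \<le> (t * w)\<^sup>2 * z\<^sup>2 + 1" by (simp add: power2_eq_square algebra_simps)
    then have "z \<le> ((t * w)\<^sup>2 * z\<^sup>2 + 1) / (2 * (t * w))" using t w by (simp add: field_simps)
    also have "\<dots> = t / 2 * (w * z\<^sup>2) + 1 / (2 * t) * (1 / w)" using t w by (simp add: field_simps power2_eq_square)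
    finally have "ennreal z \<le> ennreal (t / 2 * (w * z\<^sup>2) + 1 / (2 * t) * (1 / w))" by (rule ennreal_leI)
    also have "\<dots> = ennreal (t / 2) * ennreal (w * z\<^sup>2) + ennreal (1 / (2 * t)) * ennreal (1 / w)"
      using t w by (simp add: ennreal_plus[symmetric] ennreal_mult[symmetric] del: ennreal_plus)
    finally show ?thesis using False by (simp add: w_def z_def)
  qed simp
  have "?I
     \<le> (\<integral>\<^sup>+x. ennreal (t / 2) * ennreal (wgt k x * (norm (tp a x))\<^sup>2) + ennreal (1 / (2 * t)) * (indicator (- nbhd r) x * ennreal (1 / wgt k x)) \<partial>torus)"
    by (intro nn_integral_mono pw)
  also have "\<dots> = ennreal (t / 2) * ennreal (\<Sum>l\<in>UNIV. sqnorm (fd l k a))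
      + ennreal (1 / (2 * t)) * (\<integral>\<^sup>+(x :: real ^ 'n). indicator (- nbhd r) x * ennreal (1 / wgt k x) \<partial>torus)"
    by (subst nn_integral_add, simp, simp, subst nn_integral_cmult, simp, subst nn_integral_cmult, simp)
      (simp add: nn_integral_wgt_tp[OF fin])
  also have "\<dots> \<le> ennreal (t / 2) * ennreal (\<Sum>l\<in>UNIV. sqnorm (fd l k a))
      + ennreal (1 / (2 * t)) * ennreal (2 * 4 ^ CARD('n) * (r ^ CARD('n) / r ^ (2 * k)))"
    by (intro add_left_mono mult_left_mono nn_integral_inverse_wgt k r) auto
  also have "\<dots> = ennreal (t / 2 * (\<Sum>l\<in>UNIV. sqnorm (fd l k a)) + 4 ^ CARD('n) * (r ^ CARD('n) / r ^ (2 * k)) / t)"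
  proof -
    have 1: "0 \<le> (\<Sum>l\<in>UNIV. sqnorm (fd l k a))" by (simp add: sum_nonneg sqnorm_def)
    have 2: "1 / (2 * t) * (2 * 4 ^ CARD('n) * (r ^ CARD('n) / r ^ (2 * k))) = 4 ^ CARD('n) * (r ^ CARD('n) / r ^ (2 * k)) / t"
      using t by simp
    show ?thesis
      unfolding 2[symmetric] by (rule ennreal_mult_add) (use t r 1 in auto)
  qed
  finally show ?thesis .
qed

text \<open>The same inequality with weight 1, on a set whose measure is known.\<close>

lemma nn_integral_tp_near:
  fixes a :: "int ^ 'n \<Rightarrow> complex"
  assumes fin: "finite (supp a)" and r: "0 < r" and t: "0 < t"
  shows "(\<integral>\<^sup>+x. indicator (nbhd r) x * ennreal (norm (tp a x)) \<partial>torus)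
    \<le> ennreal (t / 2 * sqnorm a + (2 * r) ^ CARD('n) / (2 * t))" (is "?I \<le> _")
proof -
  have pw: "indicator (nbhd r) x * ennreal (norm (tp a x))
     \<le> ennreal (t / 2) * ennreal ((norm (tp a x))\<^sup>2) + ennreal (1 / (2 * t)) * indicator (nbhd r) x" for x
  proof (cases "x \<in> nbhd r")
    case True
    define z where "z = norm (tp a x)"
    have "0 \<le> (t * z - 1)\<^sup>2" by simp
    then have "2 * t * z \<le> t\<^sup>2 * z\<^sup>2 + 1" by (simp add: power2_eq_square algebra_simps)
    then have "z \<le> (t\<^sup>2 * z\<^sup>2 + 1) / (2 * t)" using t by (simp add: field_simps)
    also have "\<dots> = t / 2 * z\<^sup>2 + 1 / (2 * t)" using t by (simp add: field_simps power2_eq_square)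
    finally have "ennreal z \<le> ennreal (t / 2 * z\<^sup>2 + 1 / (2 * t))" by (rule ennreal_leI)
    also have "\<dots> = ennreal (t / 2) * ennreal (z\<^sup>2) + ennreal (1 / (2 * t))"
      using t by (simp add: ennreal_plus[symmetric] ennreal_mult[symmetric] del: ennreal_plus)
    finally show ?thesis using True by (simp add: z_def)
  qed simp
  have int: "integrable torus (\<lambda>x. (norm (tp a x))\<^sup>2)"
    by (rule integrable_torus_bounded[where B = "(\<Sum>\<xi> | a \<xi> \<noteq> 0. norm (a \<xi>))\<^sup>2"])
      (auto intro!: power_mono norm_tp_le)
  have "?I
     \<le> (\<integral>\<^sup>+x. ennreal (t / 2) * ennreal ((norm (tp a x))\<^sup>2) + ennreal (1 / (2 * t)) * indicator (nbhd r) x \<partial>torus)"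
    by (intro nn_integral_mono pw)
  also have "\<dots> = ennreal (t / 2) * ennreal (sqnorm a) + ennreal (1 / (2 * t)) * emeasure torus (nbhd r :: (real ^ 'n) set)"
    by (subst nn_integral_add, simp, simp, subst nn_integral_cmult, simp, subst nn_integral_cmult, simp)
      (simp add: nn_integral_eq_integral[OF int] tp_parseval[OF fin] sqnorm_def)
  also have "\<dots> \<le> ennreal (t / 2) * ennreal (sqnorm a) + ennreal (1 / (2 * t)) * ennreal ((2 * r) ^ CARD('n))"
    using r by (intro add_left_mono mult_left_mono emeasure_nbhd) auto
  also have "\<dots> = ennreal (t / 2 * sqnorm a + (2 * r) ^ CARD('n) / (2 * t))"
  proof -
    have 1: "0 \<le> sqnorm a" by (simp add: sqnorm_def sum_nonneg)
    have 2: "1 / (2 * t) * (2 * r) ^ CARD('n) = (2 * r) ^ CARD('n) / (2 * t)" by simp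
    show ?thesis
      unfolding 2[symmetric] by (rule ennreal_mult_add) (use t r 1 in auto)
  qed
  finally show ?thesis .
qed

section \<open>The mass of one dyadic kernel\<close>

lemma nbhd_mono: "r \<le> r' \<Longrightarrow> nbhd r \<subseteq> nbhd r'"
  unfolding nbhd_def by (blast intro: order.trans)

text \<open>The two terms of \<open>nn_integral_tp_far\<close> after balancing: the dimension times
  half the constant of \<open>sqnorm_fd_adapted\<close>, and the volume factor of the inverse
  weight.\<close>

definition far_const :: "nat \<Rightarrow> nat \<Rightarrow> real" where
  "far_const n k = n * (32 * 6 ^ n * (2 ^ (k + 3)) ^ (n + 4 - 2 * k)) / 2 + 4 ^ n"

lemma far_const_nonneg: "0 \<le> far_const n k"
  by (simp add: far_const_def)

lemma adapted_far:
  fixes a :: "int ^ 'n \<Rightarrow> complex"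
  assumes a: "adapted k j A a" and A: "0 < A" and r: "0 < r"
    and k: "CARD('n) < 2 * k" "2 * k < CARD('n) + 4"
  shows "(\<integral>\<^sup>+x. indicator (- nbhd r) x * ennreal (norm (tp a x)) \<partial>torus)
    \<le> ennreal (far_const CARD('n) k * A / sqrt (2 ^ j * r) ^ (2 * k - CARD('n)))" (is "?I \<le> _")
proof -
  let ?n = "CARD('n)"
  define c where "c = 32 * 6 ^ ?n * (2 ^ (k + 3)) ^ (?n + 4 - 2 * k) * (1::real)"
  define R :: real where "R = 2 ^ j"
  define d where "d = 2 * k - ?n"
  define v where "v = sqrt (R * r)"
  \<comment> \<open>Balances the two terms: since the square of v is \<open>R * r\<close>, both
    become a constant times \<open>A / v ^ d\<close>.\<close>
  define t where "t = R ^ d / (v ^ d * A)"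
  have R: "0 < R" by (simp add: R_def)
  have v: "0 < v" using R r by (simp add: v_def)
  have t: "0 < t" using R v A by (simp add: t_def)
  have k2: "2 * k = ?n + d" using k by (simp add: d_def)
  have vv: "v ^ d * v ^ d = R ^ d * r ^ d"
    using R r by (simp add: v_def power_mult_distrib[symmetric])
  have "(\<Sum>l\<in>UNIV. sqnorm (fd l k a)) \<le> (\<Sum>l\<in>(UNIV :: 'n set). c * A\<^sup>2 * (1 / R ^ d))"
  proof (rule sum_mono)
    fix l
    have "R ^ ?n / R ^ (2 * k) = 1 / R ^ d" unfolding k2 using R by (simp add: power_add)
    then show "sqnorm (fd l k a) \<le> c * A\<^sup>2 * (1 / R ^ d)"
      using sqnorm_fd_adapted[OF a k(2), of l] by (simp add: c_def R_def)
  qed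
  then have S: "(\<Sum>l\<in>UNIV. sqnorm (fd l k a)) \<le> ?n * (c * A\<^sup>2 * (1 / R ^ d))" by simp
  have "?I
    \<le> ennreal (t / 2 * (\<Sum>l\<in>UNIV. sqnorm (fd l k a)) + 4 ^ ?n * (r ^ ?n / r ^ (2 * k)) / t)"
    by (rule nn_integral_tp_far[OF adapted_finite_support[OF a] k(1) r t])
  also have "\<dots> \<le> ennreal (far_const ?n k * A / v ^ d)"
  proof (rule ennreal_leI)
    have "t / 2 * (\<Sum>l\<in>UNIV. sqnorm (fd l k a)) \<le> t / 2 * (?n * (c * A\<^sup>2 * (1 / R ^ d)))"
      using S t by (intro mult_left_mono) auto
    also have "\<dots> = ?n * c / 2 * A / v ^ d"
      using R v A by (simp add: t_def field_simps power2_eq_square)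
    finally have 1: "t / 2 * (\<Sum>l\<in>UNIV. sqnorm (fd l k a)) \<le> ?n * c / 2 * A / v ^ d" .
    have "4 ^ ?n * (r ^ ?n / r ^ (2 * k)) / t = 4 ^ ?n * ((v ^ d * A) / (R ^ d * r ^ d))"
      unfolding k2 using r R v A by (simp add: t_def power_add field_simps)
    also have "\<dots> = 4 ^ ?n * A / v ^ d"
      unfolding vv[symmetric] using v by (simp add: field_simps)
    finally show "t / 2 * (\<Sum>l\<in>UNIV. sqnorm (fd l k a)) + 4 ^ ?n * (r ^ ?n / r ^ (2 * k)) / t
        \<le> far_const ?n k * A / v ^ d"
      using 1 by (simp add: far_const_def c_def add_divide_distrib distrib_right)
  qed
  finally show ?thesis by (simp add: v_def d_def R_def)
qed

definition total_const :: "nat \<Rightarrow> nat \<Rightarrow> real" where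
  "total_const n k = far_const n k + (81 * 9 ^ n / 2 + 2 ^ n / 2)"

text \<open>Split at radius \<open>1 / 2 ^ j\<close>, the natural scale of a kernel with frequencies
  of order \<open>2 ^ j\<close>. Outside, the tail bound no longer depends on j; inside, unweighted
  Parseval is played against the volume of the cube.\<close>

lemma adapted_total:
  fixes a :: "int ^ 'n \<Rightarrow> complex"
  assumes a: "adapted k j A a" and A: "0 < A"
    and k: "CARD('n) < 2 * k" "2 * k < CARD('n) + 4"
  shows "(\<integral>\<^sup>+x. ennreal (norm (tp a x)) \<partial>torus) \<le> ennreal (total_const CARD('n) k * A)"
proof -
  let ?n = "CARD('n)"
  define R :: real where "R = 2 ^ j"
  have R: "0 < R" by (simp add: R_def)
  \<comment> \<open>Balances \<open>sqnorm a\<close>, of order \<open>A\<^sup>2 * R ^ ?n\<close>,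
    against the volume of the cube, of order \<open>1 / R ^ ?n\<close>.\<close>
  define t where "t = 1 / (A * R ^ ?n)"
  have t: "0 < t" using R A by (simp add: t_def)
  let ?far = "\<integral>\<^sup>+x. indicator (- nbhd (1 / R)) x * ennreal (norm (tp a x)) \<partial>torus"
  let ?near = "\<integral>\<^sup>+x. indicator (nbhd (1 / R)) x * ennreal (norm (tp a x)) \<partial>torus"
  have "(\<integral>\<^sup>+x. ennreal (norm (tp a x)) \<partial>torus)
      = (\<integral>\<^sup>+x. indicator (- nbhd (1 / R)) x * ennreal (norm (tp a x)) + indicator (nbhd (1 / R)) x * ennreal (norm (tp a x)) \<partial>torus)"
    by (intro nn_integral_cong) (auto simp: indicator_def)
  also have "\<dots> = ?far
      + ?near"
    by (rule nn_integral_add) auto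
  also have "\<dots> \<le> ennreal (far_const ?n k * A) + ennreal ((81 * 9 ^ ?n / 2 + 2 ^ ?n / 2) * A)"
  proof (rule add_mono)
    show "?far \<le> ennreal (far_const ?n k * A)"
      using adapted_far[OF a A _ k, of "1 / R"] R by (simp add: R_def)
    have "?near
       \<le> ennreal (t / 2 * sqnorm a + (2 * (1 / R)) ^ ?n / (2 * t))"
      using R by (intro nn_integral_tp_near adapted_finite_support[OF a] t) simp
    also have "\<dots> \<le> ennreal ((81 * 9 ^ ?n / 2 + 2 ^ ?n / 2) * A)"
    proof (rule ennreal_leI)
      have "t / 2 * sqnorm a \<le> t / 2 * (81 * 9 ^ ?n * A\<^sup>2 * R ^ ?n)"
        using sqnorm_adapted[OF a] t by (intro mult_left_mono) (auto simp: R_def)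
      also have "\<dots> = 81 * 9 ^ ?n / 2 * A"
        using R A by (simp add: t_def field_simps power2_eq_square)
      finally have "t / 2 * sqnorm a \<le> 81 * 9 ^ ?n / 2 * A" .
      moreover have "(2 * (1 / R)) ^ ?n / (2 * t) = 2 ^ ?n / 2 * A"
        using R A by (simp add: t_def field_simps)
      ultimately show "t / 2 * sqnorm a + (2 * (1 / R)) ^ ?n / (2 * t) \<le> (81 * 9 ^ ?n / 2 + 2 ^ ?n / 2) * A"
        by (simp add: distrib_right)
    qed
    finally show "?near
        \<le> ennreal ((81 * 9 ^ ?n / 2 + 2 ^ ?n / 2) * A)" .
  qed
  also have "\<dots> = ennreal (total_const ?n k * A)"
    using A far_const_nonneg[of ?n k]
    by (subst ennreal_plus[symmetric]) (auto simp: total_const_def distrib_right)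
  finally show ?thesis .
qed

section \<open>Summation over the dyadic scales\<close>

lemma sum_min_dyadic_low:
  assumes "0 < s"
  shows "(\<Sum>j<J. if 2 ^ j * s \<le> 1 then 2 ^ j * s else (0::real)) \<le> min 2 (2 ^ J * s)"
proof (induction J)
  case (Suc J)
  have "2 ^ J * s \<le> 2 ^ Suc J * s" using assms by simp
  then show ?case using Suc by (auto simp: min_def mult.commute split: if_splits)
qed (use assms in simp)

text \<open>Telescoping: once x = \<open>2 ^ J * s\<close> exceeds 1, the new term
  \<open>1 / sqrt x\<close> is at most \<open>4 / sqrt x - 4 / sqrt (2 * x)\<close>, because 4 /
  sqrt 2 \<le> 3. The right side depends on J to carry the induction, as does
  \<open>min 2 (2 ^ J * s)\<close> in the sum over low scales.\<close>

lemma sum_min_dyadic_high: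
  assumes "0 < s"
  shows "(\<Sum>j<J. if 2 ^ j * s \<le> 1 then 0 else 1 / sqrt (2 ^ j * s)) \<le> 4 - 4 / sqrt (max 1 (2 ^ J * s))"
proof (induction J)
  case (Suc J)
  define x where "x = 2 ^ J * s"
  have x: "0 < x" using assms by (simp add: x_def)
  have x2: "2 ^ Suc J * s = 2 * x" by (simp add: x_def)
  show ?case
  proof (cases "x \<le> 1")
    case True
    have "1 \<le> sqrt (max 1 (2 * x))" by (simp add: real_sqrt_ge_one)
    then have "4 / sqrt (max 1 (2 * x)) \<le> 4" by (simp add: divide_simps)
    then show ?thesis using Suc True unfolding x2 by (simp add: x_def[symmetric])
  next
    case False
    have "4 / sqrt (2 * x) \<le> 3 / sqrt x"
    proof -
      have "(4 / 3 :: real) \<le> sqrt 2" by (rule real_le_rsqrt) (simp add: power2_eq_square)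
      then have "4 * sqrt x \<le> 3 * (sqrt 2 * sqrt x)" using x by (simp add: field_simps)
      then show ?thesis using x by (simp add: real_sqrt_mult divide_simps)
    qed
    then show ?thesis using Suc False unfolding x2 by (simp add: x_def[symmetric] max_def)
  qed
next
  case 0
  have "1 \<le> sqrt (max 1 s)" by (simp add: real_sqrt_ge_one)
  then show ?case by (simp add: divide_simps)
qed

text \<open>What the j-th kernel contributes for translations of length up to s: first-order
  cancellation while \<open>2 ^ j * s \<le> 1\<close>, decay of the tail afterwards. The exponent
  1/2 is the least value of k - n / 2, attained in odd dimensions.\<close>

definition dyadic_decay :: "real \<Rightarrow> nat \<Rightarrow> real" where
  "dyadic_decay s j = (if 2 ^ j * s \<le> 1 then 2 ^ j * s else 1 / sqrt (2 ^ j * s))"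

lemma sum_min_dyadic:
  assumes "0 < s"
  shows "(\<Sum>j<J. dyadic_decay s j) \<le> 6"
proof -
  have "(\<Sum>j<J. dyadic_decay s j)
     = (\<Sum>j<J. if 2 ^ j * s \<le> 1 then 2 ^ j * s else 0) + (\<Sum>j<J. if 2 ^ j * s \<le> 1 then 0 else 1 / sqrt (2 ^ j * s))"
    by (auto simp: dyadic_decay_def sum.distrib[symmetric] intro!: sum.cong)
  moreover have "0 \<le> 4 / sqrt (max 1 (2 ^ J * s))" by simp
  ultimately show ?thesis
    using sum_min_dyadic_low[OF assms, of J] sum_min_dyadic_high[OF assms, of J] by linarith
qed

text \<open>Telescoping from radius 1, where the cutoff is the indicator of the origin because every
  other lattice point has length at least 1; hence the separate term
  \<open>\<sigma> 0\<close>.\<close>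

lemma tp_cutoff_decomposition:
  fixes \<sigma> :: "int ^ 'n \<Rightarrow> complex"
  assumes k: "1 \<le> k"
  shows "tp (\<lambda>\<xi>. \<sigma> \<xi> * cutoff k (2 ^ J) \<xi>) x = \<sigma> 0 + (\<Sum>j<J. tp (\<lambda>\<xi>. dyadic_cutoff k j \<xi> * \<sigma> \<xi>) x)"
    and "finite {\<xi>. \<sigma> \<xi> * cutoff k (2 ^ J) \<xi> \<noteq> 0}"
proof (induction J)
  case 0
  have z: "cutoff k 1 \<xi> = 0" if nz: "\<xi> \<noteq> 0" for \<xi> :: "int ^ 'n"
  proof (rule cutoff_eq_0)
    obtain i where "\<xi> $ i \<noteq> 0" using nz by (auto simp: vec_eq_iff)
    then have "1 \<le> \<bar>\<xi> $ i\<bar>" by linarith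
    then have "1 \<le> \<bar>real_of_int (\<xi> $ i)\<bar>" by linarith
    then have "1 \<le> (real_of_int (\<xi> $ i))\<^sup>2" using one_le_power[of "\<bar>real_of_int (\<xi> $ i)\<bar>" 2] by simp
    then show "1\<^sup>2 \<le> nsq \<xi>" using abs_component_sq_le[of \<xi> i] by simp
  qed (use k in auto)
  have sub: "{\<xi>. \<sigma> \<xi> * cutoff k 1 \<xi> \<noteq> 0} \<subseteq> {0}" using z by auto
  have "cutoff k 1 (0 :: int ^ 'n) = 1" by (simp add: cutoff_def hat_def nsq_def)
  then show "tp (\<lambda>\<xi>. \<sigma> \<xi> * cutoff k (2 ^ 0) \<xi>) x = \<sigma> 0 + (\<Sum>j<0. tp (\<lambda>\<xi>. dyadic_cutoff k j \<xi> * \<sigma> \<xi>) x)"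
    using sub by (subst tp_eq[where S = "{0}"]) auto
  show "finite {\<xi>. \<sigma> \<xi> * cutoff k (2 ^ 0) \<xi> \<noteq> 0}" using sub finite_subset by auto
next
  case (Suc J)
  have fin: "finite {\<xi>. dyadic_cutoff k J \<xi> * \<sigma> \<xi> \<noteq> 0}"
    using adapted_finite_support[OF adapted_dyadic_cutoff[OF k, of J]] by (rule rev_finite_subset) auto
  show fin': "finite {\<xi>. \<sigma> \<xi> * cutoff k (2 ^ Suc J) \<xi> \<noteq> 0}"
    by (rule finite_subset[OF _ finite_UnI[OF Suc(2) fin]]) (auto simp: dyadic_cutoff_def)
  have "(\<lambda>\<xi>. dyadic_cutoff k J \<xi> * \<sigma> \<xi>) = (\<lambda>\<xi>. \<sigma> \<xi> * cutoff k (2 ^ Suc J) \<xi> - \<sigma> \<xi> * cutoff k (2 ^ J) \<xi>)"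
    by (simp add: dyadic_cutoff_def fun_eq_iff algebra_simps)
  then show "tp (\<lambda>\<xi>. \<sigma> \<xi> * cutoff k (2 ^ Suc J) \<xi>) x = \<sigma> 0 + (\<Sum>j<Suc J. tp (\<lambda>\<xi>. dyadic_cutoff k j \<xi> * \<sigma> \<xi>) x)"
    using tp_diff[OF fin' Suc(2), of x] Suc(1) by simp
qed

definition hormander :: "(int ^ 'n \<Rightarrow> complex) \<Rightarrow> real \<Rightarrow> bool" where
  "hormander a H \<longleftrightarrow> 0 \<le> H \<and> (\<forall>r y. 0 < r \<longrightarrow> (\<forall>i. \<bar>y $ i\<bar> \<le> r) \<longrightarrow>
     (\<integral>\<^sup>+x. indicator (- nbhd (2 * r)) x * ennreal (norm (tp a (x - y) - tp a x)) \<partial>torus) \<le> ennreal H)"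

theorem hormander_condition:
  fixes \<sigma> :: "int ^ 'n \<Rightarrow> complex"
  assumes \<sigma>: "\<And>l m \<xi>. m \<le> k \<Longrightarrow> norm (fd l m \<sigma> \<xi>) \<le> B / japanese \<xi> ^ m" and B: "0 < B"
    and k: "CARD('n) < 2 * k" "2 * k < CARD('n) + 4"
  obtains H where "\<And>J. hormander (\<lambda>\<xi>. \<sigma> \<xi> * cutoff k (2 ^ J) \<xi>) H"
proof -
  let ?n = "CARD('n)"
  have k1: "1 \<le> k" using k by simp
  define M where "M = 2 ^ k * (1 + real k) ^ (k + 2)"
  have M: "0 < M" by (simp add: M_def)
  have cc: "0 < cutoff_const k" using k1 by (simp add: cutoff_const_def add_nonneg_pos)
  define A where "A = M * (2 * cutoff_const k) * B"
  have A: "0 < A" using M cc B by (simp add: A_def)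
  define \<tau> where "\<tau> j \<xi> = dyadic_cutoff k j \<xi> * \<sigma> \<xi>" for j \<xi>
  have ad: "adapted k j A (\<tau> j)" for j
    unfolding \<tau>_def A_def M_def by (rule adapted_mult[OF adapted_dyadic_cutoff[OF k1]]) (use B \<sigma> in auto)
  define B1 where "B1 = (2 * pi * (real k + 3)) ^ (k + 1)"
  have B1: "0 < B1" unfolding B1_def by (intro zero_less_power mult_pos_pos) auto
  define L where "L = total_const ?n k * (M * A * B1)"
  \<comment> \<open>The factor 2 counts the kernel and its translate. The third power of the
    dimension pays for replacing r by s, which is n times r, in a decay whose exponent
    \<open>2 * k - ?n\<close> is at most 3.\<close>
  define U where "U = 2 * (far_const ?n k * A * real ?n ^ 3)"
  have tc: "0 \<le> total_const ?n k" using far_const_nonneg[of ?n k] by (simp add: total_const_def)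
  have L: "0 \<le> L" using tc M A B1 by (simp add: L_def)
  have U: "0 \<le> U" using far_const_nonneg[of ?n k] A by (simp add: U_def)
  define H where "H = (L + U) * 6"
  show ?thesis
  proof (rule that[of H], unfold hormander_def, intro conjI allI impI)
    show "0 \<le> H" using L U by (simp add: H_def)
    fix J r and y :: "real ^ 'n" assume r: "0 < r" and "\<forall>i. \<bar>y $ i\<bar> \<le> r"
    then have y: "\<And>i. \<bar>y $ i\<bar> \<le> r" by blast
    let ?K = "tp (\<lambda>\<xi>. \<sigma> \<xi> * cutoff k (2 ^ J) \<xi>)"
    \<comment> \<open>A bound for the Euclidean length of y, which governs the modulation, whereas r
      measures y in the maximum norm.\<close>
    define s where "s = real ?n * r"
    have s: "0 < s" using r by (simp add: s_def)
    have ys: "norm y \<le> s"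
    proof -
      have "norm y \<le> (\<Sum>i\<in>UNIV. \<bar>y $ i\<bar>)" by (rule norm_le_l1_cart)
      also have "\<dots> \<le> (\<Sum>i\<in>(UNIV :: 'n set). r)" by (intro sum_mono y)
      finally show ?thesis by (simp add: s_def)
    qed
    define g where "g j x = indicator (- nbhd (2 * r)) x * ennreal (norm (tp (\<tau> j) (x - y) - tp (\<tau> j) x))" for j x
    have gm [measurable]: "g j \<in> borel_measurable borel" for j unfolding g_def by measurable
    have gb: "(\<integral>\<^sup>+x. g j x \<partial>torus)
        \<le> ennreal ((L + U) * dyadic_decay s j)" for j
    proof (cases "2 ^ j * s \<le> 1")
      case True
      have yj: "norm y * 2 ^ j \<le> 2 ^ j * s" using ys by (simp add: mult.commute)
      have "adapted k j (2 ^ k * (1 + real k) ^ (k + 2) * A * (B1 * (2 ^ j * s))) (\<lambda>\<xi>. \<tau> j \<xi> * (cnj (chr \<xi> y) - 1))"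
      proof (rule adapted_mult[OF ad])
        show "0 \<le> B1 * (2 ^ j * s)" using B1 s by simp
        fix l m and \<xi> :: "int ^ 'n" assume m: "m \<le> k" and J: "japanese \<xi> \<le> (real k + 3) * 2 ^ j"
        have "norm (fd l m (\<lambda>\<zeta>. cnj (chr \<zeta> y) - 1) \<xi>) \<le> B1 * (norm y * 2 ^ j) / japanese \<xi> ^ m"
          unfolding B1_def by (rule fd_modulation_bound[OF order.trans[OF yj True] m J]) simp
        also have "\<dots> \<le> B1 * (2 ^ j * s) / japanese \<xi> ^ m"
          using yj B1 by (intro divide_right_mono mult_left_mono) (auto simp: less_imp_le[OF japanese_pos])
        finally show "norm (fd l m (\<lambda>\<zeta>. cnj (chr \<zeta> y) - 1) \<xi>) \<le> B1 * (2 ^ j * s) / japanese \<xi> ^ m" .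
      qed
      then have "(\<integral>\<^sup>+x. ennreal (norm (tp (\<lambda>\<xi>. \<tau> j \<xi> * (cnj (chr \<xi> y) - 1)) x)) \<partial>torus)
          \<le> ennreal (total_const ?n k * (M * A * (B1 * (2 ^ j * s))))"
        unfolding M_def using A B1 s by (intro adapted_total k) auto
      also have "\<dots> \<le> ennreal ((L + U) * (2 ^ j * s))"
        using U s by (intro ennreal_leI) (simp add: L_def algebra_simps)
      finally have "(\<integral>\<^sup>+x. ennreal (norm (tp (\<tau> j) (x - y) - tp (\<tau> j) x)) \<partial>torus) \<le> ennreal ((L + U) * (2 ^ j * s))"
        by (simp add: tp_translate_diff[OF adapted_finite_support[OF ad]])
      moreover have "(\<integral>\<^sup>+x. g j x \<partial>torus) \<le> (\<integral>\<^sup>+x. ennreal (norm (tp (\<tau> j) (x - y) - tp (\<tau> j) x)) \<partial>torus)"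
        unfolding g_def by (intro nn_integral_mono) (auto simp: indicator_def)
      ultimately show ?thesis using True by (simp add: dyadic_decay_def)
    next
      case False
      \<comment> \<open>For these frequencies no cancellation is sought: x outside
        \<open>nbhd (2 * r)\<close> and coordinates of y of modulus at most r put both x and x - y
        outside \<open>nbhd r\<close>, which leaves two tails.\<close>
      define F where "F x = indicator (- nbhd r) x * ennreal (norm (tp (\<tau> j) x))" for x
      have Fm [measurable]: "F \<in> borel_measurable borel" unfolding F_def by measurable
      have Fp: "lperiodic F" unfolding F_def
        by (intro lperiodic_mult lperiodic_indicator_nbhd lperiodic_compose[OF lperiodic_tp])
      have "g j x \<le> F (x + - y) + F x" for x
      proof (cases "x \<in> nbhd (2 * r)")
        case False
        have "x \<notin> nbhd r" using False nbhd_mono[of r "2 * r"] r by auto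
        moreover have "x - y \<notin> nbhd r"
        proof
          assume *: "x - y \<in> nbhd r"
          have "\<exists>m :: int. \<bar>x $ i - of_int m\<bar> \<le> 2 * r" for i
          proof -
            obtain m :: int where "\<bar>(x - y) $ i - of_int m\<bar> \<le> r" using * by (auto simp: nbhd_def)
            then have "\<bar>x $ i - of_int m\<bar> \<le> 2 * r" using y[of i] by simp
            then show ?thesis by blast
          qed
          with False show False by (simp add: nbhd_def)
        qed
        ultimately show ?thesis
          using False norm_triangle_ineq4[of "tp (\<tau> j) (x - y)" "tp (\<tau> j) x"]
          by (simp add: g_def F_def ennreal_plus[symmetric] ennreal_leI del: ennreal_plus)
      qed (simp add: g_def)
      then have "(\<integral>\<^sup>+x. g j x \<partial>torus) \<le> (\<integral>\<^sup>+x. F (x + - y) + F x \<partial>torus)" by (intro nn_integral_mono)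
      also have "\<dots> = (\<integral>\<^sup>+x. F (x + - y) \<partial>torus) + (\<integral>\<^sup>+x. F x \<partial>torus)" by (rule nn_integral_add) auto
      also have "\<dots> = 2 * (\<integral>\<^sup>+x. F x \<partial>torus)"
        by (subst nn_integral_torus_translation[OF Fm Fp]) (simp add: mult_2)
      also have "\<dots> \<le> 2 * ennreal (far_const ?n k * A / sqrt (2 ^ j * r) ^ (2 * k - ?n))"
        unfolding F_def by (intro mult_left_mono adapted_far[OF ad A r k]) auto
      also have "\<dots> = ennreal (2 * (far_const ?n k * A / sqrt (2 ^ j * r) ^ (2 * k - ?n)))"
        using far_const_nonneg[of ?n k] A r by (subst ennreal_mult) auto
      also have "\<dots> \<le> ennreal ((L + U) * (1 / sqrt (2 ^ j * s)))"
      proof (rule ennreal_leI)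
        define v w d where "v = sqrt (2 ^ j * r)" and "w = sqrt (2 ^ j * s)" and "d = 2 * k - ?n"
        have n1: "1 \<le> real ?n" by (simp add: Suc_leI)
        have v: "0 < v" using r by (simp add: v_def)
        have w: "1 \<le> w" using False by (simp add: w_def real_sqrt_ge_one)
        have "w = sqrt (real ?n) * v" by (simp add: w_def v_def s_def real_sqrt_mult)
        also have "\<dots> \<le> real ?n * v"
        proof (rule mult_right_mono)
          show "sqrt (real ?n) \<le> real ?n" using n1 by (intro real_le_lsqrt) (auto simp: power2_eq_square)
        qed (use v in simp)
        finally have wv: "w \<le> real ?n * v" .
        have d: "1 \<le> d" "d \<le> 3" using k by (auto simp: d_def)
        \<comment> \<open>As w is at least 1 in this case, the decay exponent d may be lowered to 1,
          which treats even and odd dimensions alike.\<close>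
        have "w \<le> w ^ d" using w d power_increasing[of 1 d w] by simp
        also have "\<dots> \<le> (real ?n * v) ^ d" using wv w by (intro power_mono) auto
        also have "\<dots> = real ?n ^ d * v ^ d" by (simp add: power_mult_distrib)
        also have "\<dots> \<le> real ?n ^ 3 * v ^ d" using n1 d v by (intro mult_right_mono power_increasing) auto
        finally have "1 / v ^ d \<le> real ?n ^ 3 * (1 / w)" using v w by (simp add: field_simps)
        then have "2 * (far_const ?n k * A) * (1 / v ^ d) \<le> 2 * (far_const ?n k * A) * (real ?n ^ 3 * (1 / w))"
          using far_const_nonneg[of ?n k] A by (intro mult_left_mono) auto
        also have "\<dots> = U * (1 / w)" by (simp add: U_def)
        also have "\<dots> \<le> (L + U) * (1 / w)" using L w by (intro mult_right_mono) auto
        finally show "2 * (far_const ?n k * A / sqrt (2 ^ j * r) ^ (2 * k - ?n)) \<le> (L + U) * (1 / sqrt (2 ^ j * s))"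
          by (simp add: v_def w_def d_def)
      qed
      finally show ?thesis using False by (simp add: dyadic_decay_def)
    qed
    have "(\<integral>\<^sup>+x. indicator (- nbhd (2 * r)) x * ennreal (norm (?K (x - y) - ?K x)) \<partial>torus) \<le> (\<integral>\<^sup>+x. (\<Sum>j<J. g j x) \<partial>torus)"
    proof (rule nn_integral_mono)
      fix x
      \<comment> \<open>The constant term \<open>\<sigma> 0\<close> of the decomposition cancels in
        the difference.\<close>
      have "?K (x - y) - ?K x
          = (\<Sum>j<J. tp (\<tau> j) (x - y) - tp (\<tau> j) x)"
        by (simp add: tp_cutoff_decomposition(1)[OF k1] \<tau>_def[abs_def] sum_subtractf)
      then have "norm (?K (x - y) - ?K x)
          \<le> (\<Sum>j<J. norm (tp (\<tau> j) (x - y) - tp (\<tau> j) x))"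
        by (simp only: norm_sum)
      then have "ennreal (norm (?K (x - y) - ?K x))
          \<le> (\<Sum>j<J. ennreal (norm (tp (\<tau> j) (x - y) - tp (\<tau> j) x)))"
        by (subst sum_ennreal) (auto intro: ennreal_leI)
      then show "indicator (- nbhd (2 * r)) x * ennreal (norm (?K (x - y) - ?K x)) \<le> (\<Sum>j<J. g j x)"
        unfolding g_def sum_distrib_left[symmetric] by (rule mult_left_mono) simp
    qed
    also have "\<dots> = (\<Sum>j<J. \<integral>\<^sup>+x. g j x \<partial>torus)" by (rule nn_integral_sum) simp
    also have "\<dots> \<le> (\<Sum>j<J. ennreal ((L + U) * dyadic_decay s j))"
      by (intro sum_mono gb)
    also have "\<dots> = ennreal (\<Sum>j<J. (L + U) * dyadic_decay s j)"
      using L U s by (intro sum_ennreal mult_nonneg_nonneg) (auto simp: dyadic_decay_def)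
    also have "\<dots> \<le> ennreal H"
      unfolding H_def sum_distrib_left[symmetric]
      using L U by (intro ennreal_leI mult_left_mono sum_min_dyadic s) auto
    finally show "(\<integral>\<^sup>+x. indicator (- nbhd (2 * r)) x * ennreal (norm (?K (x - y) - ?K x)) \<partial>torus) \<le> ennreal H" .
  qed
qed

section \<open>The Calderon--Zygmund decomposition\<close>

text \<open>Integer label of the half-open dyadic cube of side \<open>1 / 2 ^ j\<close> around x.
  Passing to the parent cube halves each entry (\<open>key_Suc\<close>), which turns nesting of
  cubes into arithmetic.\<close>

definition key :: "nat \<Rightarrow> real ^ 'n \<Rightarrow> int ^ 'n" where
  "key j x = (\<chi> i. \<lfloor>2 ^ j * x $ i\<rfloor>)"

definition cell :: "nat \<Rightarrow> int ^ 'n \<Rightarrow> (real ^ 'n) set" where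
  "cell j q = {x. key j x = q}"

lemma cell_alt: "cell j q = {x. \<forall>i. of_int (q $ i) \<le> 2 ^ j * x $ i \<and> 2 ^ j * x $ i < of_int (q $ i) + 1}"
  by (auto simp: cell_def key_def vec_eq_iff floor_eq_iff)

lemma cell_measurable [measurable]: "cell j q \<in> sets borel"
  unfolding cell_alt by measurable

lemma key_Suc: "key j x = (\<chi> i. key (Suc j) x $ i div 2)"
proof -
  have "\<lfloor>2 ^ j * x $ i\<rfloor> = \<lfloor>2 ^ Suc j * x $ i\<rfloor> div 2" for i
    using floor_divide_real_eq_div[of 2 "2 ^ Suc j * x $ i"] by simp
  then show ?thesis by (simp add: key_def vec_eq_iff)
qed

lemma key_coarsen:
  assumes "i \<le> j" "key j x = key j y"
  shows "key i x = key i y"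
  using assms
proof (induction j)
  case (Suc j)
  have "key j x = key j y" unfolding key_Suc[of j] using Suc.prems(2) by simp
  then show ?case using Suc by (cases "i = Suc j") auto
qed simp

lemma fund_iff_key: "x \<in> fund \<longleftrightarrow> key 0 x = 0"
  by (simp add: fund_def key_def vec_eq_iff floor_eq_iff)

lemma fund_cell: "fund = cell 0 0"
  by (auto simp: fund_iff_key cell_def)

lemma cell_subset_fund: "x \<in> fund \<Longrightarrow> cell j (key j x) \<subseteq> fund"
proof
  fix y assume "x \<in> fund" "y \<in> cell j (key j x)"
  then show "y \<in> fund" using key_coarsen[OF le0, of j y x] by (simp add: fund_iff_key cell_def)
qed

text \<open>The lower corner serves as the centre of the cube, so the full side length acts as its
  radius later on.\<close>

lemma cell_corner: "x \<in> cell j q \<Longrightarrow> \<bar>x $ i - of_int (q $ i) / 2 ^ j\<bar> \<le> 1 / 2 ^ j"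
proof -
  assume "x \<in> cell j q"
  then have *: "of_int (q $ i) \<le> 2 ^ j * x $ i" "2 ^ j * x $ i < of_int (q $ i) + 1"
    by (auto simp: cell_alt)
  have "of_int (q $ i) / 2 ^ j \<le> x $ i" using *(1) by (simp add: field_simps)
  moreover have "x $ i \<le> of_int (q $ i) / 2 ^ j + 1 / 2 ^ j" using *(2) by (simp add: field_simps)
  ultimately show ?thesis by linarith
qed

lemma emeasure_cell: "emeasure lborel (cell j q :: (real ^ 'n) set) = ennreal ((1 / 2 ^ j) ^ CARD('n))"
proof -
  let ?a = "(\<chi> i. of_int (q $ i) / 2 ^ j) :: real ^ 'n" and ?b = "(\<chi> i. (of_int (q $ i) + 1) / 2 ^ j) :: real ^ 'n"
  have le: "?a $ i \<le> ?b $ i" for i by (simp add: divide_right_mono)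
  have "?a \<in> cbox ?a ?b" using le by (simp add: mem_box_cart)
  then have "measure lborel (cbox ?a ?b) = (\<Prod>i\<in>UNIV. ?b $ i - ?a $ i)" by (intro content_cbox_cart) auto
  also have "\<dots> = (1 / 2 ^ j) ^ CARD('n)" by (simp add: diff_divide_distrib[symmetric])
  finally have c: "emeasure lborel (cbox ?a ?b) = ennreal ((1 / 2 ^ j) ^ CARD('n))"
    by (subst emeasure_eq_ennreal_measure) (auto simp: emeasure_lborel_cbox_eq)
  have b: "emeasure lborel (box ?a ?b) = emeasure lborel (cbox ?a ?b)"
    by (simp add: emeasure_lborel_box_eq emeasure_lborel_cbox_eq)
  have "box ?a ?b \<subseteq> cell j q" "cell j q \<subseteq> cbox ?a ?b"
    by (auto simp: cell_alt mem_box_cart field_simps less_imp_le)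
  then have "emeasure lborel (box ?a ?b) \<le> emeasure lborel (cell j q)" "emeasure lborel (cell j q) \<le> emeasure lborel (cbox ?a ?b)"
    by (auto intro!: emeasure_mono)
  then show ?thesis using b c by simp
qed

lemma measure_torus_cell:
  assumes "cell j q \<subseteq> (fund :: (real ^ 'n) set)"
  shows "measure torus (cell j q :: (real ^ 'n) set) = (1 / 2 ^ j) ^ CARD('n)"
proof -
  have "emeasure torus (cell j q :: (real ^ 'n) set) = ennreal ((1 / 2 ^ j) ^ CARD('n))"
    using assms by (simp add: emeasure_torus Int_absorb1 emeasure_cell)
  then show ?thesis by (simp add: measure_def)
qed

lemma AE_torus_fund: "AE x in torus. x \<in> (fund :: (real ^ 'n) set)"
  unfolding torus_def by (subst AE_density) (auto simp: indicator_def)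

lemma lperiodic_bounded:
  fixes f :: "real ^ 'n \<Rightarrow> complex"
  assumes "continuous_on UNIV f" "lperiodic f"
  obtains B where "0 < B" "\<And>x. norm (f x) \<le> B"
proof -
  have "compact (f ` cbox 0 1)"
    by (intro compact_continuous_image continuous_on_subset[OF assms(1)] compact_cbox) auto
  then have "bounded (f ` cbox 0 1)" by (rule compact_imp_bounded)
  then obtain B where B: "0 < B" "\<And>z. z \<in> f ` cbox 0 1 \<Longrightarrow> norm z \<le> B"
    unfolding bounded_pos by blast
  have "norm (f x) \<le> B" for x
  proof -
    define m :: "int ^ 'n" where "m = (\<chi> i. \<lfloor>x $ i\<rfloor>)"
    have "x - lattice_vec m \<in> cbox 0 1"
      unfolding mem_box_cart m_def by (auto, linarith)
    then have "norm (f (x - lattice_vec m)) \<le> B" using B(2) by blast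
    moreover have "f (x - lattice_vec m) = f x" using lperiodicD[OF assms(2), of "x - lattice_vec m" m] by simp
    ultimately show ?thesis by simp
  qed
  with B(1) show ?thesis by (rule that)
qed

text \<open>Uniform continuity of \<open>f\<close> stops the selection at a finite generation, so that no
  differentiation theorem is needed.\<close>

lemma calderon_zygmund_cells:
  fixes f :: "real ^ 'n \<Rightarrow> complex"
  assumes cont: "continuous_on UNIV f" and per: "lperiodic f" and lam: "0 < \<mu>"
    and small: "(\<integral>x. norm (f x) \<partial>torus) \<le> \<mu>"
  obtains I :: "(nat \<times> (int ^ 'n)) set" where "finite I"
    "disjoint_family_on (\<lambda>(j, q). cell j q) I"
    "\<And>j q. (j, q) \<in> I \<Longrightarrow> cell j q \<subseteq> fund"
    "\<And>j q. (j, q) \<in> I \<Longrightarrow> \<mu> * measure torus (cell j q) \<le> (\<integral>x. indicator (cell j q) x * norm (f x) \<partial>torus)"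
    "\<And>j q. (j, q) \<in> I \<Longrightarrow> (\<integral>x. indicator (cell j q) x * norm (f x) \<partial>torus) \<le> 2 ^ CARD('n) * \<mu> * measure torus (cell j q)"
    "\<And>x. x \<in> fund \<Longrightarrow> x \<notin> (\<Union>(j, q)\<in>I. cell j q) \<Longrightarrow> norm (f x) \<le> 2 * \<mu>"
proof -
  let ?n = "CARD('n)"
  have fm [measurable]: "f \<in> borel_measurable borel" using cont by (rule borel_measurable_continuous_onI)
  obtain B where B: "0 < B" "\<And>x. norm (f x) \<le> B" using lperiodic_bounded[OF cont per] by metis
  have int: "integrable torus (\<lambda>x. indicator Q x * norm (f x))" if [measurable]: "Q \<in> sets borel" for Q
    by (rule integrable_torus_bounded[where B = B]) (use B in \<open>auto simp: indicator_def less_imp_le\<close>)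
  \<comment> \<open>The factor \<open>(2 ^ j) ^ ?n\<close> is the reciprocal of the measure of a
    cell inside \<open>fund\<close>, so this is the mean of |f| over the cell of generation j around
    x.\<close>
  define av where "av j x = (2 ^ j) ^ ?n * (\<integral>y. indicator (cell j (key j x)) y * norm (f y) \<partial>torus)" for j and x :: "real ^ 'n"
  have av_cong: "av i x = av i y" if "key i x = key i y" for i x y using that by (simp add: av_def)
  \<comment> \<open>The first generation at which the mean exceeds \<open>\<mu>\<close>. Being first
    gives both the disjointness of the selected cells and the bound on the parent of each.\<close>
  define stop where "stop j x \<longleftrightarrow> \<mu> < av j x \<and> (\<forall>i<j. av i x \<le> \<mu>)" for j x
  have "uniformly_continuous_on (cbox 0 1) f"
    by (intro compact_uniformly_continuous continuous_on_subset[OF cont] compact_cbox) auto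
  then obtain \<delta> where \<delta>: "0 < \<delta>" "\<And>x y. x \<in> cbox 0 1 \<Longrightarrow> y \<in> cbox 0 1 \<Longrightarrow> dist y x < \<delta> \<Longrightarrow> dist (f y) (f x) < \<mu>"
    using lam unfolding uniformly_continuous_on_def by metis
  \<comment> \<open>Two points of a cell of generation J differ by at most
    \<open>2 * (1 / 2) ^ J\<close> in each coordinate, hence by less than \<open>\<delta>\<close> in
    norm.\<close>
  obtain J where J: "(1 / 2) ^ J < \<delta> / (2 * ?n)"
    using real_arch_pow_inv[of "\<delta> / (2 * ?n)" "1 / 2"] \<delta>(1) by auto
  define I where "I = (\<lambda>(j, x). (j, key j x)) ` {(j, x). j \<le> J \<and> x \<in> fund \<and> stop j x}"
  have IE: "\<exists>x\<in>fund. j \<le> J \<and> stop j x \<and> q = key j x" if "(j, q) \<in> I" for j q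
    using that by (auto simp: I_def)
  have cint: "(\<integral>y. indicator (cell j (key j x)) y * norm (f y) \<partial>torus) = av j x * measure torus (cell j (key j x))"
    if "x \<in> fund" for j x
    using measure_torus_cell[OF cell_subset_fund[OF that], of j] by (simp add: av_def power_one_over)
  have av0: "av 0 x \<le> \<mu>" if "x \<in> fund" for x
  proof -
    have "av 0 x = (\<integral>y. indicator fund y * norm (f y) \<partial>torus)"
      using that by (simp add: av_def fund_iff_key[of x] fund_cell[symmetric])
    also have "\<dots> = (\<integral>y. norm (f y) \<partial>torus)"
      by (rule integral_cong_AE) (use AE_torus_fund in \<open>auto simp: indicator_def\<close>)
    finally show ?thesis using small by simp
  qed
  show ?thesis
  proof (rule that[of I])
    let ?V = "{q :: int ^ 'n. \<forall>i. q $ i \<in> {0..2 ^ J}}"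
    have "I \<subseteq> {..J} \<times> ?V"
    proof safe
      fix j q assume "(j, q) \<in> I"
      then obtain x where x: "x \<in> fund" "j \<le> J" "q = key j x" using IE by blast
      then show "j \<le> J" by simp
      fix i
      have xi: "0 \<le> x $ i" "x $ i < 1" using x(1) by (auto simp: fund_def)
      have "2 ^ j * x $ i \<le> 2 ^ J * 1" using xi x(2) by (intro mult_mono power_increasing) auto
      then have "\<lfloor>2 ^ j * x $ i\<rfloor> \<le> \<lfloor>(2::real) ^ J\<rfloor>" by (intro floor_mono) simp
      also have "\<lfloor>(2::real) ^ J\<rfloor> = 2 ^ J" using floor_of_int[of "2 ^ J", where ?'a = real] by simp
      finally show "q $ i \<in> {0..2 ^ J}" using xi x(3) by (simp add: key_def)
    qed
    moreover have "finite ({..J} \<times> ?V)" by (intro finite_cartesian_product card_vec_le(1)) auto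
    ultimately show "finite I" by (rule finite_subset)
    have dis: "(j, q) = (i, p)" if 1: "(j, q) \<in> I" "(i, p) \<in> I" and z: "z \<in> cell j q" "z \<in> cell i p" and ij: "i \<le> j" for j q i p z
    proof -
      obtain x y where x: "stop j x" "q = key j x" and y: "stop i y" "p = key i y" using IE 1 by blast
      have zx: "key j z = key j x" and zy: "key i z = key i y" using z x y by (auto simp: cell_def)
      have "i = j"
      proof (rule ccontr)
        assume "i \<noteq> j"
        then have "av i x \<le> \<mu>" using ij x(1) by (auto simp: stop_def)
        moreover have "av i x = av i y" using key_coarsen[OF ij zx] zy by (intro av_cong) simp
        ultimately show False using y(1) by (simp add: stop_def)
      qed
      with zx zy x y show ?thesis by simp
    qed
    show "disjoint_family_on (\<lambda>(j, q). cell j q) I"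
      unfolding disjoint_family_on_def
    proof (intro ballI impI, rule ccontr)
      fix u v assume uv: "u \<in> I" "v \<in> I" "u \<noteq> v" and "(case u of (j, q) \<Rightarrow> cell j q) \<inter> (case v of (j, q) \<Rightarrow> cell j q) \<noteq> {}"
      then obtain z where "z \<in> cell (fst u) (snd u)" "z \<in> cell (fst v) (snd v)" by (auto simp: split_beta)
      then show False
        using uv dis[of "fst u" "snd u" "fst v" "snd v" z] dis[of "fst v" "snd v" "fst u" "snd u" z]
        by (cases "fst v \<le> fst u") auto
    qed
  next
    fix j q assume "(j, q) \<in> I"
    then obtain x where x: "x \<in> fund" "stop j x" "q = key j x" using IE by blast
    show "cell j q \<subseteq> fund" using x cell_subset_fund by blast
    show "\<mu> * measure torus (cell j q) \<le> (\<integral>x. indicator (cell j q) x * norm (f x) \<partial>torus)"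
      unfolding x(3) cint[OF x(1)] using x(2) by (intro mult_right_mono) (auto simp: stop_def)
    \<comment> \<open>The assumption on the norm of f says that generation 0 does not stop, so a
      selected cell has a parent.\<close>
    have "j \<noteq> 0"
    proof
      assume "j = 0"
      then show False using x(2) av0[OF x(1)] by (simp add: stop_def)
    qed
    then obtain i where i: "j = Suc i" by (cases j) auto
    \<comment> \<open>Enlarge to the parent: its mean is still at most \<open>\<mu>\<close> and its
      measure is \<open>2 ^ ?n\<close> times that of the cell.\<close>
    have "(\<integral>x. indicator (cell j q) x * norm (f x) \<partial>torus) \<le> (\<integral>y. indicator (cell i (key i x)) y * norm (f y) \<partial>torus)"
    proof (intro integral_mono int)
      have "cell j q \<subseteq> cell i (key i x)"
      proof
        fix y assume "y \<in> cell j q"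
        then have "key j y = key j x" using x(3) by (simp add: cell_def)
        then have "key i y = key i x" by (rule key_coarsen[rotated]) (simp add: i)
        then show "y \<in> cell i (key i x)" by (simp add: cell_def)
      qed
      then show "indicator (cell j q) y * norm (f y) \<le> indicator (cell i (key i x)) y * norm (f y)" for y
        by (auto simp: indicator_def)
    qed auto
    also have "\<dots> = av i x * measure torus (cell i (key i x))" by (rule cint[OF x(1)])
    also have "\<dots> \<le> \<mu> * measure torus (cell i (key i x))"
      using x(2) i by (intro mult_right_mono) (auto simp: stop_def)
    also have "measure torus (cell i (key i x)) = 2 ^ ?n * measure torus (cell j (key j x))"
      unfolding measure_torus_cell[OF cell_subset_fund[OF x(1)]] i
      by (simp add: power_one_over power_mult_distrib power_divide)
    finally show "(\<integral>x. indicator (cell j q) x * norm (f x) \<partial>torus) \<le> 2 ^ ?n * \<mu> * measure torus (cell j q)"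
      unfolding x(3) by (simp add: mult_ac)
  next
    fix x assume x: "x \<in> fund" and "x \<notin> (\<Union>(j, q)\<in>I. cell j q)"
    then have out: "\<And>j q. (j, q) \<in> I \<Longrightarrow> x \<notin> cell j q" by auto
    have nostop: "\<not> stop j x" if "j \<le> J" for j
    proof
      assume "stop j x"
      then have "(j, key j x) \<in> I" using x that by (auto simp: I_def)
      then show False using out by (auto simp: cell_def)
    qed
    have "av j x \<le> \<mu>" if "j \<le> J" for j
      using that
    proof (induction j rule: less_induct)
      case (less j)
      then have "\<forall>i<j. av i x \<le> \<mu>" by auto
      then show ?case using nostop[OF less.prems] by (auto simp: stop_def)
    qed
    then have avJ: "av J x \<le> \<mu>" by simp
    let ?Q = "cell J (key J x)"
    have sub: "?Q \<subseteq> fund" using cell_subset_fund[OF x] .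
    \<comment> \<open>On this cell f varies by less than \<open>\<mu>\<close>, so a mean of at most
      \<open>\<mu>\<close> leaves a value of at most \<open>2 * \<mu>\<close> at x itself.\<close>
    have lb: "norm (f x) - \<mu> \<le> norm (f y)" if y: "y \<in> ?Q" for y
    proof -
      have "dist y x \<le> (\<Sum>i\<in>UNIV. \<bar>(y - x) $ i\<bar>)" unfolding dist_norm by (rule norm_le_l1_cart)
      also have "\<dots> \<le> (\<Sum>i\<in>(UNIV :: 'n set). 2 * (1 / 2) ^ J)"
      proof (rule sum_mono)
        fix i
        have "\<bar>y $ i - of_int (key J x $ i) / 2 ^ J\<bar> \<le> 1 / 2 ^ J" "\<bar>x $ i - of_int (key J x $ i) / 2 ^ J\<bar> \<le> 1 / 2 ^ J"
          using y by (auto intro!: cell_corner simp: cell_def)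
        then have "\<bar>y $ i - x $ i\<bar> \<le> 2 * (1 / 2 ^ J)" by linarith
        then show "\<bar>(y - x) $ i\<bar> \<le> 2 * (1 / 2) ^ J" by (simp add: power_one_over)
      qed
      also have "\<dots> = 2 * ?n * (1 / 2) ^ J" by simp
      also have "\<dots> < \<delta>" using J by (simp add: field_simps)
      finally have "dist y x < \<delta>" .
      moreover have "x \<in> cbox 0 1" "y \<in> cbox 0 1" using x y sub fund_subset_cbox by auto
      ultimately have "dist (f y) (f x) < \<mu>" by (intro \<delta>(2))
      then show ?thesis using norm_triangle_ineq3[of "f y" "f x"] by (simp add: dist_norm)
    qed
    have "(norm (f x) - \<mu>) * measure torus ?Q = (\<integral>y. indicator ?Q y * (norm (f x) - \<mu>) \<partial>torus)" by simp
    also have "\<dots> \<le> (\<integral>y. indicator ?Q y * norm (f y) \<partial>torus)"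
    proof (rule integral_mono)
      show "integrable torus (\<lambda>y. indicator ?Q y * (norm (f x) - \<mu>))"
        by (rule integrable_torus_bounded[where B = "\<bar>norm (f x) - \<mu>\<bar>"]) (auto simp: indicator_def)
      show "integrable torus (\<lambda>y. indicator ?Q y * norm (f y))" by (rule int) simp
      show "indicator ?Q y * (norm (f x) - \<mu>) \<le> indicator ?Q y * norm (f y)" for y
        using lb[of y] by (cases "y \<in> ?Q") auto
    qed
    also have "\<dots> = av J x * measure torus ?Q" by (rule cint[OF x])
    also have "\<dots> \<le> \<mu> * measure torus ?Q" using avJ by (intro mult_right_mono) auto
    finally have *: "(norm (f x) - \<mu>) * measure torus ?Q \<le> \<mu> * measure torus ?Q" .
    have "0 < measure torus ?Q" unfolding measure_torus_cell[OF sub] by simp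
    with * have "norm (f x) - \<mu> \<le> \<mu>" by (rule mult_right_le_imp_le)
    then show "norm (f x) \<le> 2 * \<mu>" by simp
  qed
qed

section \<open>The weak type (1,1) bound\<close>

text \<open>Formulated for bounded measurable f, because the good and bad parts are discontinuous.
  Only the values on \<open>fund\<close> enter, so the bad parts, each supported in a single cell,
  are used without periodic extension.\<close>

definition tmul :: "(int ^ 'n \<Rightarrow> complex) \<Rightarrow> (real ^ 'n \<Rightarrow> complex) \<Rightarrow> real ^ 'n \<Rightarrow> complex" where
  "tmul a f x = (\<Sum>\<xi> | a \<xi> \<noteq> 0. (a \<xi> * fc f \<xi>) * chr \<xi> x)"

lemma borel_measurable_tmul [measurable]: "tmul a f \<in> borel_measurable borel"
  unfolding tmul_def by measurable

lemma integrable_cnj_chr_mult: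
  assumes [measurable]: "f \<in> borel_measurable borel" and "\<And>x. norm (f x) \<le> B"
  shows "integrable torus (\<lambda>x. cnj (chr \<xi> x) * f x)"
  by (rule integrable_torus_bounded[where B = B]) (use assms in \<open>auto simp: norm_mult\<close>)

lemma tmul_kernel:
  fixes f :: "real ^ 'n \<Rightarrow> complex"
  assumes f: "f \<in> borel_measurable borel" "\<And>x. norm (f x) \<le> B"
  shows "tmul a f x = (\<integral>y. tp a (x - y) * f y \<partial>torus)"
proof -
  have "(\<integral>y. tp a (x - y) * f y \<partial>torus)
      = (\<integral>y. (\<Sum>\<xi> | a \<xi> \<noteq> 0. (a \<xi> * chr \<xi> x) * (cnj (chr \<xi> y) * f y)) \<partial>torus)"
    by (simp add: tp_def chr_diff_right sum_distrib_right mult.assoc)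
  also have "\<dots> = (\<Sum>\<xi> | a \<xi> \<noteq> 0. (a \<xi> * chr \<xi> x) * fc f \<xi>)"
    unfolding fc_def using integrable_cnj_chr_mult[OF f] by simp
  finally show ?thesis by (simp add: tmul_def mult_ac)
qed

lemma fc_add_sum:
  fixes g :: "real ^ 'n \<Rightarrow> complex"
  assumes g: "g \<in> borel_measurable borel" "\<And>x. norm (g x) \<le> B"
    and b: "\<And>p. p \<in> I \<Longrightarrow> b p \<in> borel_measurable borel" "\<And>p x. p \<in> I \<Longrightarrow> norm (b p x) \<le> B"
  shows "fc (\<lambda>x. g x + (\<Sum>p\<in>I. b p x)) \<xi> = fc g \<xi> + (\<Sum>p\<in>I. fc (b p) \<xi>)"
proof -
  have "fc (\<lambda>x. g x + (\<Sum>p\<in>I. b p x)) \<xi>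
      = (\<integral>x. cnj (chr \<xi> x) * g x + (\<Sum>p\<in>I. cnj (chr \<xi> x) * b p x) \<partial>torus)"
    by (simp add: fc_def distrib_left sum_distrib_left)
  also have "\<dots> = fc g \<xi> + (\<Sum>p\<in>I. fc (b p) \<xi>)"
    unfolding fc_def using integrable_cnj_chr_mult[OF g] integrable_cnj_chr_mult[OF b]
    by (subst Bochner_Integration.integral_add) (auto simp: integral_sum intro!: Bochner_Integration.integrable_sum)
  finally show ?thesis .
qed

lemma tmul_add_sum:
  fixes g :: "real ^ 'n \<Rightarrow> complex"
  assumes g: "g \<in> borel_measurable borel" "\<And>x. norm (g x) \<le> B"
    and b: "\<And>p. p \<in> I \<Longrightarrow> b p \<in> borel_measurable borel" "\<And>p x. p \<in> I \<Longrightarrow> norm (b p x) \<le> B"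
  shows "tmul a (\<lambda>x. g x + (\<Sum>p\<in>I. b p x)) x = tmul a g x + (\<Sum>p\<in>I. tmul a (b p) x)"
proof -
  have fcs: "fc (\<lambda>x. g x + (\<Sum>p\<in>I. b p x)) \<xi> = fc g \<xi> + (\<Sum>p\<in>I. fc (b p) \<xi>)" for \<xi>
    by (rule fc_add_sum[OF g b])
  have "tmul a (\<lambda>x. g x + (\<Sum>p\<in>I. b p x)) x
     = (\<Sum>\<xi> | a \<xi> \<noteq> 0. a \<xi> * fc g \<xi> * chr \<xi> x + (\<Sum>p\<in>I. a \<xi> * fc (b p) \<xi> * chr \<xi> x))"
    unfolding tmul_def fcs
    by (simp add: distrib_left distrib_right sum_distrib_left sum_distrib_right mult.assoc)
  also have "\<dots> = tmul a g x + (\<Sum>p\<in>I. tmul a (b p) x)"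
    unfolding tmul_def sum.distrib by (subst sum.swap) (rule refl)
  finally show ?thesis .
qed

lemma integrable_norm_tmul_sq: "integrable torus (\<lambda>x. (norm (tmul a f x))\<^sup>2)"
proof (rule integrable_torus_bounded)
  fix x
  have "norm (tmul a f x) \<le> (\<Sum>\<xi> | a \<xi> \<noteq> 0. norm (a \<xi> * fc f \<xi>))"
    unfolding tmul_def by (rule order.trans[OF norm_sum]) (simp add: norm_mult)
  then show "norm ((norm (tmul a f x))\<^sup>2) \<le> (\<Sum>\<xi> | a \<xi> \<noteq> 0. norm (a \<xi> * fc f \<xi>))\<^sup>2"
    by (simp add: power_mono)
qed measurable

text \<open>Parseval for the finite sum on the left, Bessel for f on the right.\<close>

lemma tmul_L2:
  fixes f :: "real ^ 'n \<Rightarrow> complex"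
  assumes f: "f \<in> borel_measurable borel" "\<And>x. norm (f x) \<le> M"
    and fin: "finite (supp a)" and a: "\<And>\<xi>. norm (a \<xi>) \<le> B"
  shows "(\<integral>x. (norm (tmul a f x))\<^sup>2 \<partial>torus) \<le> B\<^sup>2 * (\<integral>x. (norm (f x))\<^sup>2 \<partial>torus)"
proof -
  have "(\<integral>x. (norm (tmul a f x))\<^sup>2 \<partial>torus) = (\<Sum>\<xi> | a \<xi> \<noteq> 0. (norm (a \<xi> * fc f \<xi>))\<^sup>2)"
    unfolding tmul_def by (rule tp_parseval_sum[OF fin])
  also have "\<dots> \<le> (\<Sum>\<xi> | a \<xi> \<noteq> 0. B\<^sup>2 * (norm (fc f \<xi>))\<^sup>2)"
    unfolding norm_mult power_mult_distrib using a
    by (intro sum_mono mult_right_mono power_mono) auto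
  also have "\<dots> = B\<^sup>2 * (\<Sum>\<xi> | a \<xi> \<noteq> 0. (norm (fc f \<xi>))\<^sup>2)" by (simp add: sum_distrib_left)
  also have "\<dots> \<le> B\<^sup>2 * (\<integral>x. (norm (f x))\<^sup>2 \<partial>torus)"
    by (intro mult_left_mono fc_bessel[OF f fin]) auto
  finally show ?thesis .
qed

text \<open>As h has mean 0, \<open>tp a (x - c)\<close> may be subtracted from the kernel. After
  exchanging the integrals there remains, for each y with \<open>h y \<noteq> 0\<close>, an integral
  over x that a translation by c brings into the form of \<open>hormander\<close> with shift
  \<open>y - c\<close>.\<close>

lemma tmul_off_support:
  fixes h :: "real ^ 'n \<Rightarrow> complex"
  assumes H: "hormander a H" and hm [measurable]: "h \<in> borel_measurable borel" and hb: "\<And>x. norm (h x) \<le> B"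
    and mean0: "(\<integral>x. h x \<partial>torus) = 0" and r: "0 < r"
    and supp: "\<And>y i. h y \<noteq> 0 \<Longrightarrow> \<bar>y $ i - c $ i\<bar> \<le> r"
  shows "(\<integral>\<^sup>+x. indicator (- nbhd (2 * r)) (x - c) * ennreal (norm (tmul a h x)) \<partial>torus)
    \<le> ennreal (H * (\<integral>x. norm (h x) \<partial>torus))" (is "?I \<le> _")
proof -
  define D where "D x y = tp a (x - y) - tp a (x - c)" for x y
  let ?G = "\<lambda>x y. indicator (- nbhd (2 * r)) (x - c) * (ennreal (norm (D x y)) * ennreal (norm (h y)))"
  have [measurable]: "case_prod D \<in> borel_measurable (borel \<Otimes>\<^sub>M borel)"
    unfolding D_def split_beta by measurable
  have inth: "integrable torus h" by (rule integrable_torus_bounded[OF hm hb])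
  have intK: "integrable torus (\<lambda>y. tp a (x - y) * h y)" for x
  proof (rule integrable_torus_bounded[where B = "(\<Sum>\<xi> | a \<xi> \<noteq> 0. norm (a \<xi>)) * B"])
    show "norm (tp a (x - y) * h y) \<le> (\<Sum>\<xi> | a \<xi> \<noteq> 0. norm (a \<xi>)) * B" for y
      unfolding norm_mult by (intro mult_mono norm_tp_le hb sum_nonneg) auto
  qed measurable
  have eq: "tmul a h x = (\<integral>y. D x y * h y \<partial>torus)" for x
  proof -
    have "(\<integral>y. D x y * h y \<partial>torus) = (\<integral>y. tp a (x - y) * h y - tp a (x - c) * h y \<partial>torus)"
      by (simp add: D_def left_diff_distrib)
    also have "\<dots> = (\<integral>y. tp a (x - y) * h y \<partial>torus) - tp a (x - c) * (\<integral>y. h y \<partial>torus)"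
      using intK inth by simp
    finally show ?thesis using mean0 tmul_kernel[OF hm hb] by simp
  qed
  have intD: "integrable torus (\<lambda>y. D x y * h y)" for x
    unfolding D_def left_diff_distrib using intK inth by (intro Bochner_Integration.integrable_diff) auto
  have nrm: "ennreal (norm (tmul a h x)) \<le> (\<integral>\<^sup>+y. ennreal (norm (D x y)) * ennreal (norm (h y)) \<partial>torus)" for x
  proof -
    have "ennreal (norm (\<integral>y. D x y * h y \<partial>torus)) \<le> (\<integral>\<^sup>+y. ennreal (norm (D x y * h y)) \<partial>torus)"
      by (rule integral_norm_bound_ennreal[OF intD])
    then show ?thesis by (simp add: eq norm_mult ennreal_mult)
  qed
  interpret P: pair_sigma_finite "torus :: (real ^ 'n) measure" "torus :: (real ^ 'n) measure" ..
  have sp [simp]: "sets (torus \<Otimes>\<^sub>M torus) = sets (borel \<Otimes>\<^sub>M (borel :: (real ^ 'n) measure) :: ((real ^ 'n) \<times> (real ^ 'n)) measure)"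
    by (rule sets_pair_measure_cong) auto
  have "?I
     \<le> (\<integral>\<^sup>+x. indicator (- nbhd (2 * r)) (x - c) * (\<integral>\<^sup>+y. ennreal (norm (D x y)) * ennreal (norm (h y)) \<partial>torus) \<partial>torus)"
    by (intro nn_integral_mono mult_left_mono nrm) auto
  also have "\<dots> = (\<integral>\<^sup>+x. (\<integral>\<^sup>+y. ?G x y \<partial>torus) \<partial>torus)"
    by (intro nn_integral_cong nn_integral_cmult[symmetric]) (simp add: D_def)
  also have "\<dots> = (\<integral>\<^sup>+y. (\<integral>\<^sup>+x. ?G x y \<partial>torus) \<partial>torus)"
    by (rule P.Fubini'[symmetric]) (unfold D_def split_beta, measurable)
  also have "\<dots> \<le> (\<integral>\<^sup>+y. ennreal H * ennreal (norm (h y)) \<partial>torus)"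
  proof (rule nn_integral_mono)
    fix y
    show "(\<integral>\<^sup>+x. ?G x y \<partial>torus)
        \<le> ennreal H * ennreal (norm (h y))"
    proof (cases "h y = 0")
      case False
      let ?F = "\<lambda>x. indicator (- nbhd (2 * r)) x * ennreal (norm (tp a (x - (y - c)) - tp a x))"
      have per: "lperiodic ?F"
      proof (intro lperiodic_mult lperiodic_indicator_nbhd)
        show "lperiodic (\<lambda>x. ennreal (norm (tp a (x - (y - c)) - tp a x)))"
          unfolding lperiodic_def
        proof (intro allI)
          fix x m
          have "x + lattice_vec m - (y - c) = (x - (y - c)) + lattice_vec m" by simp
          then show "ennreal (norm (tp a (x + lattice_vec m - (y - c)) - tp a (x + lattice_vec m)))
              = ennreal (norm (tp a (x - (y - c)) - tp a x))"
            by (simp only: lperiodicD[OF lperiodic_tp])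
        qed
      qed
      have "(\<integral>\<^sup>+x. ?G x y \<partial>torus)
         = (\<integral>\<^sup>+x. ?F (x + - c) * ennreal (norm (h y)) \<partial>torus)"
        by (simp add: D_def mult.assoc)
      also have "\<dots> = (\<integral>\<^sup>+x. ?F (x + - c) \<partial>torus) * ennreal (norm (h y))"
        by (rule nn_integral_multc) measurable
      also have "(\<integral>\<^sup>+x. ?F (x + - c) \<partial>torus) = (\<integral>\<^sup>+x. ?F x \<partial>torus)"
        by (rule nn_integral_torus_translation[OF _ per]) measurable
      also have "\<dots> * ennreal (norm (h y)) \<le> ennreal H * ennreal (norm (h y))"
        using H r supp[OF False] unfolding hormander_def by (intro mult_right_mono) auto
      finally show ?thesis .
    qed simp
  qed
  also have "\<dots> = ennreal H * ennreal (\<integral>y. norm (h y) \<partial>torus)"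
    using inth by (simp add: nn_integral_cmult nn_integral_eq_integral)
  finally show ?thesis using H by (simp add: hormander_def ennreal_mult)
qed

lemma emeasure_nbhd_translate:
  assumes "0 \<le> \<rho>"
  shows "emeasure torus {x :: real ^ 'n. x - c \<in> nbhd \<rho>} \<le> ennreal ((2 * \<rho>) ^ CARD('n))"
proof -
  have "emeasure torus {x :: real ^ 'n. x - c \<in> nbhd \<rho>} = (\<integral>\<^sup>+(x :: real ^ 'n). indicator {x. x - c \<in> nbhd \<rho>} x \<partial>torus)"
    by (rule nn_integral_indicator[symmetric]) simp
  also have "\<dots> = (\<integral>\<^sup>+(x :: real ^ 'n). indicator (nbhd \<rho>) (x + - c) \<partial>torus)"
    by (intro nn_integral_cong) (simp add: indicator_def)
  also have "\<dots> = (\<integral>\<^sup>+(x :: real ^ 'n). indicator (nbhd \<rho>) x \<partial>torus)"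
    by (rule nn_integral_torus_translation) (auto intro: lperiodic_indicator_nbhd)
  also have "\<dots> = emeasure torus (nbhd \<rho> :: (real ^ 'n) set)" by simp
  also have "\<dots> \<le> ennreal ((2 * \<rho>) ^ CARD('n))" by (rule emeasure_nbhd[OF assms])
  finally show ?thesis .
qed

text \<open>In this order: Markov's inequality for the good part at level \<open>\<mu> / 2\<close>,
  with 12 = 4 * 3; the cells enlarged to side 4 times their own; Hoermander's bound for the bad
  part, with a factor 2 from the level \<open>\<mu> / 2\<close> and another from the norm of the bad
  pieces.\<close>

definition weak_const :: "nat \<Rightarrow> real \<Rightarrow> real \<Rightarrow> real" where
  "weak_const n B H = 12 * 2 ^ n * B\<^sup>2 + 4 ^ n + 4 * H"

text \<open>If the norm of f exceeds \<open>\<mu>\<close>, the total mass 1 suffices, as the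
  constant is at least 1. Otherwise f splits into a part g, at most
  \<open>2 ^ CARD('n) * \<mu>\<close> on \<open>fund\<close> and treated in L2, and pieces of mean 0
  on the selected cells, treated off the enlarged cells, which themselves have small
  measure.\<close>

theorem weak_type:
  fixes f :: "real ^ 'n \<Rightarrow> complex"
  assumes cont: "continuous_on UNIV f" and per: "lperiodic f" and mu: "0 < \<mu>"
    and fin: "finite (supp a)" and a: "\<And>\<xi>. norm (a \<xi>) \<le> B" and H: "hormander a H"
  shows "\<mu> * measure torus {x. \<mu> < norm (tmul a f x)} \<le> weak_const CARD('n) B H * (\<integral>x. norm (f x) \<partial>torus)" (is "\<mu> * ?m \<le> _")
proof (cases "(\<integral>x. norm (f x) \<partial>torus) \<le> \<mu>")
  case False
  let ?N = "\<integral>x. norm (f x) \<partial>torus"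
  have H0: "0 \<le> H" using H by (simp add: hormander_def)
  have "?m \<le> 1"
    using torus.bounded_measure[of "{x. \<mu> < norm (tmul a f x)}"] by simp
  then have "\<mu> * ?m \<le> 1 * ?N"
    using False mu by (metis less_imp_le mult.commute mult_left_le mult_1 not_le order_trans)
  also have "\<dots> \<le> weak_const CARD('n) B H * ?N"
  proof (rule mult_right_mono)
    have "(1::real) \<le> 4 ^ CARD('n)" by simp
    moreover have "0 \<le> 12 * 2 ^ CARD('n) * B\<^sup>2" by simp
    ultimately show "1 \<le> weak_const CARD('n) B H" using H0 unfolding weak_const_def by linarith
  qed simp
  finally show ?thesis .
next
  case True
  let ?n = "CARD('n)"
  define N where "N = (\<integral>x. norm (f x) \<partial>torus)"
  have H0: "0 \<le> H" using H by (simp add: hormander_def)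
  have fm [measurable]: "f \<in> borel_measurable borel" using cont by (rule borel_measurable_continuous_onI)
  obtain M where M: "0 < M" "\<And>x. norm (f x) \<le> M" using lperiodic_bounded[OF cont per] by metis
  have N0: "0 \<le> N" by (simp add: N_def)
  obtain I where finI: "finite I" and disj: "disjoint_family_on (\<lambda>(j, q). cell j q) I"
    and sub: "\<And>j q. (j, q) \<in> I \<Longrightarrow> cell j q \<subseteq> (fund :: (real ^ 'n) set)"
    and lo: "\<And>j q. (j, q) \<in> I \<Longrightarrow> \<mu> * measure torus (cell j q) \<le> (\<integral>x. indicator (cell j q) x * norm (f x) \<partial>torus)"
    and hi: "\<And>j q. (j, q) \<in> I \<Longrightarrow> (\<integral>x. indicator (cell j q) x * norm (f x) \<partial>torus) \<le> 2 ^ ?n * \<mu> * measure torus (cell j q)"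
    and off: "\<And>x. x \<in> fund \<Longrightarrow> x \<notin> (\<Union>(j, q)\<in>I. cell j q) \<Longrightarrow> norm (f x) \<le> 2 * \<mu>"
    by (rule calderon_zygmund_cells[OF cont per mu True]) (rule that)
  define Q where "Q p = cell (fst p) (snd p)" for p :: "nat \<times> (int ^ 'n)"
  define r where "r p = (1 / 2 ^ fst p :: real)" for p :: "nat \<times> (int ^ 'n)"
  define c where "c p = (\<chi> i. of_int (snd p $ i) / 2 ^ fst p :: real ^ 'n)" for p :: "nat \<times> (int ^ 'n)"
  define fQ where "fQ p = (\<integral>x. indicator (Q p) x * norm (f x) \<partial>torus)" for p
  have Qm [measurable]: "Q p \<in> sets borel" for p by (simp add: Q_def)
  have r: "0 < r p" for p by (simp add: r_def)
  have mQ: "measure torus (Q p) = r p ^ ?n" if "p \<in> I" for p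
    using measure_torus_cell[OF sub[of "fst p" "snd p"]] that by (simp add: Q_def r_def)
  have mQ0: "0 < measure torus (Q p)" if "p \<in> I" for p using mQ[OF that] r[of p] by simp
  have lo': "\<mu> * measure torus (Q p) \<le> fQ p" and hi': "fQ p \<le> 2 ^ ?n * \<mu> * measure torus (Q p)" if "p \<in> I" for p
    using lo[of "fst p" "snd p"] hi[of "fst p" "snd p"] that by (simp_all add: Q_def fQ_def)
  have uniq: "p = p'" if "p \<in> I" "p' \<in> I" "x \<in> Q p" "x \<in> Q p'" for p p' x
    using disj that unfolding disjoint_family_on_def Q_def by (fastforce simp: split_beta)
  have intQ: "integrable torus (\<lambda>x. indicator (Q p) x * norm (f x))" for p
    by (rule integrable_torus_bounded[where B = M]) (use M in \<open>auto simp: indicator_def less_imp_le\<close>)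
  have intN: "integrable torus (\<lambda>x. norm (f x))"
    by (rule integrable_torus_bounded[where B = M]) (use M in auto)
  have sumfQ: "(\<Sum>p\<in>I. fQ p) \<le> N"
  proof -
    have "(\<Sum>p\<in>I. fQ p) = (\<integral>x. (\<Sum>p\<in>I. indicator (Q p) x * norm (f x)) \<partial>torus)"
      unfolding fQ_def using intQ by simp
    also have "\<dots> \<le> N" unfolding N_def
    proof (rule integral_mono)
      fix x
      have "(\<Sum>p\<in>I. indicator (Q p) x) \<le> (1::real)"
      proof (cases "\<exists>p\<in>I. x \<in> Q p")
        case True
        then obtain p where p: "p \<in> I" "x \<in> Q p" by blast
        have "(\<Sum>p\<in>I. indicator (Q p) x) = (\<Sum>p'\<in>{p}. indicator (Q p') x :: real)"
        proof (intro sum.mono_neutral_right ballI)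
          fix p' assume "p' \<in> I - {p}"
          then have "x \<notin> Q p'" using uniq[of p' p x] p by auto
          then show "indicator (Q p') x = (0::real)" by simp
        qed (use p finI in auto)
        also have "\<dots> \<le> 1" by (simp only: sum.insert finite.emptyI empty_iff not_False_eq_True sum.empty) (simp add: indicator_def)
        finally show ?thesis .
      qed (simp add: indicator_def)
      then have "(\<Sum>p\<in>I. indicator (Q p) x) * norm (f x) \<le> 1 * norm (f x)" by (intro mult_right_mono) auto
      then show "(\<Sum>p\<in>I. indicator (Q p) x * norm (f x)) \<le> norm (f x)" by (simp add: sum_distrib_right)
    qed (use intQ intN in auto)
    finally show ?thesis .
  qed
  have sumQ: "\<mu> * (\<Sum>p\<in>I. measure torus (Q p)) \<le> N"
    using sum_mono[of I "\<lambda>p. \<mu> * measure torus (Q p)" fQ] lo' sumfQ by (simp add: sum_distrib_left)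
  define m where "m p = (\<integral>x. indicator (Q p) x * f x \<partial>torus) / of_real (measure torus (Q p))" for p
  have intQf: "integrable torus (\<lambda>x. indicator (Q p) x * f x)" for p
    by (rule integrable_torus_bounded[where B = M]) (use M in \<open>auto simp: indicator_def less_imp_le\<close>)
  have nm: "norm (m p) * measure torus (Q p) \<le> fQ p" if "p \<in> I" for p
  proof -
    have "norm (\<integral>x. indicator (Q p) x * f x \<partial>torus) \<le> (\<integral>x. norm (indicator (Q p) x * f x) \<partial>torus)"
      by (rule integral_norm_bound)
    also have "\<dots> = fQ p"
      unfolding fQ_def by (intro Bochner_Integration.integral_cong refl) (auto simp: indicator_def)
    finally show ?thesis using mQ0[OF that] by (simp add: m_def norm_divide)
  qed
  have mhi: "norm (m p) \<le> 2 ^ ?n * \<mu>" if "p \<in> I" for p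
  proof -
    have "norm (m p) * measure torus (Q p) \<le> 2 ^ ?n * \<mu> * measure torus (Q p)"
      using nm[OF that] hi'[OF that] by linarith
    then show ?thesis using mQ0[OF that] by (rule mult_right_le_imp_le)
  qed
  \<comment> \<open>The mean over the cell is removed, so that \<open>tmul_off_support\<close>
    applies with centre \<open>c p\<close> and radius \<open>r p\<close>.\<close>
  define b where "b p x = indicator (Q p) x * (f x - m p)" for p x
  have bm [measurable]: "b p \<in> borel_measurable borel" for p unfolding b_def by measurable
  define MB where "MB = M + 2 ^ ?n * \<mu>"
  have MB: "0 \<le> MB" using M mu by (simp add: MB_def)
  have bb: "norm (b p x) \<le> MB" if "p \<in> I" for p x
    using norm_triangle_ineq4[of "f x" "m p"] M(2)[of x] mhi[OF that] MB
    by (cases "x \<in> Q p") (auto simp: b_def MB_def norm_mult)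
  have intb: "integrable torus (b p)" if "p \<in> I" for p
    by (rule integrable_torus_bounded[OF bm bb[OF that]])
  have b0: "(\<integral>x. b p x \<partial>torus) = 0" if "p \<in> I" for p
  proof -
    have i1: "integrable torus (\<lambda>x. indicator (Q p) x * m p)"
      by (rule integrable_torus_bounded[where B = "norm (m p)"]) (auto simp: indicator_def)
    have "(\<integral>x. indicator (Q p) x * m p \<partial>torus) = (\<integral>x. indicator (Q p) x *\<^sub>R m p \<partial>torus)"
      by (intro Bochner_Integration.integral_cong) (auto simp: indicator_def)
    also have "\<dots> = (\<integral>x. indicator (Q p) x \<partial>torus) *\<^sub>R m p"
      by (rule integral_scaleR_left, rule integrable_torus_bounded[where B = 1]) (auto simp: indicator_def)
    also have "(\<integral>x. indicator (Q p) x \<partial>torus) = measure torus (Q p)" by simp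
    finally have "(\<integral>x. b p x \<partial>torus) = (\<integral>x. indicator (Q p) x * f x \<partial>torus) - measure torus (Q p) *\<^sub>R m p"
      unfolding b_def right_diff_distrib using intQf i1 by simp
    then show ?thesis using mQ0[OF that] by (simp add: m_def scaleR_conv_of_real)
  qed
  have b1: "(\<integral>x. norm (b p x) \<partial>torus) \<le> 2 * fQ p" if "p \<in> I" for p
  proof -
    have "(\<integral>x. norm (b p x) \<partial>torus) \<le> (\<integral>x. indicator (Q p) x * norm (f x) + norm (m p) * indicator (Q p) x \<partial>torus)"
    proof (rule integral_mono)
      show "integrable torus (\<lambda>x. norm (b p x))" using intb[OF that] by simp
      show "integrable torus (\<lambda>x. indicator (Q p) x * norm (f x) + norm (m p) * indicator (Q p) x)"
        using intQ by (intro Bochner_Integration.integrable_add integrable_torus_bounded[where B = "norm (m p)" and F = "\<lambda>x. norm (m p) * indicator (Q p) x"])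
          (auto simp: indicator_def)
      show "norm (b p x) \<le> indicator (Q p) x * norm (f x) + norm (m p) * indicator (Q p) x" for x
        using norm_triangle_ineq4[of "f x" "m p"] by (cases "x \<in> Q p") (auto simp: b_def)
    qed
    also have "\<dots> = fQ p + norm (m p) * measure torus (Q p)"
    proof -
      have "integrable torus (\<lambda>x. norm (m p) * indicator (Q p) x :: real)"
        by (rule integrable_torus_bounded[where B = "norm (m p)"]) (auto simp: indicator_def)
      then show ?thesis using intQ by (subst Bochner_Integration.integral_add) (auto simp: fQ_def)
    qed
    also have "\<dots> \<le> 2 * fQ p" using nm[OF that] by simp
    finally show ?thesis .
  qed
  define g where "g x = f x - (\<Sum>p\<in>I. b p x)" for x
  have gm [measurable]: "g \<in> borel_measurable borel" unfolding g_def by measurable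
  have bsum: "(\<Sum>p\<in>I. b p x) = (if x \<in> Q p then b p x else (\<Sum>p\<in>I. b p x))" if "p \<in> I" for p x
  proof (cases "x \<in> Q p")
    case True
    have "(\<Sum>p'\<in>I. b p' x) = (\<Sum>p'\<in>{p}. b p' x)"
    proof (intro sum.mono_neutral_right ballI)
      fix p' assume "p' \<in> I - {p}"
      then have "x \<notin> Q p'" using uniq[of p' p x] that True by auto
      then show "b p' x = 0" by (simp add: b_def)
    qed (use that finI in auto)
    then show ?thesis using True by simp
  qed simp
  have gQ: "g x = m p" if "p \<in> I" "x \<in> Q p" for p x
    using bsum[OF that(1), of x] that by (simp add: g_def b_def)
  have gO: "g x = f x" if "\<And>p. p \<in> I \<Longrightarrow> x \<notin> Q p" for x
    using that by (simp add: g_def b_def)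
  have gb: "norm (g x) \<le> MB" for x
  proof (cases "\<exists>p\<in>I. x \<in> Q p")
    case True
    then obtain p where "p \<in> I" "x \<in> Q p" by blast
    then show ?thesis using gQ[of p x] mhi[of p] M by (simp add: MB_def)
  next
    case False
    then have "g x = f x" by (intro gO) auto
    moreover have "0 \<le> 2 ^ ?n * \<mu>" using mu by simp
    ultimately show ?thesis using M(2)[of x] unfolding MB_def by simp
  qed
  \<comment> \<open>Outside \<open>fund\<close> the function g is simply f. The bound is therefore
    stated on \<open>fund\<close> and enters the integral of the square almost everywhere.\<close>
  have gfund: "norm (g x) \<le> 2 ^ ?n * \<mu>" if "x \<in> fund" for x
  proof (cases "\<exists>p\<in>I. x \<in> Q p")
    case True
    then obtain p where "p \<in> I" "x \<in> Q p" by blast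
    then show ?thesis using gQ[of p x] mhi[of p] by simp
  next
    case False
    then have "g x = f x" by (intro gO) auto
    moreover have "norm (f x) \<le> 2 * \<mu>" using False by (intro off[OF that]) (auto simp: Q_def)
    moreover have "(2::real) \<le> 2 ^ ?n" using power_increasing[of 1 ?n "2::real"] by (simp add: Suc_leI)
    then have "2 * \<mu> \<le> 2 ^ ?n * \<mu>" using mu by (intro mult_right_mono) auto
    ultimately show ?thesis by simp
  qed
  have intg: "integrable torus (\<lambda>x. norm (g x))"
    by (rule integrable_torus_bounded[where B = MB]) (use gb in auto)
  have g1: "(\<integral>x. norm (g x) \<partial>torus) \<le> 3 * N"
  proof -
    have intbn: "integrable torus (\<lambda>x. \<Sum>p\<in>I. norm (b p x))" using intb by (intro Bochner_Integration.integrable_sum) auto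
    have "(\<integral>x. norm (g x) \<partial>torus) \<le> (\<integral>x. norm (f x) + (\<Sum>p\<in>I. norm (b p x)) \<partial>torus)"
    proof (rule integral_mono[OF intg])
      show "integrable torus (\<lambda>x. norm (f x) + (\<Sum>p\<in>I. norm (b p x)))" using intN intbn by simp
      show "norm (g x) \<le> norm (f x) + (\<Sum>p\<in>I. norm (b p x))" for x
        unfolding g_def by (rule order.trans[OF norm_triangle_ineq4]) (intro add_left_mono norm_sum)
    qed
    also have "\<dots> = N + (\<Sum>p\<in>I. \<integral>x. norm (b p x) \<partial>torus)"
      using intN intbn intb by (subst Bochner_Integration.integral_add) (auto simp: N_def)
    also have "\<dots> \<le> N + (\<Sum>p\<in>I. 2 * fQ p)" using b1 by (intro add_left_mono sum_mono)
    also have "\<dots> \<le> 3 * N" using sumfQ by (simp add: sum_distrib_left[symmetric])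
    finally show ?thesis .
  qed
  have g2: "(\<integral>x. (norm (g x))\<^sup>2 \<partial>torus) \<le> 2 ^ ?n * \<mu> * (3 * N)"
  proof -
    have "(\<integral>x. (norm (g x))\<^sup>2 \<partial>torus) \<le> (\<integral>x. 2 ^ ?n * \<mu> * norm (g x) \<partial>torus)"
    proof (rule integral_mono_AE)
      show "integrable torus (\<lambda>x. (norm (g x))\<^sup>2)"
        by (rule integrable_torus_bounded[where B = "MB\<^sup>2"]) (use gb in \<open>auto intro: power_mono\<close>)
      show "integrable torus (\<lambda>x. 2 ^ ?n * \<mu> * norm (g x))" using intg by simp
      show "AE x in torus. (norm (g x))\<^sup>2 \<le> 2 ^ ?n * \<mu> * norm (g x)"
        using AE_torus_fund by eventually_elim (simp add: power2_eq_square mult_right_mono gfund)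
    qed
    also have "\<dots> = 2 ^ ?n * \<mu> * (\<integral>x. norm (g x) \<partial>torus)" by simp
    also have "\<dots> \<le> 2 ^ ?n * \<mu> * (3 * N)" using g1 mu by (intro mult_left_mono) auto
    finally show ?thesis .
  qed
  have split: "tmul a f x = tmul a g x + (\<Sum>p\<in>I. tmul a (b p) x)" for x
  proof -
    have "f = (\<lambda>x. g x + (\<Sum>p\<in>I. b p x))" by (simp add: g_def)
    then show ?thesis using tmul_add_sum[OF gm gb bm bb, where a = a and x = x and I = I] by simp
  qed
  \<comment> \<open>Cubes about the corner of a cell with half-side twice its side, wrapped around
    the torus: side r becomes side 4 r.\<close>
  define E where "E = (\<Union>p\<in>I. {x. x - c p \<in> nbhd (2 * r p)})"
  have Em [measurable]: "E \<in> sets borel" unfolding E_def using finI by (intro sets.finite_UN) auto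
  define h where "h x = (\<Sum>p\<in>I. norm (tmul a (b p) x))" for x
  have hm [measurable]: "h \<in> borel_measurable borel" unfolding h_def by measurable
  \<comment> \<open>Written with squares so that Markov's inequality applies to the L2 integral as
    it stands.\<close>
  define A1 where "A1 = {x. (\<mu> / 2)\<^sup>2 \<le> (norm (tmul a g x))\<^sup>2}"
  define A2 where "A2 = {x. x \<notin> E \<and> \<mu> / 2 < h x}"
  have A1m [measurable]: "A1 \<in> sets borel" and A2m [measurable]: "A2 \<in> sets borel"
    unfolding A1_def A2_def by measurable
  have cover: "{x. \<mu> < norm (tmul a f x)} \<subseteq> A1 \<union> E \<union> A2"
  proof
    fix x assume x: "x \<in> {x. \<mu> < norm (tmul a f x)}"
    have "norm (tmul a f x) \<le> norm (tmul a g x) + h x"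
      unfolding split h_def by (rule order.trans[OF norm_triangle_ineq]) (intro add_left_mono norm_sum)
    then have "\<mu> / 2 < norm (tmul a g x) \<or> \<mu> / 2 < h x" using x by auto
    then show "x \<in> A1 \<union> E \<union> A2"
    proof
      assume "\<mu> / 2 < norm (tmul a g x)"
      then have "(\<mu> / 2)\<^sup>2 \<le> (norm (tmul a g x))\<^sup>2" using mu by (intro power_mono) auto
      then show ?thesis by (simp add: A1_def)
    qed (auto simp: A2_def)
  qed
  have m1: "\<mu> * measure torus A1 \<le> 12 * 2 ^ ?n * B\<^sup>2 * N"
  proof -
    have "measure torus {x \<in> space torus. (\<mu> / 2)\<^sup>2 \<le> (norm (tmul a g x))\<^sup>2}
        \<le> (\<integral>x. (norm (tmul a g x))\<^sup>2 \<partial>torus) / (\<mu> / 2)\<^sup>2"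
      by (rule integral_Markov_inequality_measure[OF integrable_norm_tmul_sq, where A = "{}"]) (use mu in auto)
    then have "(\<mu> / 2)\<^sup>2 * measure torus A1 \<le> (\<integral>x. (norm (tmul a g x))\<^sup>2 \<partial>torus)"
      using mu by (simp add: A1_def field_simps)
    also have "\<dots> \<le> B\<^sup>2 * (\<integral>x. (norm (g x))\<^sup>2 \<partial>torus)" by (rule tmul_L2[OF gm gb fin a])
    also have "\<dots> \<le> B\<^sup>2 * (2 ^ ?n * \<mu> * (3 * N))" using g2 by (intro mult_left_mono) auto
    finally have "\<mu> * (\<mu> * measure torus A1) \<le> \<mu> * (12 * 2 ^ ?n * B\<^sup>2 * N)"
      by (simp add: power2_eq_square field_simps)
    then show ?thesis using mu by (rule mult_left_le_imp_le)
  qed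
  have m2: "\<mu> * measure torus E \<le> 4 ^ ?n * N"
  proof -
    have "measure torus E \<le> (\<Sum>p\<in>I. measure torus {x. x - c p \<in> nbhd (2 * r p)})"
      unfolding E_def by (rule torus.finite_measure_subadditive_finite[OF finI]) auto
    also have "\<dots> \<le> (\<Sum>p\<in>I. 4 ^ ?n * measure torus (Q p))"
    proof (rule sum_mono)
      fix p assume p: "p \<in> I"
      have "emeasure torus {x. x - c p \<in> nbhd (2 * r p)} \<le> ennreal ((2 * (2 * r p)) ^ ?n)"
        using r[of p] by (intro emeasure_nbhd_translate) auto
      then have "measure torus {x. x - c p \<in> nbhd (2 * r p)} \<le> (2 * (2 * r p)) ^ ?n"
        using r[of p] by (simp add: torus.emeasure_eq_measure)
      then show "measure torus {x. x - c p \<in> nbhd (2 * r p)} \<le> 4 ^ ?n * measure torus (Q p)"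
        unfolding mQ[OF p] by (simp add: power_mult_distrib)
    qed
    finally have "\<mu> * measure torus E \<le> \<mu> * (\<Sum>p\<in>I. 4 ^ ?n * measure torus (Q p))"
      using mu by (intro mult_left_mono) auto
    also have "\<dots> = 4 ^ ?n * (\<mu> * (\<Sum>p\<in>I. measure torus (Q p)))" by (simp add: sum_distrib_left[symmetric])
    also have "\<dots> \<le> 4 ^ ?n * N" using sumQ by (intro mult_left_mono) auto
    finally show ?thesis .
  qed
  have m3: "\<mu> * measure torus A2 \<le> 4 * H * N"
  proof -
    let ?D = "\<lambda>p x. indicator (- nbhd (2 * r p)) (x - c p) * ennreal (norm (tmul a (b p) x))"
    have "ennreal (\<mu> / 2) * emeasure torus A2 = (\<integral>\<^sup>+x. ennreal (\<mu> / 2) * indicator A2 x \<partial>torus)"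
      by (simp add: nn_integral_cmult_indicator)
    also have "\<dots> \<le> (\<integral>\<^sup>+x. (\<Sum>p\<in>I. ?D p x) \<partial>torus)"
    proof (rule nn_integral_mono)
      fix x
      show "ennreal (\<mu> / 2) * indicator A2 x \<le> (\<Sum>p\<in>I. ?D p x)"
      proof (cases "x \<in> A2")
        case True
        then have "(\<Sum>p\<in>I. ?D p x) = (\<Sum>p\<in>I. ennreal (norm (tmul a (b p) x)))"
          by (intro sum.cong) (auto simp: A2_def E_def)
        also have "\<dots> = ennreal (h x)" unfolding h_def by (rule sum_ennreal) simp
        finally show ?thesis using True by (auto simp: A2_def intro!: ennreal_leI)
      qed simp
    qed
    also have "\<dots> = (\<Sum>p\<in>I. \<integral>\<^sup>+x. ?D p x \<partial>torus)"
      by (rule nn_integral_sum) measurable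
    also have "\<dots> \<le> (\<Sum>p\<in>I. ennreal (H * (\<integral>x. norm (b p x) \<partial>torus)))"
    proof (rule sum_mono)
      fix p assume p: "p \<in> I"
      show "(\<integral>\<^sup>+x. ?D p x \<partial>torus)
          \<le> ennreal (H * (\<integral>x. norm (b p x) \<partial>torus))"
      proof (rule tmul_off_support[OF H bm bb[OF p] b0[OF p] r])
        fix y i assume "b p y \<noteq> 0"
        then have "y \<in> cell (fst p) (snd p)" by (auto simp: b_def Q_def indicator_def split: if_splits)
        then show "\<bar>y $ i - c p $ i\<bar> \<le> r p" using cell_corner[of y "fst p" "snd p" i] by (simp add: c_def r_def)
      qed
    qed
    also have "\<dots> = ennreal (\<Sum>p\<in>I. H * (\<integral>x. norm (b p x) \<partial>torus))"
      using H0 by (intro sum_ennreal) simp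
    also have "\<dots> \<le> ennreal (2 * H * N)"
    proof (rule ennreal_leI)
      have "(\<Sum>p\<in>I. H * (\<integral>x. norm (b p x) \<partial>torus)) \<le> (\<Sum>p\<in>I. H * (2 * fQ p))"
        using b1 H0 by (intro sum_mono mult_left_mono) auto
      also have "\<dots> = 2 * H * (\<Sum>p\<in>I. fQ p)" by (simp add: sum_distrib_left sum_distrib_right mult_ac)
      also have "\<dots> \<le> 2 * H * N" using sumfQ H0 by (intro mult_left_mono) auto
      finally show "(\<Sum>p\<in>I. H * (\<integral>x. norm (b p x) \<partial>torus)) \<le> 2 * H * N" .
    qed
    finally have "ennreal (\<mu> / 2 * measure torus A2) \<le> ennreal (2 * H * N)"
      using mu by (simp add: torus.emeasure_eq_measure ennreal_mult[symmetric])
    then have "\<mu> / 2 * measure torus A2 \<le> 2 * H * N" using H0 N0 by (subst (asm) ennreal_le_iff) auto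
    then show ?thesis by simp
  qed
  have "?m \<le> measure torus (A1 \<union> E \<union> A2)"
    by (rule torus.finite_measure_mono[OF cover]) simp
  also have "\<dots> \<le> measure torus A1 + measure torus E + measure torus A2"
    using measure_Un_le[of "A1 \<union> E" torus A2] measure_Un_le[of A1 torus E] by simp
  finally have "\<mu> * ?m \<le> \<mu> * (measure torus A1 + measure torus E + measure torus A2)"
    using mu by (intro mult_left_mono) auto
  also have "\<dots> \<le> weak_const ?n B H * N"
    using m1 m2 m3 by (simp add: weak_const_def distrib_left distrib_right)
  finally show ?thesis by (simp add: N_def)
qed

section \<open>From weak type to Lebesgue spaces below 1\<close>

lemma integrable_torus_iff:
  fixes F :: "real ^ 'n \<Rightarrow> 'b :: {banach, second_countable_topology}"
  assumes [measurable]: "F \<in> borel_measurable borel"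
  shows "integrable torus F \<longleftrightarrow> set_integrable lborel (cbox 0 1) F"
proof -
  have t: "torus = density lborel (\<lambda>x :: real ^ 'n. ennreal (indicator fund x))"
    by (simp add: torus_def ennreal_indicator)
  have "integrable torus F \<longleftrightarrow> integrable lborel (\<lambda>x. indicator fund x *\<^sub>R F x)"
    unfolding t by (rule integrable_density) auto
  also have "\<dots> \<longleftrightarrow> integrable lborel (\<lambda>x. indicator (cbox 0 1) x *\<^sub>R F x)"
    by (rule integrable_cong_AE) (use AE_fund_cbox in \<open>auto simp: indicator_def\<close>)
  finally show ?thesis by (simp add: set_integrable_def)
qed

text \<open>The 1 pays for the values up to s; the rest is a geometric series of ratio
  \<open>2 powr (p - 1)\<close>, convergent because p < 1.\<close>

definition lp_const :: "real \<Rightarrow> real \<Rightarrow> real" where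
  "lp_const p W = 1 + 2 * W * (2 powr p * (1 / (1 - 2 powr (p - 1))))"

lemma lp_const_pos: "0 < p \<Longrightarrow> p < 1 \<Longrightarrow> 0 \<le> W \<Longrightarrow> 0 < lp_const p W"
  using powr_less_mono[of "p - 1" 0 2] unfolding lp_const_def
  by (intro add_pos_nonneg mult_nonneg_nonneg divide_nonneg_nonneg) auto

text \<open>Values of F up to s contribute at most \<open>s powr p\<close> on a space of mass 1. On
  the layer where F lies between \<open>2 ^ i * s\<close> and \<open>2 ^ Suc i * s\<close> the weak
  bound gives measure at most \<open>2 * W / 2 ^ i\<close>, against a p-th power of at most
  \<open>(2 ^ Suc i * s) powr p\<close>.\<close>

lemma weak_type_imp_lp:
  fixes F :: "real ^ 'n \<Rightarrow> real"
  assumes [measurable]: "F \<in> borel_measurable borel" and F0: "\<And>x. 0 \<le> F x"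
    and W: "0 \<le> W" and s: "0 < s" and p: "0 < p" "p < 1"
    and wk: "\<And>\<mu>. 0 < \<mu> \<Longrightarrow> \<mu> * measure torus {x. \<mu> < F x} \<le> W * s"
  shows "(\<integral>\<^sup>+x. ennreal (F x powr p) \<partial>torus) \<le> ennreal (lp_const p W * s powr p)"
proof -
  define q where "q = 2 powr (p - 1)"
  have q: "0 < q" "q < 1" using p powr_less_mono[of "p - 1" 0 2] by (simp_all add: q_def)
  \<comment> \<open>The threshold is halved because the weak bound concerns a strict inequality
    while a layer includes its lower end.\<close>
  define A where "A i = {x. 2 ^ i * s / 2 < F x}" for i :: nat
  have [measurable]: "A i \<in> sets borel" for i unfolding A_def by measurable
  define c where "c i = (2 ^ Suc i * s) powr p" for i :: nat
  have pw: "ennreal (F x powr p) \<le> ennreal (s powr p) + (\<Sum>i. ennreal (c i) * indicator (A i) x)" for x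
  proof (cases "F x \<le> s")
    case True
    then have "F x powr p \<le> s powr p" using F0 p by (intro powr_mono2) auto
    then show ?thesis by (intro add_increasing2 ennreal_leI) auto
  next
    case False
    then have "1 \<le> F x / s" using s by simp
    then obtain i where i: "2 ^ i \<le> F x / s" "F x / s < 2 ^ Suc i" by (rule dyadic_level_exists)
    have "2 ^ i * s \<le> F x" and up: "F x \<le> 2 ^ Suc i * s" using i s by (simp_all add: field_simps)
    moreover have "0 < 2 ^ i * s" using s by simp
    ultimately have "x \<in> A i" unfolding A_def mem_Collect_eq by linarith
    moreover have "F x powr p \<le> c i" unfolding c_def using up F0 p by (intro powr_mono2) auto
    ultimately have "ennreal (F x powr p) \<le> ennreal (c i) * indicator (A i) x" by (simp add: ennreal_leI)
    also have "\<dots> \<le> (\<Sum>i. ennreal (c i) * indicator (A i) x)" by (rule ennreal_le_suminf)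
    finally show ?thesis by (rule add_increasing[OF zero_le])
  qed
  have lvl: "ennreal (c i) * emeasure torus (A i) \<le> ennreal (2 * W * (2 powr p * s powr p) * q ^ i)" for i
  proof -
    have ceq: "c i = 2 powr p * s powr p * (2 powr p) ^ i"
    proof -
      have "((2::real) ^ i) powr p = (2 powr p) ^ i"
        by (simp add: powr_realpow[symmetric] powr_powr mult.commute)
      then show ?thesis using s by (simp add: c_def powr_mult)
    qed
    have "2 ^ i * s / 2 * measure torus (A i) \<le> W * s"
      unfolding A_def using s by (intro wk) simp
    then have "measure torus (A i) \<le> 2 * W / 2 ^ i" using s by (simp add: field_simps)
    then have "c i * measure torus (A i) \<le> c i * (2 * W / 2 ^ i)" by (intro mult_left_mono) (auto simp: c_def)
    also have "\<dots> = 2 * W * (2 powr p * s powr p) * q ^ i"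
    proof -
      have "q = 2 powr p / 2" by (simp add: q_def powr_diff)
      then have "q ^ i = (2 powr p) ^ i / 2 ^ i" by (metis power_divide)
      then show ?thesis by (simp add: ceq)
    qed
    finally have "ennreal (c i * measure torus (A i)) \<le> ennreal (2 * W * (2 powr p * s powr p) * q ^ i)"
      by (rule ennreal_leI)
    then show ?thesis by (simp add: torus.emeasure_eq_measure ennreal_mult c_def)
  qed
  have "(\<integral>\<^sup>+x. ennreal (F x powr p) \<partial>torus)
      \<le> (\<integral>\<^sup>+x. ennreal (s powr p) + (\<Sum>i. ennreal (c i) * indicator (A i) x) \<partial>torus)"
    by (intro nn_integral_mono pw)
  also have "\<dots> = (\<integral>\<^sup>+(x :: real ^ 'n). ennreal (s powr p) \<partial>torus) + (\<integral>\<^sup>+x. (\<Sum>i. ennreal (c i) * indicator (A i) x) \<partial>torus)"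
    by (rule nn_integral_add) measurable
  also have "(\<integral>\<^sup>+(x :: real ^ 'n). ennreal (s powr p) \<partial>torus) = ennreal (s powr p)" by simp
  also have "(\<integral>\<^sup>+x. (\<Sum>i. ennreal (c i) * indicator (A i) x) \<partial>torus) = (\<Sum>i. ennreal (c i) * emeasure torus (A i))"
    by (subst nn_integral_suminf) (auto simp: nn_integral_cmult_indicator)
  also have "\<dots> \<le> (\<Sum>i. ennreal (2 * W * (2 powr p * s powr p) * q ^ i))"
    by (intro suminf_le lvl) auto
  also have "\<dots> = ennreal (2 * W * (2 powr p * s powr p) * (1 / (1 - q)))"
    using W q by (intro suminf_ennreal_eq sums_mult geometric_sums mult_nonneg_nonneg) auto
  also have "ennreal (s powr p) + \<dots> = ennreal (s powr p + 2 * W * (2 powr p * s powr p) * (1 / (1 - q)))"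
    using W q by (intro ennreal_plus[symmetric] mult_nonneg_nonneg) auto
  also have "s powr p + 2 * W * (2 powr p * s powr p) * (1 / (1 - q)) = lp_const p W * s powr p"
    by (simp add: lp_const_def q_def algebra_simps)
  finally show ?thesis by (simp add: add_left_mono)
qed

section \<open>From truncated symbols to the full multiplier\<close>

lemma fourier_coeff_eq_fc:
  assumes "continuous_on UNIV f"
  shows "fourier_coeff f \<xi> = fc f \<xi>"
proof -
  have [measurable]: "f \<in> borel_measurable borel" using assms by (rule borel_measurable_continuous_onI)
  have "exp (- \<i> * 2 * pi * of_real (x \<bullet> lattice_vec \<xi>)) = cnj (chr \<xi> x)" for x
  proof -
    have "cnj (chr \<xi> x) = cis (- (2 * pi * (x \<bullet> lattice_vec \<xi>)))" by (simp only: chr_def cis_cnj)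
    then show ?thesis by (simp add: cis_conv_exp mult_ac)
  qed
  then have "fourier_coeff f \<xi> = (LINT x : cbox 0 1 | lborel. cnj (chr \<xi> x) * f x)"
    by (simp add: fourier_coeff_def)
  also have "\<dots> = fc f \<xi>" unfolding fc_def by (rule integral_torus[symmetric]) measurable
  finally show ?thesis .
qed

lemma fourier_multiplier_eq:
  assumes "continuous_on UNIV f"
  shows "fourier_multiplier \<sigma> f x = (\<Sum>\<^sub>\<infinity>\<xi>. \<sigma> \<xi> * fc f \<xi> * chr \<xi> x)"
proof -
  have "exp (\<i> * 2 * pi * of_real (x \<bullet> lattice_vec \<xi>)) = chr \<xi> x" for \<xi>
    by (simp add: chr_def cis_conv_exp mult_ac)
  then show ?thesis by (simp add: fourier_multiplier_def fourier_coeff_eq_fc[OF assms] mult_ac)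
qed

lemma cutoff_tendsto_1:
  assumes "1 \<le> k"
  shows "(\<lambda>J. cutoff k (2 ^ J) \<xi>) \<longlonglongrightarrow> 1"
proof -
  have "(\<lambda>J. k * nsq \<xi> * (1 / 4) ^ J) \<longlonglongrightarrow> k * nsq \<xi> * 0"
    by (intro tendsto_mult_left LIMSEQ_power_zero) simp
  moreover have "norm (1 - cutoff k (2 ^ J) \<xi>) \<le> k * nsq \<xi> * (1 / 4) ^ J" for J
    using one_minus_cutoff_le[OF assms, of "2 ^ J" \<xi>] by (simp add: power_one_over four_power)
  ultimately have "(\<lambda>J. 1 - cutoff k (2 ^ J) \<xi>) \<longlonglongrightarrow> 0"
    by (intro Lim_null_comparison[where f = "\<lambda>J. 1 - cutoff k (2 ^ J) \<xi>"]) (auto intro: always_eventually)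
  then have "(\<lambda>J. 1 - (1 - cutoff k (2 ^ J) \<xi>)) \<longlonglongrightarrow> 1 - 0" by (intro tendsto_diff tendsto_const)
  then show ?thesis by simp
qed

text \<open>Dominated convergence for the counting measure on the lattice; the summable family is
  its own majorant, as the cutoff is at most 1 in modulus.\<close>

lemma tmul_cutoff_tendsto:
  fixes \<sigma> :: "int ^ 'n \<Rightarrow> complex"
  assumes k: "1 \<le> k" and sum: "(\<lambda>\<xi>. \<sigma> \<xi> * fc f \<xi> * chr \<xi> x) summable_on UNIV"
  shows "(\<lambda>J. tmul (\<lambda>\<xi>. \<sigma> \<xi> * cutoff k (2 ^ J) \<xi>) f x) \<longlonglongrightarrow> (\<Sum>\<^sub>\<infinity>\<xi>. \<sigma> \<xi> * fc f \<xi> * chr \<xi> x)"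
proof -
  let ?u = "\<lambda>\<xi>. \<sigma> \<xi> * fc f \<xi> * chr \<xi> x"
  let ?U = "count_space (UNIV :: (int ^ 'n) set)"
  have abs: "Infinite_Set_Sum.abs_summable_on ?u UNIV"
    using sum unfolding summable_on_iff_abs_summable_on_complex abs_summable_equivalent .
  then have int: "integrable ?U ?u" by (simp add: Infinite_Set_Sum.abs_summable_on_def)
  have lim: "(\<lambda>J. \<integral>\<xi>. cutoff k (2 ^ J) \<xi> * ?u \<xi> \<partial>?U) \<longlonglongrightarrow> (\<integral>\<xi>. ?u \<xi> \<partial>?U)"
  proof (rule integral_dominated_convergence[where w = "\<lambda>\<xi>. norm (?u \<xi>)"])
    show "integrable ?U (\<lambda>\<xi>. norm (?u \<xi>))" using int by simp
    show "AE \<xi> in ?U. (\<lambda>J. cutoff k (2 ^ J) \<xi> * ?u \<xi>) \<longlonglongrightarrow> ?u \<xi>"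
    proof (intro AE_I2)
      fix \<xi>
      have "(\<lambda>J. cutoff k (2 ^ J) \<xi> * ?u \<xi>) \<longlonglongrightarrow> 1 * ?u \<xi>"
        by (intro tendsto_mult_right cutoff_tendsto_1 k)
      then show "(\<lambda>J. cutoff k (2 ^ J) \<xi> * ?u \<xi>) \<longlonglongrightarrow> ?u \<xi>" by simp
    qed
    show "AE \<xi> in ?U. norm (cutoff k (2 ^ J) \<xi> * ?u \<xi>) \<le> norm (?u \<xi>)" for J
      unfolding norm_mult by (intro AE_I2 mult_left_le_one_le norm_cutoff_le) auto
  qed simp_all
  have fs: "(\<integral>\<xi>. cutoff k (2 ^ J) \<xi> * ?u \<xi> \<partial>?U) = tmul (\<lambda>\<xi>. \<sigma> \<xi> * cutoff k (2 ^ J) \<xi>) f x" for J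
  proof -
    have fin: "finite {\<xi>. \<sigma> \<xi> * cutoff k (2 ^ J) \<xi> \<noteq> 0}" by (rule tp_cutoff_decomposition(2)[OF k])
    have "(\<integral>\<xi>. cutoff k (2 ^ J) \<xi> * ?u \<xi> \<partial>?U) = (\<Sum>\<xi> | \<xi> \<in> UNIV \<and> cutoff k (2 ^ J) \<xi> * ?u \<xi> \<noteq> 0. cutoff k (2 ^ J) \<xi> * ?u \<xi>)"
      by (rule lebesgue_integral_count_space_finite_support) (rule finite_subset[OF _ fin], auto)
    also have "\<dots> = (\<Sum>\<xi> | \<sigma> \<xi> * cutoff k (2 ^ J) \<xi> \<noteq> 0. cutoff k (2 ^ J) \<xi> * ?u \<xi>)"
      by (rule sum.mono_neutral_left[OF fin]) auto
    finally show ?thesis by (simp add: tmul_def mult_ac)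
  qed
  have "(\<integral>\<xi>. ?u \<xi> \<partial>?U) = (\<Sum>\<^sub>\<infinity>\<xi>. ?u \<xi>)"
    using infsetsum_infsum[OF abs] by (simp add: infsetsum_def)
  with lim show ?thesis by (simp only: fs)
qed

text \<open>The sum of the constants over the finitely many pure multi-indices of order at most k
  serves all of them at once.\<close>

lemma symbol_pure_differences:
  fixes \<sigma> :: "int ^ 'n \<Rightarrow> complex" and C :: "nat ^ 'n \<Rightarrow> real"
  assumes C: "\<And>\<alpha>. multi_abs \<alpha> \<le> k \<Longrightarrow> C \<alpha> > 0"
    and \<sigma>: "\<And>\<alpha> \<xi>. multi_abs \<alpha> \<le> k \<Longrightarrow>
           norm (diff_op \<alpha> \<sigma> \<xi>) \<le> C \<alpha> * japanese \<xi> powr (- real (multi_abs \<alpha>))"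
  obtains B where "0 < B" "\<And>l m \<xi>. m \<le> k \<Longrightarrow> norm (fd l m \<sigma> \<xi>) \<le> B / japanese \<xi> ^ m"
proof -
  define \<alpha> where "\<alpha> l m = (\<chi> i. if i = l then m else (0 :: nat))" for l :: 'n and m
  have ma: "multi_abs (\<alpha> l m) = m" for l m by (simp add: \<alpha>_def multi_abs_pure)
  define B where "B = (\<Sum>(l, m)\<in>UNIV \<times> {..k}. C (\<alpha> l m))"
  have le: "C (\<alpha> l m) \<le> B" if "m \<le> k" for l m
  proof -
    have "(case (l, m) of (l, m) \<Rightarrow> C (\<alpha> l m)) \<le> B" unfolding B_def
    proof (rule member_le_sum)
      show "0 \<le> (case z of (l, m) \<Rightarrow> C (\<alpha> l m))" if "z \<in> UNIV \<times> {..k} - {(l, m)}" for z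
        using that C[of "\<alpha> (fst z) (snd z)"] ma by (auto simp: split_beta intro!: less_imp_le)
    qed (use that in auto)
    then show ?thesis by simp
  qed
  have "0 < C (\<alpha> undefined 0)" using ma by (intro C) simp
  also have "\<dots> \<le> B" by (rule le) simp
  finally have "0 < B" .
  moreover have "norm (fd l m \<sigma> \<xi>) \<le> B / japanese \<xi> ^ m" if "m \<le> k" for l m \<xi>
  proof -
    have "norm (fd l m \<sigma> \<xi>) \<le> C (\<alpha> l m) * japanese \<xi> powr (- real m)"
      using \<sigma>[of "\<alpha> l m" \<xi>] that by (simp add: ma) (simp add: \<alpha>_def diff_op_pure)
    also have "\<dots> \<le> B * japanese \<xi> powr (- real m)" by (intro mult_right_mono le that) simp
    also have "\<dots> = B / japanese \<xi> ^ m"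
      by (simp add: powr_minus powr_realpow divide_inverse)
    finally show ?thesis .
  qed
  ultimately show ?thesis by (rule that)
qed

lemma weak_const_nonneg: "0 \<le> H \<Longrightarrow> 0 \<le> weak_const n B H"
  by (simp add: weak_const_def)

theorem mainTheorem3:
  fixes \<sigma> :: "int ^ 'n \<Rightarrow> complex"
    and C :: "nat ^ 'n \<Rightarrow> real"
    and k :: nat
  assumes "k = CARD('n) div 2 + 1"
    and "\<And>\<alpha>. multi_abs \<alpha> \<le> k \<Longrightarrow> C \<alpha> > 0"
    and "\<And>\<alpha> \<xi>. multi_abs \<alpha> \<le> k \<Longrightarrow>
           norm (diff_op \<alpha> \<sigma> \<xi>) \<le> C \<alpha> * japanese \<xi> powr (- real (multi_abs \<alpha>))"
  shows "\<forall>p. 0 < p \<and> p < 1 \<longrightarrow> bounded_L1_Lp (fourier_multiplier \<sigma>) p"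
proof (intro allI impI)
  fix p :: real assume "0 < p \<and> p < 1"
  then have p: "0 < p" "p < 1" by auto
  \<comment> \<open>\<open>2 * k\<close> is n + 1 for odd n and n + 2 for even n.\<close>
  have k: "CARD('n) < 2 * k" "2 * k < CARD('n) + 4" "1 \<le> k" using assms(1) by auto
  obtain B where B: "0 < B" and \<sigma>: "\<And>l m \<xi>. m \<le> k \<Longrightarrow> norm (fd l m \<sigma> \<xi>) \<le> B / japanese \<xi> ^ m"
    using symbol_pure_differences[OF assms(2,3)] by blast
  have \<sigma>B: "norm (\<sigma> \<xi>) \<le> B" for \<xi> using \<sigma>[of 0 undefined \<xi>] by simp
  define a where "a J \<xi> = \<sigma> \<xi> * cutoff k (2 ^ J) \<xi>" for J \<xi>
  have aB: "norm (a J \<xi>) \<le> B" for J \<xi>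
    using mult_mono[OF \<sigma>B[of \<xi>] norm_cutoff_le[of k "2 ^ J" \<xi>]] B by (simp add: a_def norm_mult)
  have afin: "finite {\<xi>. a J \<xi> \<noteq> 0}" for J
    unfolding a_def by (rule tp_cutoff_decomposition(2)[OF k(3)])
  obtain H where H: "\<And>J. hormander (a J) H"
    unfolding a_def
  proof (rule hormander_condition[OF \<sigma> B k(1,2)])
    fix H assume *: "\<And>J. hormander (\<lambda>\<xi>. \<sigma> \<xi> * cutoff k (2 ^ J) \<xi>) H"
    show thesis by (rule that[of H]) (simp add: a_def[abs_def] *)
  qed
  then have H0: "0 \<le> H" by (simp add: hormander_def)
  define W where "W = weak_const CARD('n) B H"
  have W: "0 \<le> W" using H0 by (simp add: W_def weak_const_nonneg)
  define K where "K = lp_const p W"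
  have K: "0 < K" unfolding K_def by (rule lp_const_pos[OF p W])
  show "bounded_L1_Lp (fourier_multiplier \<sigma>) p"
    unfolding bounded_L1_Lp_def
  proof (intro exI[of _ "K powr (1 / p)"] conjI ballI)
    show "0 < K powr (1 / p)" using K by simp
    fix f :: "real ^ 'n \<Rightarrow> complex" assume f: "f \<in> torus_smooth"
    then have per: "lperiodic f" by (simp add: torus_smooth_def periodic_def lperiodic_def)
    have "times_cont_diff 0 f" using f unfolding torus_smooth_def by blast
    then have cont: "continuous_on UNIV f" by simp
    have [measurable]: "f \<in> borel_measurable borel" using cont by (rule borel_measurable_continuous_onI)
    define T where "T = fourier_multiplier \<sigma> f"
    define N where "N = (\<integral>x. norm (f x) \<partial>torus)"
    have N0: "0 \<le> N" by (simp add: N_def)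
    \<comment> \<open>The bound is stated for every s above N rather than for N, because
      \<open>weak_type_imp_lp\<close> splits at a positive level and N may be 0. The passage from s
      to N comes at the very end.\<close>
    have "T \<in> borel_measurable borel \<and>
        (\<forall>s>N. (\<integral>\<^sup>+x. ennreal (norm (T x) powr p) \<partial>torus) \<le> ennreal (K * s powr p))"
    proof (cases "(\<lambda>\<xi>. norm (\<sigma> \<xi> * fc f \<xi>)) summable_on UNIV")
      case False
      \<comment> \<open>Then the infinite sum takes its junk value 0, so the decay of \<open>fc f\<close> need not be proved.\<close>
      have "T x = 0" for x
      proof -
        have "\<not> (\<lambda>\<xi>. \<sigma> \<xi> * fc f \<xi> * chr \<xi> x) summable_on UNIV"
          using False unfolding summable_on_iff_abs_summable_on_complex by (simp add: norm_mult)
        then show ?thesis unfolding T_def fourier_multiplier_eq[OF cont] by (rule infsum_not_exists)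
      qed
      then have "T = (\<lambda>_. 0)" by auto
      then show ?thesis by simp
    next
      case True
      have "(\<lambda>\<xi>. \<sigma> \<xi> * fc f \<xi> * chr \<xi> x) summable_on UNIV" for x
        using True unfolding summable_on_iff_abs_summable_on_complex by (simp add: norm_mult)
      then have lim: "(\<lambda>J. tmul (a J) f x) \<longlonglongrightarrow> T x" for x
        unfolding T_def fourier_multiplier_eq[OF cont] a_def by (intro tmul_cutoff_tendsto k(3))
      have Tm: "T \<in> borel_measurable borel"
        by (rule borel_measurable_LIMSEQ_metric[OF _ lim]) simp
      have bd: "(\<integral>\<^sup>+x. ennreal (norm (T x) powr p) \<partial>torus) \<le> ennreal (K * s powr p)" if s: "N < s" for s
      proof -
        have s0: "0 < s" using s N0 by simp
        let ?F = "\<lambda>J x. ennreal (norm (tmul (a J) f x) powr p)"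
        have each: "(\<integral>\<^sup>+x. ?F J x \<partial>torus) \<le> ennreal (K * s powr p)" for J
          unfolding K_def
        proof (rule weak_type_imp_lp[OF _ _ W s0 p])
          fix \<mu> :: real assume mu: "0 < \<mu>"
          have "\<mu> * measure torus {x. \<mu> < norm (tmul (a J) f x)} \<le> W * N"
            unfolding W_def N_def by (rule weak_type[OF cont per mu afin aB H])
          also have "\<dots> \<le> W * s" using W s by (intro mult_left_mono) auto
          finally show "\<mu> * measure torus {x. \<mu> < norm (tmul (a J) f x)} \<le> W * s" .
        qed auto
        \<comment> \<open>Pointwise convergence identifies the integrand on the left of Fatou's
          lemma; the bounds \<open>each\<close> on the right are the same for all J.\<close>
        have "liminf (\<lambda>J. ?F J x) = ennreal (norm (T x) powr p)" for x
        proof (rule lim_imp_Liminf)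
          show "(\<lambda>J. ?F J x) \<longlonglongrightarrow> ennreal (norm (T x) powr p)"
            using p by (intro tendsto_ennrealI tendsto_powr' tendsto_norm lim tendsto_const) auto
        qed simp
        then have "(\<integral>\<^sup>+x. ennreal (norm (T x) powr p) \<partial>torus)
            = (\<integral>\<^sup>+x. liminf (\<lambda>J. ?F J x) \<partial>torus)" by simp
        also have "\<dots> \<le> liminf (\<lambda>J. \<integral>\<^sup>+x. ?F J x \<partial>torus)"
          by (rule nn_integral_liminf) measurable
        also have "\<dots> \<le> liminf (\<lambda>J :: nat. ennreal (K * s powr p))"
          by (intro Liminf_mono always_eventually allI each)
        also have "\<dots> = ennreal (K * s powr p)" by (rule Liminf_const) simp
        finally show ?thesis .
      qed
      show ?thesis using Tm bd by blast
    qed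
    then have Tm [measurable]: "T \<in> borel_measurable borel"
      and bd: "\<And>s. N < s \<Longrightarrow> (\<integral>\<^sup>+x. ennreal (norm (T x) powr p) \<partial>torus) \<le> ennreal (K * s powr p)" by auto
    have int: "integrable torus (\<lambda>x. norm (T x) powr p)"
    proof (rule integrableI_bounded)
      have "(\<integral>\<^sup>+x. ennreal (norm (norm (T x) powr p)) \<partial>torus) \<le> ennreal (K * (N + 1) powr p)"
        using bd[of "N + 1"] by simp
      also have "\<dots> < \<infinity>" by simp
      finally show "(\<integral>\<^sup>+x. ennreal (norm (norm (T x) powr p)) \<partial>torus) < \<infinity>" .
    qed measurable
    show "set_integrable lborel (cbox 0 1) (\<lambda>x. norm (fourier_multiplier \<sigma> f x) powr p)"
      using int unfolding T_def[symmetric] by (subst integrable_torus_iff[symmetric]) auto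
    define I where "I = (\<integral>x. norm (T x) powr p \<partial>torus)"
    have I0: "0 \<le> I" by (simp add: I_def)
    have Is: "I powr (1 / p) \<le> K powr (1 / p) * s" if s: "N < s" for s
    proof -
      have s0: "0 < s" using s N0 by simp
      have "ennreal I \<le> ennreal (K * s powr p)"
        using bd[OF s] int by (simp add: I_def nn_integral_eq_integral)
      then have "I \<le> K * s powr p" using K by (subst (asm) ennreal_le_iff) auto
      then have "I powr (1 / p) \<le> (K * s powr p) powr (1 / p)" using I0 p by (intro powr_mono2) auto
      also have "\<dots> = K powr (1 / p) * s" using K s0 p by (simp add: powr_mult powr_powr)
      finally show ?thesis .
    qed
    have "I powr (1 / p) \<le> K powr (1 / p) * N"
    proof (rule field_le_epsilon)
      fix e :: real assume e: "0 < e"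
      \<comment> \<open>The excess of s over N is scaled so that the constant turns it into exactly
        e.\<close>
      have "0 < K powr (1 / p)" using K by simp
      then show "I powr (1 / p) \<le> K powr (1 / p) * N + e"
        using Is[of "N + e / K powr (1 / p)"] e by (simp add: distrib_left)
    qed
    moreover have "I = (LINT x : cbox 0 1 | lborel. norm (T x) powr p)"
      unfolding I_def by (rule integral_torus) measurable
    moreover have "N = (LINT x : cbox 0 1 | lborel. norm (f x))"
      unfolding N_def by (rule integral_torus) measurable
    ultimately show "(LINT x : cbox 0 1 | lborel. norm (fourier_multiplier \<sigma> f x) powr p) powr (1 / p)
        \<le> K powr (1 / p) * (LINT x : cbox 0 1 | lborel. norm (f x))"
      by (simp add: T_def)
  qed
qed

end
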